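(* Work in $\mathbf{CZF}$ and assume NID. Then all W-types exist: for every function $f:B\to A$ between sets there is an initial $P_f$-algebra.
   Context: For $f:B\to A$ and $a\in A$ write $B_a=f^{-1}(a)$. The polynomial functor $P_f$ sends a set $X$ to $P_f(X)=\{(a,t):a\in A,\ t:B_a\to X\}$ and $\alpha:X\to Y$ to $P_f(\alpha)(a,t)=(a,\alpha\circ t)$. A $P_f$-algebra is a set $X$ with a function $s:P_f(X)\to X$; a morphism $(X,s)\to(Y,t)$ is $\alpha:X\to Y$ with $\alpha\circ s=t\circ P_f(\alpha)$; an initial $P_f$-algebra (the W-type of $f$) has a unique morphism to every algebra. A rule on a set $X$ is a pair $(a,b)$ of subsets of $X$; $Y\subseteq X$ is closed under it if $a\subseteq Y$ implies $b\cap Y$ inhabited. A class $M$ of subsets of $X$ is set-generated if there is a set $G\subseteq M$ with $\forall\alpha\in M\,\forall x\in\alpha\,\exists\beta\in G\,x\in\beta\subseteq\alpha$. NID: for every set $X$ and set $\mathcal R$ of rules on $X$, the class of subsets of $X$ closed under all rules in $\mathcal R$ is set-generated. *)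

theory Defs
  imports Main
begin

text \<open>
  The claim is about provability in the intuitionistic first-order theory CZF, so that theory is
  represented as an object language with its own derivability relation: the classical logic of HOL
  must not be available inside CZF.
\<close>

section \<open>Intuitionistic first-order logic with equality\<close>

text \<open>
  Formulas in the language of set theory, with de Bruijn indices. The only terms are variables, so
  that substitution is renaming of variables.
\<close>

datatype fm =
    Falsum
  | Mem nat nat
  | Eq nat nat
  | And fm fm
  | Or fm fm
  | Imp fm fm
  | All fm
  | Ex fm

fun under :: "(nat \<Rightarrow> nat) \<Rightarrow> nat \<Rightarrow> nat" where
  "under r 0 = 0"
| "under r (Suc i) = Suc (r i)"

primrec rename :: "(nat \<Rightarrow> nat) \<Rightarrow> fm \<Rightarrow> fm" where
  "rename r Falsum = Falsum"
| "rename r (Mem x y) = Mem (r x) (r y)"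
| "rename r (Eq x y) = Eq (r x) (r y)"
| "rename r (And p q) = And (rename r p) (rename r q)"
| "rename r (Or p q) = Or (rename r p) (rename r q)"
| "rename r (Imp p q) = Imp (rename r p) (rename r q)"
| "rename r (All p) = All (rename (under r) p)"
| "rename r (Ex p) = Ex (rename (under r) p)"

definition lift :: "fm \<Rightarrow> fm" where
  "lift p = rename Suc p"

definition inst :: "fm \<Rightarrow> nat \<Rightarrow> fm" where
  "inst p t = rename (\<lambda>i. case i of 0 \<Rightarrow> t | Suc j \<Rightarrow> j) p"

text \<open>
  Natural deduction from axioms \<open>T\<close> and hypotheses \<open>H\<close>. Free variables of hypotheses are fixed,
  hence the lifting in \<open>AllI\<close> and \<open>ExE\<close>; free variables of axioms are not, so that an axiom stands
  for its universal closure.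
\<close>

inductive deriv :: "fm set \<Rightarrow> fm set \<Rightarrow> fm \<Rightarrow> bool" for T :: "fm set" where
  Axiom: "p \<in> T \<Longrightarrow> deriv T H p"
| Hyp: "p \<in> H \<Longrightarrow> deriv T H p"
| FalsumE: "deriv T H Falsum \<Longrightarrow> deriv T H p"
| AndI: "deriv T H p \<Longrightarrow> deriv T H q \<Longrightarrow> deriv T H (And p q)"
| AndE1: "deriv T H (And p q) \<Longrightarrow> deriv T H p"
| AndE2: "deriv T H (And p q) \<Longrightarrow> deriv T H q"
| OrI1: "deriv T H p \<Longrightarrow> deriv T H (Or p q)"
| OrI2: "deriv T H q \<Longrightarrow> deriv T H (Or p q)"
| OrE: "deriv T H (Or p q) \<Longrightarrow> deriv T (insert p H) c \<Longrightarrow> deriv T (insert q H) c \<Longrightarrow> deriv T H c"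
| ImpI: "deriv T (insert p H) q \<Longrightarrow> deriv T H (Imp p q)"
| ImpE: "deriv T H (Imp p q) \<Longrightarrow> deriv T H p \<Longrightarrow> deriv T H q"
| AllI: "deriv T (lift ` H) p \<Longrightarrow> deriv T H (All p)"
| AllE: "deriv T H (All p) \<Longrightarrow> deriv T H (inst p t)"
| ExI: "deriv T H (inst p t) \<Longrightarrow> deriv T H (Ex p)"
| ExE: "deriv T H (Ex p) \<Longrightarrow> deriv T (insert p (lift ` H)) (lift c) \<Longrightarrow> deriv T H c"
| EqRefl: "deriv T H (Eq x x)"
| EqSubst: "deriv T H (Eq x y) \<Longrightarrow> deriv T H (inst p x) \<Longrightarrow> deriv T H (inst p y)"

definition proves :: "fm set \<Rightarrow> fm \<Rightarrow> bool"  (infix "\<turnstile>" 40) where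
  "T \<turnstile> p \<longleftrightarrow> deriv T {} p"

section \<open>Writing formulas with named variables\<close>

text \<open>
  A \<open>form\<close> is a formula to be placed under \<open>n\<close> binders, as a function of \<open>n\<close>. Variables bound by
  these binders are referred to by level, counted from the outermost binder; the level \<open>x\<close> is the de
  Bruijn index \<open>n - 1 - x\<close>. A quantifier under \<open>n\<close> binders binds the level \<open>n\<close>, which allows
  HOL-bound variables to be used as names for object variables.
\<close>

type_synonym form = "nat \<Rightarrow> fm"

definition mem :: "nat \<Rightarrow> nat \<Rightarrow> form"  (infix "\<^bold>\<in>" 50) where
  "x \<^bold>\<in> y = (\<lambda>n. Mem (n - 1 - x) (n - 1 - y))"

definition eq :: "nat \<Rightarrow> nat \<Rightarrow> form"  (infix "\<^bold>=" 50) where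
  "x \<^bold>= y = (\<lambda>n. Eq (n - 1 - x) (n - 1 - y))"

definition falsum :: form  ("\<^bold>\<bottom>") where
  "\<^bold>\<bottom> = (\<lambda>n. Falsum)"

definition conj :: "form \<Rightarrow> form \<Rightarrow> form"  (infixr "\<^bold>\<and>" 35) where
  "(p \<^bold>\<and> q) = (\<lambda>n. And (p n) (q n))"

definition disj :: "form \<Rightarrow> form \<Rightarrow> form"  (infixr "\<^bold>\<or>" 30) where
  "(p \<^bold>\<or> q) = (\<lambda>n. Or (p n) (q n))"

definition imp :: "form \<Rightarrow> form \<Rightarrow> form"  (infixr "\<^bold>\<longrightarrow>" 25) where
  "(p \<^bold>\<longrightarrow> q) = (\<lambda>n. Imp (p n) (q n))"

definition iff :: "form \<Rightarrow> form \<Rightarrow> form"  (infixr "\<^bold>\<longleftrightarrow>" 25) where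
  "(p \<^bold>\<longleftrightarrow> q) = ((p \<^bold>\<longrightarrow> q) \<^bold>\<and> (q \<^bold>\<longrightarrow> p))"

definition all :: "(nat \<Rightarrow> form) \<Rightarrow> form"  (binder "\<^bold>\<forall>" 10) where
  "all P = (\<lambda>n. All (P n (Suc n)))"

definition ex :: "(nat \<Rightarrow> form) \<Rightarrow> form"  (binder "\<^bold>\<exists>" 10) where
  "ex P = (\<lambda>n. Ex (P n (Suc n)))"

definition ball :: "nat \<Rightarrow> (nat \<Rightarrow> form) \<Rightarrow> form" where
  "ball a P = (\<^bold>\<forall>x. x \<^bold>\<in> a \<^bold>\<longrightarrow> P x)"

definition bex :: "nat \<Rightarrow> (nat \<Rightarrow> form) \<Rightarrow> form" where
  "bex a P = (\<^bold>\<exists>x. x \<^bold>\<in> a \<^bold>\<and> P x)"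

definition ex1 :: "(nat \<Rightarrow> form) \<Rightarrow> form"  (binder "\<^bold>\<exists>\<^bold>!" 10) where
  "ex1 P = (\<^bold>\<exists>x. P x \<^bold>\<and> (\<^bold>\<forall>y. P y \<^bold>\<longrightarrow> y \<^bold>= x))"

text \<open>
  \<open>app p [x\<^sub>0, \<dots>, x\<^sub>k]\<close> is the formula \<open>p\<close> with its variables \<open>0, \<dots>, k\<close> replaced by
  \<open>x\<^sub>0, \<dots>, x\<^sub>k\<close>. The remaining variables of \<open>p\<close> are kept as parameters, out of reach of the \<open>n\<close>
  surrounding binders.
\<close>

definition app :: "fm \<Rightarrow> nat list \<Rightarrow> form" where
  "app p xs =
     (\<lambda>n. rename (\<lambda>i. if i < length xs then n - 1 - xs ! i else n + (i - length xs)) p)"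

definition toplevel :: "form \<Rightarrow> fm" where
  "toplevel p = p 0"

section \<open>The axioms of CZF\<close>

inductive bounded :: "fm \<Rightarrow> bool" where
  "bounded Falsum"
| "bounded (Mem x y)"
| "bounded (Eq x y)"
| "bounded p \<Longrightarrow> bounded q \<Longrightarrow> bounded (And p q)"
| "bounded p \<Longrightarrow> bounded q \<Longrightarrow> bounded (Or p q)"
| "bounded p \<Longrightarrow> bounded q \<Longrightarrow> bounded (Imp p q)"
| "bounded p \<Longrightarrow> bounded (All (Imp (Mem 0 (Suc a)) p))"
| "bounded p \<Longrightarrow> bounded (Ex (And (Mem 0 (Suc a)) p))"

definition subset :: "nat \<Rightarrow> nat \<Rightarrow> form"  (infix "\<^bold>\<subseteq>" 50) where
  "a \<^bold>\<subseteq> b = ball a (\<lambda>x. x \<^bold>\<in> b)"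

definition Extensionality :: form where
  "Extensionality = (\<^bold>\<forall>a. \<^bold>\<forall>b. (\<^bold>\<forall>x. x \<^bold>\<in> a \<^bold>\<longleftrightarrow> x \<^bold>\<in> b) \<^bold>\<longrightarrow> a \<^bold>= b)"

definition Pairing :: form where
  "Pairing = (\<^bold>\<forall>a. \<^bold>\<forall>b. \<^bold>\<exists>c. \<^bold>\<forall>x. x \<^bold>\<in> c \<^bold>\<longleftrightarrow> x \<^bold>= a \<^bold>\<or> x \<^bold>= b)"

definition Union :: form where
  "Union = (\<^bold>\<forall>a. \<^bold>\<exists>c. \<^bold>\<forall>x. x \<^bold>\<in> c \<^bold>\<longleftrightarrow> bex a (\<lambda>y. x \<^bold>\<in> y))"

definition is_empty :: "nat \<Rightarrow> form" where
  "is_empty x = (\<^bold>\<forall>z. z \<^bold>\<in> x \<^bold>\<longrightarrow> \<^bold>\<bottom>)"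

definition is_successor :: "nat \<Rightarrow> nat \<Rightarrow> form" where
  "is_successor y x = (\<^bold>\<forall>z. z \<^bold>\<in> y \<^bold>\<longleftrightarrow> z \<^bold>\<in> x \<^bold>\<or> z \<^bold>= x)"

definition is_inductive :: "nat \<Rightarrow> form" where
  "is_inductive a =
     (bex a (\<lambda>x. is_empty x) \<^bold>\<and> ball a (\<lambda>x. bex a (\<lambda>y. is_successor y x)))"

definition Infinity :: form where
  "Infinity = (\<^bold>\<exists>a. is_inductive a \<^bold>\<and> (\<^bold>\<forall>b. is_inductive b \<^bold>\<longrightarrow> a \<^bold>\<subseteq> b))"

definition Set_Induction :: "fm \<Rightarrow> form" where
  "Set_Induction p =
     ((\<^bold>\<forall>x. ball x (\<lambda>y. app p [y]) \<^bold>\<longrightarrow> app p [x]) \<^bold>\<longrightarrow> (\<^bold>\<forall>x. app p [x]))"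

definition Separation :: "fm \<Rightarrow> form" where
  "Separation p = (\<^bold>\<forall>a. \<^bold>\<exists>b. \<^bold>\<forall>x. x \<^bold>\<in> b \<^bold>\<longleftrightarrow> x \<^bold>\<in> a \<^bold>\<and> app p [x])"

definition Strong_Collection :: "fm \<Rightarrow> form" where
  "Strong_Collection p =
     (\<^bold>\<forall>a. ball a (\<lambda>x. \<^bold>\<exists>y. app p [x, y]) \<^bold>\<longrightarrow>
       (\<^bold>\<exists>b. ball a (\<lambda>x. bex b (\<lambda>y. app p [x, y])) \<^bold>\<and>
            ball b (\<lambda>y. bex a (\<lambda>x. app p [x, y]))))"

definition Subset_Collection :: "fm \<Rightarrow> form" where
  "Subset_Collection p =
     (\<^bold>\<forall>a. \<^bold>\<forall>b. \<^bold>\<exists>c. \<^bold>\<forall>u. ball a (\<lambda>x. bex b (\<lambda>y. app p [x, y, u])) \<^bold>\<longrightarrow>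
       bex c (\<lambda>d. ball a (\<lambda>x. bex d (\<lambda>y. app p [x, y, u])) \<^bold>\<and>
                  ball d (\<lambda>y. bex a (\<lambda>x. app p [x, y, u]))))"

definition CZF :: "fm set" where
  "CZF =
     toplevel ` ({Extensionality, Pairing, Union, Infinity}
       \<union> {Set_Induction p | p. True}
       \<union> {Separation p | p. bounded p}
       \<union> {Strong_Collection p | p. True}
       \<union> {Subset_Collection p | p. True})"

section \<open>Non-deterministic inductive definitions\<close>

definition is_upair :: "nat \<Rightarrow> nat \<Rightarrow> nat \<Rightarrow> form" where
  "is_upair p x y = (\<^bold>\<forall>z. z \<^bold>\<in> p \<^bold>\<longleftrightarrow> z \<^bold>= x \<^bold>\<or> z \<^bold>= y)"

text \<open>Kuratowski pairs: \<open>p = {{x}, {x, y}}\<close>.\<close>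

definition is_pair :: "nat \<Rightarrow> nat \<Rightarrow> nat \<Rightarrow> form" where
  "is_pair p x y = (\<^bold>\<forall>z. z \<^bold>\<in> p \<^bold>\<longleftrightarrow> is_upair z x x \<^bold>\<or> is_upair z x y)"

definition pair_mem :: "nat \<Rightarrow> nat \<Rightarrow> nat \<Rightarrow> form" where
  "pair_mem x y r = bex r (\<lambda>p. is_pair p x y)"

definition is_rule_set :: "nat \<Rightarrow> nat \<Rightarrow> form" where
  "is_rule_set R X = ball R (\<lambda>r. \<^bold>\<exists>a. \<^bold>\<exists>b. is_pair r a b \<^bold>\<and> a \<^bold>\<subseteq> X \<^bold>\<and> b \<^bold>\<subseteq> X)"

definition is_closed :: "nat \<Rightarrow> nat \<Rightarrow> form" where
  "is_closed R Y =
     (\<^bold>\<forall>a. \<^bold>\<forall>b. pair_mem a b R \<^bold>\<longrightarrow> a \<^bold>\<subseteq> Y \<^bold>\<longrightarrow> (\<^bold>\<exists>z. z \<^bold>\<in> b \<^bold>\<and> z \<^bold>\<in> Y))"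

definition set_generated :: "(nat \<Rightarrow> form) \<Rightarrow> form" where
  "set_generated M =
     (\<^bold>\<exists>G. ball G M \<^bold>\<and>
        (\<^bold>\<forall>\<alpha>. M \<alpha> \<^bold>\<longrightarrow> ball \<alpha> (\<lambda>x. bex G (\<lambda>\<beta>. x \<^bold>\<in> \<beta> \<^bold>\<and> \<beta> \<^bold>\<subseteq> \<alpha>))))"

definition NID :: form where
  "NID = (\<^bold>\<forall>X. \<^bold>\<forall>R. is_rule_set R X \<^bold>\<longrightarrow> set_generated (\<lambda>Y. Y \<^bold>\<subseteq> X \<^bold>\<and> is_closed R Y))"

section \<open>W-types\<close>

text \<open>A function is a set of pairs; \<open>is_function f X Y\<close> says \<open>f : X \<rightarrow> Y\<close>.\<close>

definition is_function :: "nat \<Rightarrow> nat \<Rightarrow> nat \<Rightarrow> form" where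
  "is_function f X Y =
     (ball f (\<lambda>p. bex X (\<lambda>x. bex Y (\<lambda>y. is_pair p x y))) \<^bold>\<and>
      ball X (\<lambda>x. \<^bold>\<exists>\<^bold>!y. pair_mem x y f))"

definition is_composite :: "nat \<Rightarrow> nat \<Rightarrow> nat \<Rightarrow> form" where
  "is_composite h g f =
     (\<^bold>\<forall>p. p \<^bold>\<in> h \<^bold>\<longleftrightarrow>
        (\<^bold>\<exists>x. \<^bold>\<exists>y. \<^bold>\<exists>z. is_pair p x z \<^bold>\<and> pair_mem x y f \<^bold>\<and> pair_mem y z g))"

text \<open>\<open>D = B\<^sub>a\<close>, the fibre of \<open>f : B \<rightarrow> A\<close> over \<open>a\<close>.\<close>

definition is_fibre :: "nat \<Rightarrow> nat \<Rightarrow> nat \<Rightarrow> nat \<Rightarrow> form" where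
  "is_fibre D f B a = (\<^bold>\<forall>b. b \<^bold>\<in> D \<^bold>\<longleftrightarrow> b \<^bold>\<in> B \<^bold>\<and> pair_mem b a f)"

text \<open>\<open>P = P\<^sub>f(X)\<close>.\<close>

definition is_Pf :: "nat \<Rightarrow> nat \<Rightarrow> nat \<Rightarrow> nat \<Rightarrow> nat \<Rightarrow> form" where
  "is_Pf f B A P X =
     (\<^bold>\<forall>p. p \<^bold>\<in> P \<^bold>\<longleftrightarrow>
        bex A (\<lambda>a. \<^bold>\<exists>t. is_pair p a t \<^bold>\<and>
                        (\<^bold>\<exists>D. is_fibre D f B a \<^bold>\<and> is_function t D X)))"

text \<open>\<open>m = P\<^sub>f(\<alpha>)\<close> for a function \<open>\<alpha>\<close> with domain \<open>X\<close>.\<close>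

definition is_Pf_map :: "nat \<Rightarrow> nat \<Rightarrow> nat \<Rightarrow> nat \<Rightarrow> nat \<Rightarrow> nat \<Rightarrow> form" where
  "is_Pf_map f B A m \<alpha> X =
     (\<^bold>\<exists>P. is_Pf f B A P X \<^bold>\<and>
        (\<^bold>\<forall>q. q \<^bold>\<in> m \<^bold>\<longleftrightarrow>
           (\<^bold>\<exists>u. \<^bold>\<exists>v. is_pair q u v \<^bold>\<and> u \<^bold>\<in> P \<^bold>\<and>
              (\<^bold>\<exists>a. \<^bold>\<exists>t. \<^bold>\<exists>t'. is_pair u a t \<^bold>\<and> is_pair v a t' \<^bold>\<and> is_composite t' \<alpha> t))))"

definition is_algebra :: "nat \<Rightarrow> nat \<Rightarrow> nat \<Rightarrow> nat \<Rightarrow> nat \<Rightarrow> form" where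
  "is_algebra f B A X s = (\<^bold>\<exists>P. is_Pf f B A P X \<^bold>\<and> is_function s P X)"

definition is_morphism ::
    "nat \<Rightarrow> nat \<Rightarrow> nat \<Rightarrow> nat \<Rightarrow> nat \<Rightarrow> nat \<Rightarrow> nat \<Rightarrow> nat \<Rightarrow> form" where
  "is_morphism f B A \<alpha> X s Y t =
     (is_function \<alpha> X Y \<^bold>\<and>
      (\<^bold>\<exists>m. \<^bold>\<exists>h. is_Pf_map f B A m \<alpha> X \<^bold>\<and> is_composite h \<alpha> s \<^bold>\<and> is_composite h t m))"

definition is_initial_algebra :: "nat \<Rightarrow> nat \<Rightarrow> nat \<Rightarrow> nat \<Rightarrow> nat \<Rightarrow> form" where
  "is_initial_algebra f B A W w =
     (is_algebra f B A W w \<^bold>\<and>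
      (\<^bold>\<forall>Y. \<^bold>\<forall>t. is_algebra f B A Y t \<^bold>\<longrightarrow> (\<^bold>\<exists>\<^bold>!\<alpha>. is_morphism f B A \<alpha> W w Y t)))"

definition W_types_exist :: form where
  "W_types_exist =
     (\<^bold>\<forall>A. \<^bold>\<forall>B. \<^bold>\<forall>f. is_function f B A \<^bold>\<longrightarrow> (\<^bold>\<exists>W. \<^bold>\<exists>w. is_initial_algebra f B A W w))"

end

theory Submission
  imports Defs "HOL-Library.Countable_Set"
begin

text \<open>
  By Kripke completeness of intuitionistic logic it suffices to show that every Kripke model of CZF
  and NID forces the existence of W-types, so that each step is a first-order statement about
  forcing.

  In CZF, a tree with branching given by \<open>f : B \<rightarrow> A\<close> is the set of its labelled paths. The
  condition that every node of a tree carries some label is a non-deterministic rule on the set of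
  paths, and trees are the minimal sets closed under these rules. Every closed set is inhabited, so
  a minimal one belongs to every set that generates the closed sets. Hence, by NID and bounded
  separation, the minimal closed sets form a set \<open>T\<close>, and forming a tree from its root label and
  its subtrees is an injective partial operation on \<open>T\<close>. By NID again, a set of rules with one
  conclusion each has a least closed set. This gives the set \<open>W \<subseteq> T\<close> of well-founded trees, and for
  every algebra \<open>Y\<close> the graph of the morphism \<open>W \<rightarrow> Y\<close> as a subset of \<open>W \<times> Y\<close>, which is
  functional, and the only morphism, by induction on \<open>W\<close>.
\<close>

section \<open>Renaming and derivability\<close>

text \<open>Forcing turns disjunctions and existential statements into plain HOL case splits at one
  world, while implications and universal statements speak about all later worlds; hence most
  notions come with a monotonicity lemma. The obstacle is predicativity: without power sets, and
  with Separation for bounded formulas only, a class such as "all closed subsets" cannot be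
  collected into a set. Every set is therefore exhibited by a concrete formula, bounded for
  Separation and arbitrary for Collection, together with a lemma computing when that formula is
  forced. NID stands in for the power set, because quantifying over a generating set is bounded.
  Equality on A and B is not decidable, so a tree cannot be altered at one node by a case
  distinction. Minimality of a closed set takes the role of choosing one label per node, and a
  family of minimal closed sets can be joined below a root without deciding whether two edges are
  equal. The second use of NID asks for rules with one conclusion because closed sets of such rules
  are stable under intersection.\<close>

primrec fv :: "fm \<Rightarrow> nat set" where
  "fv Falsum = {}"
| "fv (Mem x y) = {x, y}"
| "fv (Eq x y) = {x, y}"
| "fv (And p q) = fv p \<union> fv q"
| "fv (Or p q) = fv p \<union> fv q"
| "fv (Imp p q) = fv p \<union> fv q"
| "fv (All p) = {i. Suc i \<in> fv p}"
| "fv (Ex p) = {i. Suc i \<in> fv p}"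

lemma finite_fv: "finite (fv p)"
  by (induction p) (auto simp: finite_vimageI[where h = Suc, unfolded vimage_def])

lemma rename_cong: "(\<And>i. i \<in> fv p \<Longrightarrow> r i = s i) \<Longrightarrow> rename r p = rename s p"
proof (induction p arbitrary: r s)
  case (All p)
  have "under r i = under s i" if "i \<in> fv p" for i
    using that All.prems by (cases i) auto
  then show ?case using All.IH[of "under r" "under s"] by simp
next
  case (Ex p)
  have "under r i = under s i" if "i \<in> fv p" for i
    using that Ex.prems by (cases i) auto
  then show ?case using Ex.IH[of "under r" "under s"] by simp
next
  case (And p q)
  show ?case using And.IH[of r s] And.prems by simp
next
  case (Or p q)
  show ?case using Or.IH[of r s] Or.prems by simp
next
  case (Imp p q)
  show ?case using Imp.IH[of r s] Imp.prems by simp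
qed auto

lemma under_comp: "under r (under s i) = under (\<lambda>i. r (s i)) i"
  by (cases i) auto

lemma rename_rename: "rename r (rename s p) = rename (\<lambda>i. r (s i)) p"
  by (induction p arbitrary: r s) (auto simp: under_comp)

lemma rename_ident: "(\<And>i. i \<in> fv p \<Longrightarrow> r i = i) \<Longrightarrow> rename r p = p"
proof -
  have "under (\<lambda>i. i) = (\<lambda>i. i)"
  proof
    show "under (\<lambda>i. i) i = i" for i by (cases i) auto
  qed
  then have "rename (\<lambda>i. i) p = p" by (induction p) auto
  then show "(\<And>i. i \<in> fv p \<Longrightarrow> r i = i) \<Longrightarrow> rename r p = p"
    by (metis rename_cong)
qed

lemma fv_rename: "fv (rename r p) = r ` fv p"
proof (induction p arbitrary: r)
  case (All p)
  have "{i. Suc i \<in> under r ` fv p} = r ` {i. Suc i \<in> fv p}"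
  proof (intro equalityI subsetI)
    fix i assume "i \<in> {i. Suc i \<in> under r ` fv p}"
    then obtain j where j: "j \<in> fv p" "Suc i = under r j" by auto
    then show "i \<in> r ` {i. Suc i \<in> fv p}" by (cases j) auto
  qed (force simp: image_iff)
  then show ?case using All by simp
next
  case (Ex p)
  have "{i. Suc i \<in> under r ` fv p} = r ` {i. Suc i \<in> fv p}"
  proof (intro equalityI subsetI)
    fix i assume "i \<in> {i. Suc i \<in> under r ` fv p}"
    then obtain j where j: "j \<in> fv p" "Suc i = under r j" by auto
    then show "i \<in> r ` {i. Suc i \<in> fv p}" by (cases j) auto
  qed (force simp: image_iff)
  then show ?case using Ex by simp
qed auto

lemma rename_lift: "rename (under r) (lift p) = lift (rename r p)"
  by (simp add: lift_def rename_rename)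

lemma inst_rename_under: "inst (rename (under r) p) t = rename (case_nat t r) p"
  unfolding inst_def rename_rename
  by (rule rename_cong) (metis nat.case not0_implies_Suc under.simps)

lemma rename_inst: "rename r (inst p t) = inst (rename (under r) p) (r t)"
  unfolding inst_rename_under unfolding inst_def rename_rename
  by (rule rename_cong) (auto split: nat.split)

lemma fv_inst: "fv (inst p t) \<subseteq> insert t (fv (All p))"
  unfolding inst_def fv_rename by (auto split: nat.split)

lemma deriv_weaken: "deriv T H p \<Longrightarrow> H \<subseteq> H' \<Longrightarrow> deriv T H' p"
proof (induction arbitrary: H' rule: deriv.induct)
  case (OrE H p q c)
  then show ?case by (meson deriv.OrE insert_mono)
next
  case (ImpI p H q)
  then show ?case by (meson deriv.ImpI insert_mono)
next
  case (AllI H p)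
  then show ?case by (meson deriv.AllI image_mono)
next
  case (ExE H p c)
  then show ?case by (meson deriv.ExE image_mono insert_mono)
next
  case (EqSubst H x y p)
  then show ?case by (blast intro: deriv.EqSubst[of T H' x y p])
next
  case (FalsumE H p)
  then show ?case by (blast intro: deriv.FalsumE)
next
  case (AndE1 H p q)
  then show ?case by (blast intro: deriv.AndE1)
next
  case (AndE2 H p q)
  then show ?case by (blast intro: deriv.AndE2)
next
  case (ImpE H p q)
  then show ?case by (blast intro: deriv.ImpE[of T H' p q])
next
  case (AllE H p t)
  then show ?case by (blast intro: deriv.AllE)
next
  case (ExI H p t)
  then show ?case by (blast intro: deriv.ExI[of T H' p t])
qed (auto intro: deriv.Axiom deriv.Hyp deriv.AndI deriv.OrI1 deriv.OrI2 deriv.EqRefl)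

text \<open>Without hypotheses \<open>AllI\<close> applies to every theorem, so generalising and
  instantiating in turn substitutes for the variables below \<open>n\<close> one at a time. Each
  instantiation moves the remaining variables down by one, which accounts for
  \<open>i - n\<close>.\<close>

lemma deriv_generalize:
  "deriv T {} p \<Longrightarrow> deriv T {} (rename (\<lambda>i. if i < n then r i else i - n) p)"
proof (induction n arbitrary: r)
  case 0
  then show ?case by (simp add: rename_ident)
next
  case (Suc n)
  \<comment> \<open>Variable \<open>n\<close> has become index 0, ready to be generalised; the
    values already inserted are raised by one to survive the next instantiation.\<close>
  let ?q = "rename (\<lambda>i. if i < n then Suc (r i) else i - n) p"
  have "deriv T {} ?q" using Suc.IH[of "\<lambda>i. Suc (r i)"] Suc.prems by simp
  then have "deriv T (lift ` {}) ?q" by simp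
  then have "deriv T {} (inst ?q (r n))" by (intro deriv.AllE deriv.AllI)
  moreover have "inst ?q (r n) = rename (\<lambda>i. if i < Suc n then r i else i - Suc n) p"
    unfolding inst_def rename_rename
  proof (rule rename_cong)
    fix i
    show "(case if i < n then Suc (r i) else i - n of 0 \<Rightarrow> r n | Suc j \<Rightarrow> j) =
      (if i < Suc n then r i else i - Suc n)"
      by (cases "i < n"; cases "i = n") (auto split: nat.split)
  qed
  ultimately show ?case by simp
qed

lemma deriv_rename_closed: assumes "deriv T {} p" shows "deriv T H (rename r p)"
proof -
  obtain n where n: "\<And>i. i \<in> fv p \<Longrightarrow> i < n"
    using finite_fv[of p] by (meson finite_nat_set_iff_bounded)
  have "deriv T {} (rename (\<lambda>i. if i < n then r i else i - n) p)"
    using deriv_generalize[OF assms] .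
  also have "rename (\<lambda>i. if i < n then r i else i - n) p = rename r p"
    by (rule rename_cong) (simp add: n)
  finally show ?thesis by (rule deriv_weaken) simp
qed

text \<open>\<open>T\<close> need not be closed under renaming. In the axiom case the renamed
  formula is derived by generalising the axiom; the remaining rules commute with renaming.\<close>

lemma deriv_rename: "deriv T H p \<Longrightarrow> deriv T (rename r ` H) (rename r p)"
proof (induction arbitrary: r rule: deriv.induct)
  case (Axiom p H)
  then show ?case by (intro deriv_rename_closed deriv.Axiom)
next
  case (OrE H p q c)
  show ?case
    by (rule deriv.OrE[where p = "rename r p" and q = "rename r q"])
      (use OrE.IH[of r] in auto)
next
  case (AllI H p)
  have "rename (under r) ` lift ` H = lift ` rename r ` H"
    by (auto simp: image_image rename_lift)
  then show ?case using AllI.IH[of "under r"] by (auto intro: deriv.AllI)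
next
  case (AllE H p t)
  then show ?case by (simp add: rename_inst deriv.AllE)
next
  case (ExI H p t)
  then show ?case by (auto simp: rename_inst intro: deriv.ExI)
next
  case (ExE H p c)
  have "rename (under r) ` lift ` H = lift ` rename r ` H"
    by (auto simp: image_image rename_lift)
  then show ?case using ExE.IH(1)[of r] ExE.IH(2)[of "under r"]
    by (auto simp: rename_lift intro: deriv.ExE)
next
  case (EqSubst H x y p)
  show ?case
    using deriv.EqSubst[of T "rename r ` H" "r x" "r y" "rename (under r) p"] EqSubst.IH[of r]
    by (simp add: rename_inst)
next
  case (FalsumE H p)
  then show ?case by (auto intro: deriv.FalsumE)
next
  case (AndE1 H p q)
  show ?case using AndE1.IH[of r] by (auto intro: deriv.AndE1)
next
  case (AndE2 H p q)
  show ?case using AndE2.IH[of r] by (auto intro: deriv.AndE2)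
next
  case (ImpE H p q)
  show ?case using ImpE.IH[of r] by (auto intro: deriv.ImpE)
next
  case (ImpI H p q)
  show ?case using ImpI.IH[of r] by (auto intro: deriv.ImpI)
qed (auto intro: deriv.Hyp deriv.AndI deriv.OrI1 deriv.OrI2 deriv.EqRefl)

text \<open>The delicate cases are \<open>AllI\<close> and \<open>ExE\<close>: a finite set of
  lifted hypotheses has to be pulled back to a finite set of original ones.\<close>

lemma deriv_compact: "deriv T H p \<Longrightarrow> \<exists>F. finite F \<and> F \<subseteq> H \<and> deriv T F p"
proof (induction rule: deriv.induct)
  case (Axiom p H)
  then show ?case by (meson deriv.Axiom empty_subsetI finite.emptyI)
next
  case (Hyp p H)
  then show ?case by (intro exI[of _ "{p}"]) (auto intro: deriv.Hyp)
next
  case (AndI H p q)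
  then obtain F G where "finite F" "F \<subseteq> H" "deriv T F p" "finite G" "G \<subseteq> H" "deriv T G q" by auto
  then show ?case
    by (intro exI[of _ "F \<union> G"]) (auto intro!: deriv.AndI intro: deriv_weaken)
next
  case (OrE H p q c)
  then obtain F G K where *: "finite F" "F \<subseteq> H" "deriv T F (Or p q)"
      "finite G" "G \<subseteq> insert p H" "deriv T G c" "finite K" "K \<subseteq> insert q H" "deriv T K c"
    by auto
  let ?U = "F \<union> (G - {p}) \<union> (K - {q})"
  have "deriv T ?U c"
    by (rule deriv.OrE[of _ _ p q]) (rule deriv_weaken[OF *(3)] deriv_weaken[OF *(6)] deriv_weaken[OF *(9)]; auto)+
  then show ?case using * by (intro exI[of _ ?U]) auto
next
  case (ImpI p H q)
  then obtain F where "finite F" "F \<subseteq> insert p H" "deriv T F q" by auto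
  then show ?case
    by (intro exI[of _ "F - {p}"]) (auto intro!: deriv.ImpI intro: deriv_weaken)
next
  case (ImpE H p q)
  then obtain F G where "finite F" "F \<subseteq> H" "deriv T F (Imp p q)" "finite G" "G \<subseteq> H" "deriv T G p" by auto
  then show ?case
    by (intro exI[of _ "F \<union> G"]) (auto intro!: deriv.ImpE[of T _ p q] intro: deriv_weaken)
next
  case (AllI H p)
  then obtain F where F: "finite F" "F \<subseteq> lift ` H" "deriv T F p" by auto
  then obtain G where "finite G" "G \<subseteq> H" "F = lift ` G" by (meson finite_subset_image)
  then show ?case using F by (auto intro: deriv.AllI)
next
  case (ExE H p c)
  then obtain F G where *: "finite F" "F \<subseteq> H" "deriv T F (Ex p)"
      "finite G" "G \<subseteq> insert p (lift ` H)" "deriv T G (lift c)"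
    by auto
  then have "finite (G - {p})" "G - {p} \<subseteq> lift ` H" by auto
  then obtain K where K: "finite K" "K \<subseteq> H" "G - {p} = lift ` K" by (meson finite_subset_image)
  have "deriv T (F \<union> K) c"
    by (rule deriv.ExE[of _ _ p])
      (rule deriv_weaken[OF *(3)] deriv_weaken[OF *(6)]; use K in auto)+
  then show ?case using * K by (intro exI[of _ "F \<union> K"]) auto
next
  case (EqSubst H x y p)
  then obtain F G where "finite F" "F \<subseteq> H" "deriv T F (Eq x y)" "finite G" "G \<subseteq> H" "deriv T G (inst p x)" by auto
  then show ?case
    by (intro exI[of _ "F \<union> G"]) (auto intro!: deriv.EqSubst[of T _ x y p] intro: deriv_weaken)
next
  case (FalsumE H p)
  then show ?case by (blast intro: deriv.FalsumE)
next
  case (AndE1 H p q)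
  then show ?case by (blast intro: deriv.AndE1)
next
  case (AndE2 H p q)
  then show ?case by (blast intro: deriv.AndE2)
next
  case (OrI1 H p q)
  then show ?case by (blast intro: deriv.OrI1)
next
  case (OrI2 H p q)
  then show ?case by (blast intro: deriv.OrI2)
next
  case (AllE H p t)
  then show ?case by (blast intro: deriv.AllE)
next
  case (ExI H p t)
  then show ?case by (blast intro: deriv.ExI[of T _ p t])
next
  case (EqRefl H x)
  then show ?case using deriv.EqRefl by blast
qed

lemma deriv_cut: "deriv T (insert p H) q \<Longrightarrow> deriv T H p \<Longrightarrow> deriv T H q"
  by (meson deriv.ImpI deriv.ImpE)

text \<open>Renaming \<open>x\<close> to \<open>0\<close> and every other \<open>i\<close> to \<open>i + 1\<close> turns a fresh variable into the
  de Bruijn index of a binder.\<close>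

lemma rename_fresh:
  assumes "x \<notin> fv p"
  shows "rename (\<lambda>i. if i = x then 0 else Suc i) p = lift p"
  unfolding lift_def by (rule rename_cong) (use assms in auto)

lemma rename_inst_fresh:
  assumes "x \<notin> fv (All p)"
  shows "rename (\<lambda>i. if i = x then 0 else Suc i) (inst p x) = p"
  unfolding inst_def rename_rename
  by (rule rename_ident) (use assms in \<open>auto split: nat.split\<close>)

lemma deriv_AllI_fresh:
  assumes "deriv T H (inst p x)" "\<And>q. q \<in> H \<Longrightarrow> x \<notin> fv q" "x \<notin> fv (All p)"
  shows "deriv T H (All p)"
proof -
  let ?r = "\<lambda>i. if i = x then 0 else Suc i"
  have "rename ?r ` H = lift ` H" using assms(2) by (intro image_cong) (auto simp: rename_fresh)
  then show ?thesis
    using deriv_rename[OF assms(1), of ?r] rename_inst_fresh[OF assms(3)] by (auto intro: deriv.AllI)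
qed

text \<open>Read contrapositively, this is the Henkin step: adding a witness at a fresh variable for
  an existential hypothesis cannot make \<open>c\<close> derivable.\<close>

lemma deriv_ExE_fresh:
  assumes "deriv T (insert (inst p x) H) c" "deriv T H (Ex p)"
    and "\<And>q. q \<in> H \<Longrightarrow> x \<notin> fv q" "x \<notin> fv (All p)" "x \<notin> fv c"
  shows "deriv T H c"
proof -
  let ?r = "\<lambda>i. if i = x then 0 else Suc i"
  have "rename ?r ` H = lift ` H" using assms(3) by (intro image_cong) (auto simp: rename_fresh)
  then show ?thesis
    using deriv_rename[OF assms(1), of ?r] assms(2) rename_inst_fresh[OF assms(4)]
      rename_fresh[OF assms(5)]
    by (auto intro: deriv.ExE)
qed

section \<open>Kripke completeness\<close>

instance fm :: countable
  by countable_datatype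

text \<open>Variables in \<open>V\<close> serve as constants naming the elements of a world. The
  complement of \<open>V\<close> stays infinite so that every world leaves room for the witnesses of
  later worlds.\<close>

definition prime_theory :: "fm set \<Rightarrow> nat set \<Rightarrow> fm set \<Rightarrow> bool" where
  "prime_theory T V G \<longleftrightarrow> infinite (- V) \<and> V \<noteq> {} \<and> (\<forall>p\<in>G. fv p \<subseteq> V) \<and> Falsum \<notin> G \<and>
     (\<forall>p. fv p \<subseteq> V \<longrightarrow> deriv T G p \<longrightarrow> p \<in> G) \<and>
     (\<forall>p q. Or p q \<in> G \<longrightarrow> p \<in> G \<or> q \<in> G) \<and>
     (\<forall>p. Ex p \<in> G \<longrightarrow> (\<exists>x\<in>V. inst p x \<in> G))"

text \<open>One part of the free variables supplies the witnesses of the world under construction,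
  the other part remains for its extensions. The split takes the even and odd positions of an
  injective enumeration.\<close>

lemma infinite_split:
  fixes A :: "nat set"
  assumes "infinite A"
  obtains S where "S \<subseteq> A" "infinite S" "infinite (A - S)"
proof -
  obtain f :: "nat \<Rightarrow> nat" where f: "inj f" "range f \<subseteq> A"
    using assms infinite_countable_subset by blast
  have "inj (\<lambda>n. f (2 * n))" "inj (\<lambda>n. f (2 * n + 1))"
    by (rule injI, drule injD[OF f(1)], simp)+
  then have inf: "infinite (range (\<lambda>n. f (2 * n)))" "infinite (range (\<lambda>n. f (2 * n + 1)))"
    using range_inj_infinite by blast+
  have neq: "f (2 * m) \<noteq> f (2 * n + 1)" for m n
  proof
    assume "f (2 * m) = f (2 * n + 1)"
    then have "2 * m = 2 * n + 1" by (rule injD[OF f(1)])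
    then show False by presburger
  qed
  have "range (\<lambda>n. f (2 * n + 1)) \<subseteq> A - range (\<lambda>n. f (2 * n))"
  proof (rule image_subsetI, rule DiffI)
    show "f (2 * n + 1) \<in> A" for n using f(2) by (rule subsetD) (rule rangeI)
    show "f (2 * n + 1) \<notin> range (\<lambda>n. f (2 * n))" for n
      using neq by (metis rangeE)
  qed
  then have "infinite (A - range (\<lambda>n. f (2 * n)))" using inf(2) infinite_super by blast
  moreover have "range (\<lambda>n. f (2 * n)) \<subseteq> A" using f(2) by auto
  ultimately show thesis using that inf(1) by blast
qed

text \<open>Lindenbaum-Henkin construction along an enumeration of all formulas, keeping
  \<open>c\<close> underivable. Primeness comes from the same invariant: if two disjuncts are both
  rejected, each derives \<open>c\<close>, and so does their disjunction.\<close>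

lemma prime_theory_extension:
  assumes "infinite (- V)" "V \<noteq> {}" "\<And>p. p \<in> H \<Longrightarrow> fv p \<subseteq> V" "fv c \<subseteq> V" "\<not> deriv T H c"
  obtains V' G where "prime_theory T V' G" "V \<subseteq> V'" "H \<subseteq> G" "c \<notin> G"
proof -
  obtain S where S: "S \<subseteq> - V" "infinite S" "infinite (- V - S)"
    using infinite_split[OF assms(1)] .
  define V' where "V' = V \<union> S"
  define ok where "ok F \<longleftrightarrow> finite F \<and> (\<forall>p\<in>F. fv p \<subseteq> V') \<and> \<not> deriv T (H \<union> F) c" for F
  \<comment> \<open>Stage \<open>n\<close> settles the formula with code \<open>n\<close>: it
    enters, with a witness if it is existential, or it is rejected because it would derive
    \<open>c\<close>.\<close>
  define step where "step n F F' \<longleftrightarrow> F \<subseteq> F' \<and> (let p = from_nat n in fv p \<subseteq> V' \<longrightarrow>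
    p \<in> F' \<and> (\<forall>q. p = Ex q \<longrightarrow> (\<exists>x\<in>V'. inst q x \<in> F')) \<or> deriv T (H \<union> insert p F) c)" for n F F'
  have "\<exists>f. \<forall>n. ok (f n) \<and> step n (f n) (f (Suc n))"
  proof (rule dependent_nat_choice)
    show "\<exists>F. ok F" using assms(5) by (intro exI[of _ "{}"]) (simp add: ok_def)
  next
    fix F n assume F: "ok F"
    define p :: fm where "p = from_nat n"
    show "\<exists>F'. ok F' \<and> step n F F'"
    proof (cases "fv p \<subseteq> V' \<and> \<not> deriv T (H \<union> insert p F) c")
      case False
      then show ?thesis using F by (intro exI[of _ F]) (auto simp: step_def p_def Let_def)
    next
      case p: True
      show ?thesis
      proof (cases "\<exists>q. p = Ex q")
        case False
        then show ?thesis using F p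
          by (intro exI[of _ "insert p F"]) (auto simp: ok_def step_def p_def[symmetric] Let_def)
      next
        case True
        then obtain q where q: "p = Ex q" by blast
        \<comment> \<open>Only finitely many formulas were added so far, and \<open>H\<close>
          mentions variables of \<open>V\<close> only, which is disjoint from the infinite
          \<open>S\<close>; hence some variable of \<open>S\<close> is fresh for everything.\<close>
        have "finite (fv p \<union> (\<Union>r\<in>F. fv r))" using F finite_fv by (auto simp: ok_def)
        then obtain x where x: "x \<in> S" "x \<notin> fv p" "\<And>r. r \<in> F \<Longrightarrow> x \<notin> fv r"
        proof -
          have "\<not> S \<subseteq> fv p \<union> (\<Union>r\<in>F. fv r)"
            using S(2) \<open>finite (fv p \<union> _)\<close> by (meson finite_subset)
          then show ?thesis using that by blast
        qed
        have xV: "x \<notin> V" using x S by blast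
        have "\<not> deriv T (insert (inst q x) (H \<union> insert p F)) c"
        proof
          assume "deriv T (insert (inst q x) (H \<union> insert p F)) c"
          then have "deriv T (H \<union> insert p F) c"
          proof (rule deriv_ExE_fresh)
            show "deriv T (H \<union> insert p F) (Ex q)" using q by (auto intro: deriv.Hyp)
            show "x \<notin> fv r" if "r \<in> H \<union> insert p F" for r
              using that x xV assms(3) by auto
            show "x \<notin> fv (All q)" using x q by simp
            show "x \<notin> fv c" using xV assms(4) by blast
          qed
          then show False using p by blast
        qed
        moreover have "fv (inst q x) \<subseteq> V'" using fv_inst[of q x] p x q by (auto simp: V'_def)
        ultimately show ?thesis using F p q x
          by (intro exI[of _ "insert (inst q x) (insert p F)"])
            (auto simp: ok_def step_def p_def[symmetric] Let_def V'_def)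
      qed
    qed
  qed
  then obtain f where ok: "\<And>n. ok (f n)" and step: "\<And>n. step n (f n) (f (Suc n))" by blast
  have mono: "f m \<subseteq> f n" if "m \<le> n" for m n
  proof (rule lift_Suc_mono_le[OF _ that])
    show "f n \<subseteq> f (Suc n)" for n using step[of n] unfolding step_def by (rule conjunct1)
  qed
  define G where "G = H \<union> (\<Union>n. f n)"
  have G: "fv p \<subseteq> V'" if p: "p \<in> G" for p
  proof -
    consider "p \<in> H" | n where "p \<in> f n" using p by (auto simp: G_def)
    then show ?thesis
    proof cases
      case 1
      then show ?thesis using assms(3)[of p] by (auto simp: V'_def)
    next
      case 2
      then show ?thesis using ok[of n] by (auto simp: ok_def)
    qed
  qed
  have Gc: "\<not> deriv T G c"
  proof
    assume "deriv T G c"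
    from deriv_compact[OF this] obtain F where F: "finite F" "F \<subseteq> G" "deriv T F c" by auto
    have "\<exists>n. F \<subseteq> H \<union> f n"
      using F(1) F(2)
    proof (induction F rule: finite_induct)
      case (insert p F)
      then obtain n m where "F \<subseteq> H \<union> f n" "p \<in> H \<union> f m" by (auto simp: G_def)
      then have "insert p F \<subseteq> H \<union> f (max m n)"
        using mono[of n "max m n"] mono[of m "max m n"] by auto
      then show ?case by blast
    qed auto
    then obtain n where "F \<subseteq> H \<union> f n" ..
    then have "deriv T (H \<union> f n) c" using F(3) by (rule deriv_weaken[rotated])
    then show False using ok[of n] by (simp add: ok_def)
  qed
  \<comment> \<open>The limit inherits the alternative of the single stages; maximality, primeness
    and witnesses are all read off from it.\<close>
  have dec: "p \<in> G \<and> (\<forall>q. p = Ex q \<longrightarrow> (\<exists>x\<in>V'. inst q x \<in> G)) \<or> deriv T (insert p G) c"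
    if "fv p \<subseteq> V'" for p
  proof -
    have "p \<in> f (Suc (to_nat p)) \<and> (\<forall>q. p = Ex q \<longrightarrow> (\<exists>x\<in>V'. inst q x \<in> f (Suc (to_nat p)))) \<or>
        deriv T (H \<union> insert p (f (to_nat p))) c"
      using step[of "to_nat p"] that by (simp add: step_def Let_def)
    then show ?thesis
    proof
      assume "deriv T (H \<union> insert p (f (to_nat p))) c"
      then have "deriv T (insert p G) c" by (rule deriv_weaken) (auto simp: G_def)
      then show ?thesis ..
    next
      have "f (Suc (to_nat p)) \<subseteq> G" by (auto simp: G_def)
      moreover assume "p \<in> f (Suc (to_nat p)) \<and>
        (\<forall>q. p = Ex q \<longrightarrow> (\<exists>x\<in>V'. inst q x \<in> f (Suc (to_nat p))))"
      ultimately show ?thesis by blast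
    qed
  qed
  have closed: "p \<in> G" if "fv p \<subseteq> V'" "deriv T G p" for p
    using dec[OF that(1)] deriv_cut[OF _ that(2), of c] Gc by argo
  have "prime_theory T V' G"
    unfolding prime_theory_def
  proof (intro conjI allI impI ballI)
    show "infinite (- V')" using S(3) by (simp add: V'_def Diff_eq)
    show "Falsum \<notin> G" using Gc deriv.FalsumE[OF deriv.Hyp, of G T c] by argo
    show "p \<in> G \<or> q \<in> G" if "Or p q \<in> G" for p q
    proof (rule ccontr)
      assume "\<not> (p \<in> G \<or> q \<in> G)"
      then have "deriv T (insert p G) c" "deriv T (insert q G) c"
        using dec[of p] dec[of q] G[OF that] by auto
      then show False using Gc deriv.OrE[OF deriv.Hyp[OF that], of T c] by argo
    qed
    show "\<exists>x\<in>V'. inst p x \<in> G" if "Ex p \<in> G" for p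
      using dec[OF G[OF that]] Gc that by (simp add: insert_absorb)
    show "V' \<noteq> {}" using assms(2) by (simp add: V'_def)
  qed (fact G closed)+
  then show thesis
  proof (rule that)
    show "V \<subseteq> V'" "H \<subseteq> G" by (auto simp: V'_def G_def)
    show "c \<notin> G" using Gc deriv.Hyp[of c G T] by argo
  qed
qed

text \<open>Equality is a monotone congruence instead of identity: in the canonical model the
  elements are variables, which a later world may identify.\<close>

locale kripke =
  fixes le :: "'w \<Rightarrow> 'w \<Rightarrow> bool"  (infix "\<sqsubseteq>" 50)
    and D :: "'w \<Rightarrow> 'd \<Rightarrow> bool"
    and M :: "'w \<Rightarrow> 'd \<Rightarrow> 'd \<Rightarrow> bool"
    and E :: "'w \<Rightarrow> 'd \<Rightarrow> 'd \<Rightarrow> bool"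
  assumes le_refl: "w \<sqsubseteq> w"
    and le_trans: "u \<sqsubseteq> v \<Longrightarrow> v \<sqsubseteq> w \<Longrightarrow> u \<sqsubseteq> w"
    and D_mono: "D v x \<Longrightarrow> v \<sqsubseteq> w \<Longrightarrow> D w x"
    and M_mono: "M v x y \<Longrightarrow> v \<sqsubseteq> w \<Longrightarrow> M w x y"
    and E_mono: "E v x y \<Longrightarrow> v \<sqsubseteq> w \<Longrightarrow> E w x y"
    and M_D: "M w x y \<Longrightarrow> D w x \<and> D w y"
    and E_D: "E w x y \<Longrightarrow> D w x \<and> D w y"
    and E_refl: "D w x \<Longrightarrow> E w x x"
    and E_sym: "E w x y \<Longrightarrow> E w y x"
    and E_trans: "E w x y \<Longrightarrow> E w y z \<Longrightarrow> E w x z"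
    and M_cong: "M w x y \<Longrightarrow> E w x x' \<Longrightarrow> E w y y' \<Longrightarrow> M w x' y'"
begin

primrec sat :: "fm \<Rightarrow> 'w \<Rightarrow> (nat \<Rightarrow> 'd) \<Rightarrow> bool" where
  "sat Falsum w r \<longleftrightarrow> False"
| "sat (Mem x y) w r \<longleftrightarrow> M w (r x) (r y)"
| "sat (Eq x y) w r \<longleftrightarrow> E w (r x) (r y)"
| "sat (And p q) w r \<longleftrightarrow> sat p w r \<and> sat q w r"
| "sat (Or p q) w r \<longleftrightarrow> sat p w r \<or> sat q w r"
| "sat (Imp p q) w r \<longleftrightarrow> (\<forall>v. w \<sqsubseteq> v \<longrightarrow> sat p v r \<longrightarrow> sat q v r)"
| "sat (All p) w r \<longleftrightarrow> (\<forall>v. w \<sqsubseteq> v \<longrightarrow> (\<forall>x. D v x \<longrightarrow> sat p v (case_nat x r)))"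
| "sat (Ex p) w r \<longleftrightarrow> (\<exists>x. D w x \<and> sat p w (case_nat x r))"

end

text \<open>A world of the canonical model is a prime theory together with the set of variables that
  serves as its domain.\<close>

definition cworld :: "fm set \<Rightarrow> nat set \<times> fm set \<Rightarrow> bool" where
  "cworld T w \<longleftrightarrow> prime_theory T (fst w) (snd w)"

text \<open>The type contains pairs that are not prime theories. The disjunct \<open>v = w\<close>
  keeps the order reflexive there, and the other components of the model are empty at such
  pairs.\<close>

definition cle :: "fm set \<Rightarrow> nat set \<times> fm set \<Rightarrow> nat set \<times> fm set \<Rightarrow> bool" where
  "cle T v w \<longleftrightarrow> v = w \<or> cworld T v \<and> cworld T w \<and> fst v \<subseteq> fst w \<and> snd v \<subseteq> snd w"

definition cdom :: "fm set \<Rightarrow> nat set \<times> fm set \<Rightarrow> nat \<Rightarrow> bool" where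
  "cdom T w x \<longleftrightarrow> cworld T w \<and> x \<in> fst w"

definition cmem :: "fm set \<Rightarrow> nat set \<times> fm set \<Rightarrow> nat \<Rightarrow> nat \<Rightarrow> bool" where
  "cmem T w x y \<longleftrightarrow> cworld T w \<and> Mem x y \<in> snd w"

definition ceq :: "fm set \<Rightarrow> nat set \<times> fm set \<Rightarrow> nat \<Rightarrow> nat \<Rightarrow> bool" where
  "ceq T w x y \<longleftrightarrow> cworld T w \<and> Eq x y \<in> snd w"

section \<open>The canonical model\<close>

lemma cworld_closed: "cworld T w \<Longrightarrow> fv p \<subseteq> fst w \<Longrightarrow> deriv T (snd w) p \<Longrightarrow> p \<in> snd w"
  by (auto simp: cworld_def prime_theory_def)

lemma cworld_fv: "cworld T w \<Longrightarrow> p \<in> snd w \<Longrightarrow> fv p \<subseteq> fst w"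
  by (auto simp: cworld_def prime_theory_def)

text \<open>Substitution into a template: index 0 marks the place to be replaced, and
  \<open>Suc\<close> protects the variable that must stay.\<close>

lemma deriv_Eq_sym: "deriv T H (Eq x y) \<Longrightarrow> deriv T H (Eq y x)"
  using deriv.EqSubst[of T H x y "Eq 0 (Suc x)"] by (simp add: inst_def deriv.EqRefl)

lemma deriv_Eq_trans: "deriv T H (Eq x y) \<Longrightarrow> deriv T H (Eq y z) \<Longrightarrow> deriv T H (Eq x z)"
  using deriv.EqSubst[of T H y z "Eq (Suc x) 0"] by (simp add: inst_def)

lemma deriv_Mem_cong:
  "deriv T H (Mem x y) \<Longrightarrow> deriv T H (Eq x x') \<Longrightarrow> deriv T H (Eq y y') \<Longrightarrow> deriv T H (Mem x' y')"
  using deriv.EqSubst[of T H x x' "Mem 0 (Suc y)"] deriv.EqSubst[of T H y y' "Mem (Suc x') 0"]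
  by (simp add: inst_def)

interpretation canonical: kripke "cle T" "cdom T" "cmem T" "ceq T" for T
proof
  show "ceq T w x x" if "cdom T w x" for w x
    using that cworld_closed[of T w "Eq x x"] by (auto simp: cdom_def ceq_def deriv.EqRefl)
  show "ceq T w y x" if "ceq T w x y" for w x y
    using that cworld_closed[of T w "Eq y x"] cworld_fv[of T w "Eq x y"]
    by (auto simp: ceq_def intro: deriv_Eq_sym deriv.Hyp)
  show "ceq T w x z" if "ceq T w x y" "ceq T w y z" for w x y z
    using that cworld_closed[of T w "Eq x z"] cworld_fv[of T w "Eq x y"] cworld_fv[of T w "Eq y z"]
    by (auto simp: ceq_def intro: deriv_Eq_trans[of _ _ x y z] deriv.Hyp)
  show "cmem T w x' y'" if "cmem T w x y" "ceq T w x x'" "ceq T w y y'" for w x y x' y'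
    using that cworld_closed[of T w "Mem x' y'"] cworld_fv[of T w "Eq x x'"]
      cworld_fv[of T w "Eq y y'"]
    by (auto simp: ceq_def cmem_def intro: deriv_Mem_cong[of _ _ x y] deriv.Hyp)
qed (auto simp: cle_def cdom_def cmem_def ceq_def dest: cworld_fv)

text \<open>An assignment into a world is a renaming of variables, so forcing under \<open>r\<close>
  is compared with membership of the renamed formula. If an implication or universal formula is
  missing from the theory, the extension lemma produces a later world refuting it.\<close>

lemma truth_lemma:
  "cworld T w \<Longrightarrow> (\<And>i. r i \<in> fst w) \<Longrightarrow> canonical.sat T p w r \<longleftrightarrow> rename r p \<in> snd w"
proof (induction p arbitrary: w r)
  case Falsum
  then show ?case by (simp add: cworld_def prime_theory_def)
next
  case (Mem x y)
  then show ?case unfolding canonical.sat.simps by (simp add: cmem_def)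
next
  case (Eq x y)
  then show ?case unfolding canonical.sat.simps by (simp add: ceq_def)
next
  case (And p q)
  have "And p q \<in> snd w \<longleftrightarrow> p \<in> snd w \<and> q \<in> snd w" for p q
  proof
    assume *: "And p q \<in> snd w"
    then have "deriv T (snd w) p" "deriv T (snd w) q"
      by (meson deriv.AndE1 deriv.AndE2 deriv.Hyp)+
    then show "p \<in> snd w \<and> q \<in> snd w"
      using cworld_fv[OF And.prems(1) *] cworld_closed[OF And.prems(1)] by simp
  next
    assume *: "p \<in> snd w \<and> q \<in> snd w"
    then show "And p q \<in> snd w"
      using cworld_fv[OF And.prems(1)]
      by (intro cworld_closed[OF And.prems(1)]) (auto intro: deriv.AndI deriv.Hyp)
  qed
  then show ?case using And by simp
next
  case (Or p q)
  have fv: "fv (rename r p) \<subseteq> fst w" "fv (rename r q) \<subseteq> fst w"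
    using Or.prems by (auto simp: fv_rename)
  have "Or p q \<in> snd w \<longleftrightarrow> p \<in> snd w \<or> q \<in> snd w"
    if "fv p \<subseteq> fst w" "fv q \<subseteq> fst w" for p q
  proof
    show "p \<in> snd w \<or> q \<in> snd w" if "Or p q \<in> snd w"
      using that Or.prems(1) by (simp add: cworld_def prime_theory_def)
    show "Or p q \<in> snd w" if *: "p \<in> snd w \<or> q \<in> snd w"
    proof (rule cworld_closed[OF Or.prems(1)])
      show "deriv T (snd w) (Or p q)" using * by (meson deriv.OrI1 deriv.OrI2 deriv.Hyp)
    qed (simp add: \<open>fv p \<subseteq> fst w\<close> \<open>fv q \<subseteq> fst w\<close>)
  qed
  then show ?case using Or fv by simp
next
  case (Imp p q)
  let ?p = "rename r p" and ?q = "rename r q"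
  have fv: "fv ?p \<subseteq> fst w" "fv ?q \<subseteq> fst w"
    using Imp.prems by (auto simp: fv_rename)
  show ?case
  proof
    assume L: "canonical.sat T (Imp p q) w r"
    have "deriv T (insert ?p (snd w)) ?q"
    proof (rule ccontr)
      assume *: "\<not> deriv T (insert ?p (snd w)) ?q"
      obtain V G where v: "prime_theory T V G" "fst w \<subseteq> V" "insert ?p (snd w) \<subseteq> G" "?q \<notin> G"
        by (rule prime_theory_extension[OF _ _ _ fv(2) *])
          (use Imp.prems fv in \<open>auto simp: cworld_def prime_theory_def\<close>)
      then have "cworld T (V, G)" "cle T w (V, G)" using Imp.prems by (auto simp: cworld_def cle_def)
      then show False
        using L Imp.IH(1)[of "(V, G)" r] Imp.IH(2)[of "(V, G)" r] Imp.prems v by auto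
    qed
    then show "rename r (Imp p q) \<in> snd w"
      using cworld_closed[OF Imp.prems(1), of "Imp ?p ?q"] fv by (auto intro: deriv.ImpI)
  next
    assume R: "rename r (Imp p q) \<in> snd w"
    show "canonical.sat T (Imp p q) w r"
      unfolding canonical.sat.simps
    proof (intro allI impI)
      fix v assume v: "cle T w v" "canonical.sat T p v r"
      then have v': "cworld T v" "\<And>i. r i \<in> fst v" "rename r (Imp p q) \<in> snd v"
        using Imp.prems R by (auto simp: cle_def)
      then have "?p \<in> snd v" using Imp.IH(1) v by blast
      then have "deriv T (snd v) ?q"
        using v'(3) by (auto intro!: deriv.ImpE[of T "snd v" ?p ?q] intro: deriv.Hyp)
      then have "?q \<in> snd v"
        using cworld_closed[OF v'(1)] cworld_fv[OF v'(1) v'(3)] by simp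
      then show "canonical.sat T q v r" using Imp.IH(2) v' by blast
    qed
  qed
next
  case (All p)
  let ?q = "rename (under r) p"
  have fv: "fv (All ?q) \<subseteq> fst w"
    using All.prems fv_rename[of r "All p"] by auto
  show ?case
  proof
    assume L: "canonical.sat T (All p) w r"
    have "deriv T (snd w) (All ?q)"
    proof (rule ccontr)
      assume *: "\<not> deriv T (snd w) (All ?q)"
      have inf: "infinite (- fst w)" using All.prems by (simp add: cworld_def prime_theory_def)
      \<comment> \<open>Were the instance at a fresh \<open>x\<close> derivable, generalisation
        would derive the universal formula; so a later world with \<open>x\<close> in its domain may
        omit that instance.\<close>
      then obtain x where x: "x \<notin> fst w"
        by (metis Compl_iff ex_in_conv finite.emptyI)
      have "\<not> deriv T (snd w) (inst ?q x)"
        using * x fv cworld_fv[OF All.prems(1)] by (blast intro: deriv_AllI_fresh)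
      moreover have "infinite (- insert x (fst w))"
        using inf by (metis Compl_insert infinite_remove)
      moreover have "fv (inst ?q x) \<subseteq> insert x (fst w)" using fv_inst[of ?q x] fv by auto
      ultimately obtain V G where
          v: "prime_theory T V G" "insert x (fst w) \<subseteq> V" "snd w \<subseteq> G" "inst ?q x \<notin> G"
        using cworld_fv[OF All.prems(1)]
        by (metis (no_types, lifting) insert_not_empty prime_theory_extension subset_insertI2)
      then have vw: "cworld T (V, G)" "cle T w (V, G)" "cdom T (V, G) x"
        using All.prems by (auto simp: cworld_def cle_def cdom_def)
      then have "canonical.sat T p (V, G) (case_nat x r)" using L by auto
      moreover have "case_nat x r i \<in> fst (V, G)" for i
        using v(2) All.prems(2) by (auto split: nat.split)
      ultimately have "rename (case_nat x r) p \<in> snd (V, G)" using All.IH vw(1) by blast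
      then show False using v(4) by (simp add: inst_rename_under)
    qed
    then show "rename r (All p) \<in> snd w"
      using cworld_closed[OF All.prems(1), of "All ?q"] fv by auto
  next
    assume R: "rename r (All p) \<in> snd w"
    show "canonical.sat T (All p) w r"
      unfolding canonical.sat.simps
    proof (intro allI impI)
      fix v x assume v: "cle T w v" "cdom T v x"
      then have v': "cworld T v" "\<And>i. r i \<in> fst v" "All ?q \<in> snd v" "x \<in> fst v"
        using All.prems R by (auto simp: cle_def cdom_def)
      have "fv (inst ?q x) \<subseteq> fst v" using fv_inst[of ?q x] cworld_fv[OF v'(1,3)] v' by auto
      moreover have "deriv T (snd v) (inst ?q x)"
        using v'(3) by (intro deriv.AllE deriv.Hyp)
      ultimately have "rename (case_nat x r) p \<in> snd v"
        using cworld_closed[OF v'(1)] by (simp add: inst_rename_under)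
      moreover have "case_nat x r i \<in> fst v" for i
        using v' by (auto split: nat.split)
      ultimately show "canonical.sat T p v (case_nat x r)" using All.IH v'(1) by blast
    qed
  qed
next
  case (Ex p)
  let ?q = "rename (under r) p"
  have IH: "canonical.sat T p w (case_nat x r) \<longleftrightarrow> inst ?q x \<in> snd w" if "x \<in> fst w" for x
  proof -
    have "case_nat x r i \<in> fst w" for i
      using that Ex.prems by (auto split: nat.split)
    then show ?thesis using Ex.IH[OF Ex.prems(1)] by (simp add: inst_rename_under)
  qed
  have fv: "fv (Ex ?q) \<subseteq> fst w"
    using Ex.prems fv_rename[of r "Ex p"] by auto
  have "Ex ?q \<in> snd w \<longleftrightarrow> (\<exists>x\<in>fst w. inst ?q x \<in> snd w)"
  proof
    show "\<exists>x\<in>fst w. inst ?q x \<in> snd w" if "Ex ?q \<in> snd w"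
      using that Ex.prems(1) by (simp add: cworld_def prime_theory_def)
    show "Ex ?q \<in> snd w" if *: "\<exists>x\<in>fst w. inst ?q x \<in> snd w"
    proof (rule cworld_closed[OF Ex.prems(1) fv])
      obtain x where "inst ?q x \<in> snd w" using * by blast
      then show "deriv T (snd w) (Ex ?q)" by (intro deriv.ExI[of _ _ _ x] deriv.Hyp)
    qed
  qed
  then show ?case using IH Ex.prems(1) unfolding canonical.sat.simps by (auto simp: cdom_def)
qed

text \<open>Axioms are forced at all worlds under all assignments: each renaming of an axiom is
  derivable by \<open>deriv_rename_closed\<close>, and worlds are closed under derivability.\<close>

lemma kripke_completeness:
  assumes "\<not> deriv T {} p"
  obtains w r where "cworld T w" "\<And>i. cdom T w (r i)" "\<not> canonical.sat T p w r"
    "\<And>q v s. q \<in> T \<Longrightarrow> cworld T v \<Longrightarrow> (\<And>i. cdom T v (s i)) \<Longrightarrow> canonical.sat T q v s"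
proof -
  have "infinite (- insert 0 (fv p))"
    using finite_fv[of p] by (metis finite_compl finite_insert infinite_UNIV_nat)
  then obtain V G where w: "prime_theory T V G" "insert 0 (fv p) \<subseteq> V" "p \<notin> G"
    by (rule prime_theory_extension[of "insert 0 (fv p)" "{}" p T]) (use assms in auto)
  \<comment> \<open>The identity on \<open>V\<close>, made total by the default 0, which was put
    into \<open>V\<close> for this purpose. It does not move the free variables of
    \<open>p\<close>.\<close>
  define r where "r i = (if i \<in> V then i else 0)" for i :: nat
  have "rename r p = p" by (rule rename_ident) (use w in \<open>auto simp: r_def\<close>)
  moreover have "cworld T (V, G)" "\<And>i. r i \<in> fst (V, G)" using w by (auto simp: cworld_def r_def)
  ultimately have "\<not> canonical.sat T p (V, G) r" using w(3) by (subst truth_lemma) auto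
  moreover have "canonical.sat T q v s"
    if "q \<in> T" "cworld T v" "\<And>i. cdom T v (s i)" for q v s
  proof -
    have "deriv T (snd v) (rename s q)"
      using that(1) by (intro deriv_rename_closed deriv.Axiom)
    moreover have "fv (rename s q) \<subseteq> fst v" using that(3) by (auto simp: fv_rename cdom_def)
    ultimately show ?thesis
      using that cworld_closed[OF that(2)] by (subst truth_lemma) (auto simp: cdom_def)
  qed
  ultimately show thesis
    using that[of "(V, G)" r] \<open>cworld T (V, G)\<close> \<open>\<And>i. r i \<in> fst (V, G)\<close> by (auto simp: cdom_def)
qed

section \<open>Forcing in Kripke models of CZF with NID\<close>

context kripke
begin

section \<open>Forcing of formulas with named variables\<close>

lemma sat_mono: "sat p w r \<Longrightarrow> w \<sqsubseteq> v \<Longrightarrow> sat p v r"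
proof (induction p arbitrary: w v r)
  case (Imp p q)
  then show ?case by (auto intro: le_trans)
next
  case (All p)
  then show ?case by (auto intro: le_trans)
next
  case (Ex p)
  then show ?case by (auto intro: D_mono)
qed (auto intro: M_mono E_mono)

lemma sat_rename: "sat (rename s p) w r \<longleftrightarrow> sat p w (\<lambda>i. r (s i))"
proof (induction p arbitrary: w r s)
  case (All p)
  have "(\<lambda>i. case_nat x r (under s i)) = case_nat x (\<lambda>i. r (s i))" for x
    by (rule ext) (metis nat.case not0_implies_Suc under.simps)
  then show ?case using All by simp
next
  case (Ex p)
  have "(\<lambda>i. case_nat x r (under s i)) = case_nat x (\<lambda>i. r (s i))" for x
    by (rule ext) (metis nat.case not0_implies_Suc under.simps)
  then show ?case using Ex by simp
qed auto

text \<open>The list \<open>e\<close> holds the values of the levels, \<open>pr\<close> those of the parameters out of reach.\<close>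

definition fs :: "(nat \<Rightarrow> 'd) \<Rightarrow> form \<Rightarrow> 'w \<Rightarrow> 'd list \<Rightarrow> bool" where
  "fs pr F w e \<longleftrightarrow> sat (F (length e)) w
     (\<lambda>i. if i < length e then e ! (length e - 1 - i) else pr (i - length e))"

lemma fs_mono: "fs pr F w e \<Longrightarrow> w \<sqsubseteq> v \<Longrightarrow> fs pr F v e"
  unfolding fs_def by (rule sat_mono)

lemma fs_mem [simp]:
  "x < length e \<Longrightarrow> y < length e \<Longrightarrow> fs pr (x \<^bold>\<in> y) w e \<longleftrightarrow> M w (e ! x) (e ! y)"
  by (auto simp: fs_def mem_def)

lemma fs_eq [simp]:
  "x < length e \<Longrightarrow> y < length e \<Longrightarrow> fs pr (x \<^bold>= y) w e \<longleftrightarrow> E w (e ! x) (e ! y)"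
  by (auto simp: fs_def eq_def)

lemma fs_falsum [simp]: "\<not> fs pr \<^bold>\<bottom> w e"
  by (simp add: fs_def falsum_def)

lemma fs_conj [simp]: "fs pr (p \<^bold>\<and> q) w e \<longleftrightarrow> fs pr p w e \<and> fs pr q w e"
  by (simp add: fs_def conj_def)

lemma fs_disj [simp]: "fs pr (p \<^bold>\<or> q) w e \<longleftrightarrow> fs pr p w e \<or> fs pr q w e"
  by (simp add: fs_def disj_def)

lemma fs_imp [simp]:
  "fs pr (p \<^bold>\<longrightarrow> q) w e \<longleftrightarrow> (\<forall>v. w \<sqsubseteq> v \<longrightarrow> fs pr p v e \<longrightarrow> fs pr q v e)"
  by (simp add: fs_def imp_def)

lemma fs_iff [simp]:
  "fs pr (p \<^bold>\<longleftrightarrow> q) w e \<longleftrightarrow> (\<forall>v. w \<sqsubseteq> v \<longrightarrow> (fs pr p v e \<longleftrightarrow> fs pr q v e))"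
  by (auto simp: iff_def)

text \<open>A quantifier under \<open>length e\<close> binders binds the level
  \<open>length e\<close>, so its value goes to the right end of \<open>e\<close>, while in the de
  Bruijn assignment it goes to the front.\<close>

lemma fs_snoc:
  "sat (F (Suc (length e))) w
     (case_nat x (\<lambda>i. if i < length e then e ! (length e - 1 - i) else pr (i - length e))) \<longleftrightarrow>
   fs pr F w (e @ [x])"
proof -
  have "case_nat x (\<lambda>i. if i < length e then e ! (length e - 1 - i) else pr (i - length e)) =
    (\<lambda>i. if i < length (e @ [x]) then (e @ [x]) ! (length (e @ [x]) - 1 - i)
      else pr (i - length (e @ [x])))"
    by (rule ext) (auto simp: nth_append split: nat.split)
  then show ?thesis by (simp add: fs_def)
qed

lemma fs_all:
  "fs pr (all P) w e \<longleftrightarrow>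
    (\<forall>v. w \<sqsubseteq> v \<longrightarrow> (\<forall>x. D v x \<longrightarrow> fs pr (P (length e)) v (e @ [x])))"
  unfolding fs_snoc[symmetric] by (simp add: fs_def all_def)

lemma fs_ex [simp]:
  "fs pr (ex P) w e \<longleftrightarrow> (\<exists>x. D w x \<and> fs pr (P (length e)) w (e @ [x]))"
  unfolding fs_snoc[symmetric] by (simp add: fs_def ex_def)

lemma fs_ball [simp]:
  "a < length e \<Longrightarrow> fs pr (ball a P) w e \<longleftrightarrow>
    (\<forall>v. w \<sqsubseteq> v \<longrightarrow> (\<forall>x. M v x (e ! a) \<longrightarrow> fs pr (P (length e)) v (e @ [x])))"
  by (simp add: ball_def fs_all nth_append) (meson M_D le_refl le_trans)

lemma fs_bex [simp]:
  "a < length e \<Longrightarrow> fs pr (bex a P) w e \<longleftrightarrow>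
    (\<exists>x. M w x (e ! a) \<and> fs pr (P (length e)) w (e @ [x]))"
  by (simp add: bex_def nth_append) (meson M_D)

lemma fs_app:
  "\<forall>x\<in>set xs. x < length e \<Longrightarrow> fs pr (app p xs) w e \<longleftrightarrow>
    sat p w (\<lambda>i. if i < length xs then e ! (xs ! i) else pr (i - length xs))"
  unfolding fs_def app_def sat_rename
proof (intro arg_cong[where f = "sat p w"] ext)
  fix i
  assume *: "\<forall>x\<in>set xs. x < length e"
  let ?j = "if i < length xs then length e - 1 - xs ! i else length e + (i - length xs)"
  show "(if ?j < length e then e ! (length e - 1 - ?j) else pr (?j - length e)) =
    (if i < length xs then e ! (xs ! i) else pr (i - length xs))"
  proof (cases "i < length xs")
    case True
    then have "xs ! i < length e" using * by simp
    moreover from this have "length e - Suc (xs ! i) < length e" by linarith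
    ultimately show ?thesis using True by simp
  next
    case False
    then obtain k where "i = length xs + k" by (metis le_iff_add not_less)
    then show ?thesis by simp
  qed
qed

lemma fs_app1 [simp]:
  "x < length e \<Longrightarrow> fs pr (app p [x]) w e \<longleftrightarrow>
    sat p w (\<lambda>i. if i = 0 then e ! x else pr (i - Suc 0))"
  by (subst fs_app) (auto intro!: arg_cong[where f = "sat p w"])

lemma fs_app2 [simp]:
  "x < length e \<Longrightarrow> y < length e \<Longrightarrow> fs pr (app p [x, y]) w e \<longleftrightarrow> sat p w
    (\<lambda>i. if i < Suc (Suc 0) then (if i = 0 then e ! x else e ! y) else pr (i - Suc (Suc 0)))"
  by (subst fs_app) (auto simp: less_Suc_eq intro!: arg_cong[where f = "sat p w"])

text \<open>The quantifier over later worlds of a universally quantified equivalence or implication is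
  redundant.\<close>

lemma fs_all_iff [simp]:
  "fs pr (\<^bold>\<forall>x. P x \<^bold>\<longleftrightarrow> Q x) w e \<longleftrightarrow> (\<forall>v. w \<sqsubseteq> v \<longrightarrow> (\<forall>x. D v x \<longrightarrow>
    (fs pr (P (length e)) v (e @ [x]) \<longleftrightarrow> fs pr (Q (length e)) v (e @ [x]))))"
  by (simp add: fs_all) (meson D_mono le_refl le_trans)

lemma fs_all_imp [simp]:
  "fs pr (\<^bold>\<forall>x. P x \<^bold>\<longrightarrow> Q x) w e \<longleftrightarrow> (\<forall>v. w \<sqsubseteq> v \<longrightarrow> (\<forall>x. D v x \<longrightarrow>
    fs pr (P (length e)) v (e @ [x]) \<longrightarrow> fs pr (Q (length e)) v (e @ [x])))"
  by (simp add: fs_all) (meson D_mono le_refl le_trans)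

text \<open>The side conditions keep this generic rewrite rule from firing where the two preceding
  rules remove a redundant quantifier over worlds.\<close>

lemma fs_all_NO_MATCH [simp]:
  "NO_MATCH (\<lambda>x. A x \<^bold>\<longleftrightarrow> B x) P \<Longrightarrow> NO_MATCH (\<lambda>x. A x \<^bold>\<longrightarrow> B x) P \<Longrightarrow> fs pr (all P) w e \<longleftrightarrow>
    (\<forall>v. w \<sqsubseteq> v \<longrightarrow> (\<forall>x. D v x \<longrightarrow> fs pr (P (length e)) v (e @ [x])))"
  by (rule fs_all)

lemma fs_allD: "fs pr (all P) w e \<Longrightarrow> D w x \<Longrightarrow> fs pr (P (length e)) w (e @ [x])"
  unfolding fs_all by (blast intro: le_refl)

lemma fs_impD: "fs pr (p \<^bold>\<longrightarrow> q) w e \<Longrightarrow> fs pr p w e \<Longrightarrow> fs pr q w e"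
  unfolding fs_imp by (blast intro: le_refl)

text \<open>Parameters of an axiom scheme are free variables of its instance. Since
  \<open>ps\<close> lists levels, its last entry is the value of variable 0.\<close>

definition is_param :: "'d list \<Rightarrow> (nat \<Rightarrow> 'd) \<Rightarrow> bool" where
  "is_param ps r \<longleftrightarrow> (\<forall>i<length ps. r i = ps ! (length ps - 1 - i))"

lemma ex_param:
  assumes "D w a" "\<forall>p\<in>set ps. D w p"
  obtains r where "is_param ps r" "\<And>i. D w (r i)"
proof
  show "is_param ps (\<lambda>i. if i < length ps then ps ! (length ps - 1 - i) else a)"
    by (simp add: is_param_def)
  show "D w (if i < length ps then ps ! (length ps - 1 - i) else a)" for i
    using assms by simp
qed

lemma sat_param1:
  assumes "is_param ps r"
  shows "sat (F (Suc (length ps))) w (\<lambda>i. if i = 0 then x else r (i - Suc 0)) \<longleftrightarrow>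
    fs (\<lambda>i. r (i + length ps)) F w (ps @ [x])"
proof -
  have "(\<lambda>i. if i = 0 then x else r (i - Suc 0)) = case_nat x r"
    by (rule ext) (auto split: nat.split)
  also have "\<dots> = case_nat x
      (\<lambda>i. if i < length ps then ps ! (length ps - 1 - i) else r (i - length ps + length ps))"
    by (rule arg_cong[where f = "case_nat x"], rule ext) (use assms in \<open>auto simp: is_param_def\<close>)
  finally show ?thesis using fs_snoc[of F ps w x "\<lambda>i. r (i + length ps)"] by simp
qed

text \<open>In \<open>app p [x, y]\<close> the variable 0 stands for \<open>x\<close>, that is, for
  the innermost level; hence the reversed order \<open>[y, x]\<close> at the end of the
  list.\<close>

lemma sat_param2:
  assumes "is_param ps r"
  shows "sat (F (Suc (Suc (length ps)))) w
      (\<lambda>i. if i < Suc (Suc 0) then (if i = 0 then x else y) else r (i - Suc (Suc 0))) \<longleftrightarrow>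
    fs (\<lambda>i. r (i + length ps)) F w (ps @ [y, x])"
proof -
  have "(\<lambda>i. if i < Suc (Suc 0) then (if i = 0 then x else y) else r (i - Suc (Suc 0))) =
      case_nat x (\<lambda>i. if i = 0 then y else r (i - Suc 0))"
    by (rule ext) (auto split: nat.split)
  also have "(\<lambda>i. if i = 0 then y else r (i - Suc 0)) =
      (\<lambda>i. if i < length (ps @ [y]) then (ps @ [y]) ! (length (ps @ [y]) - 1 - i)
        else r (i - length (ps @ [y]) + length ps))"
  proof
    fix i
    show "(if i = 0 then y else r (i - Suc 0)) =
      (if i < length (ps @ [y]) then (ps @ [y]) ! (length (ps @ [y]) - 1 - i)
        else r (i - length (ps @ [y]) + length ps))"
      using assms by (cases i) (auto simp: is_param_def nth_append)
  qed
  finally show ?thesis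
    using fs_snoc[of F "ps @ [y]" w x "\<lambda>i. r (i + length ps)"]
    unfolding length_append_singleton by simp
qed

end

section \<open>The axioms and schemes as statements about forcing\<close>

lemma scheme_in_CZF:
  "toplevel (Set_Induction p) \<in> CZF"
  "bounded p \<Longrightarrow> toplevel (Separation p) \<in> CZF"
  "toplevel (Strong_Collection p) \<in> CZF"
  unfolding CZF_def by blast+

locale czf = kripke +
  assumes ax: "p \<in> CZF \<union> {toplevel NID} \<Longrightarrow> (\<And>i. D w (r i)) \<Longrightarrow> sat p w r"
begin

lemma axiom_fs:
  assumes "toplevel F \<in> CZF \<union> {toplevel NID}" "\<And>i. D w (r i)"
  shows "fs r F w []"
  using ax[OF assms] by (simp add: fs_def toplevel_def)

lemma extensionality:
  assumes "D w a" "D w b" "\<And>v x. w \<sqsubseteq> v \<Longrightarrow> M v x a \<longleftrightarrow> M v x b"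
  shows "E w a b"
proof -
  have "fs (\<lambda>_. a) Extensionality w []"
    by (rule axiom_fs) (simp_all add: CZF_def assms)
  from fs_impD[OF fs_allD[OF fs_allD[OF this[unfolded Extensionality_def] assms(1)] assms(2)]]
  show ?thesis using assms(3) by simp
qed

lemma pairing:
  assumes "D w a" "D w b"
  obtains c where "D w c" "\<And>v x. w \<sqsubseteq> v \<Longrightarrow> M v x c \<longleftrightarrow> E v x a \<or> E v x b"
proof -
  have "fs (\<lambda>_. a) Pairing w []"
    by (rule axiom_fs) (simp_all add: CZF_def assms)
  from fs_allD[OF fs_allD[OF this[unfolded Pairing_def] assms(1)] assms(2)]
  have "\<exists>c. D w c \<and> (\<forall>v. w \<sqsubseteq> v \<longrightarrow> (\<forall>x. D v x \<longrightarrow> (M v x c \<longleftrightarrow> E v x a \<or> E v x b)))"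
    by simp
  then show thesis using that by (meson M_D E_D)
qed

lemma union:
  assumes "D w a"
  obtains c where "D w c" "\<And>v x. w \<sqsubseteq> v \<Longrightarrow> M v x c \<longleftrightarrow> (\<exists>y. M v y a \<and> M v x y)"
proof -
  have "fs (\<lambda>_. a) Union w []"
    by (rule axiom_fs) (simp_all add: CZF_def assms)
  from fs_allD[OF this[unfolded Union_def] assms]
  have "\<exists>c. D w c \<and> (\<forall>v. w \<sqsubseteq> v \<longrightarrow> (\<forall>x. D v x \<longrightarrow> (M v x c \<longleftrightarrow> (\<exists>y. M v y a \<and> M v x y))))"
    by simp
  then show thesis using that by (meson M_D)
qed

lemma infinity:
  assumes "D w a"
  obtains I where "D w I" "\<exists>z. M w z I \<and> (\<forall>v x. w \<sqsubseteq> v \<longrightarrow> \<not> M v x z)"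
    "\<And>v x. w \<sqsubseteq> v \<Longrightarrow> M v x I \<Longrightarrow> \<exists>y. M v y I \<and> M v x y"
proof -
  have "fs (\<lambda>_. a) Infinity w []"
    by (rule axiom_fs) (simp_all add: CZF_def assms)
  then obtain I where I: "D w I" "fs (\<lambda>_. a) (is_inductive 0) w [I]"
    by (auto simp: Infinity_def)
  have 1: "\<exists>z. M w z I \<and> (\<forall>v x. w \<sqsubseteq> v \<longrightarrow> \<not> M v x z)"
    using I(2) by (simp add: is_inductive_def is_empty_def) (meson M_D)
  have 2: "\<exists>y. M v y I \<and> M v x y" if "w \<sqsubseteq> v" "M v x I" for v x
    using I(2) that by (simp add: is_inductive_def is_successor_def) (meson E_refl M_D le_refl)
  show thesis using that I(1) 1 2 by blast
qed

text \<open>\<open>F\<close> carries the syntactic restriction, \<open>K\<close> is the HOL relation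
  that it forces. Each use shows once that the two agree and continues with \<open>K\<close>. The
  other schemes follow the same pattern.\<close>

lemma separation:
  assumes "bounded (F (Suc (length ps)))" "D w a" "\<forall>p\<in>set ps. D w p"
    and "\<And>pr v x. w \<sqsubseteq> v \<Longrightarrow> \<forall>p\<in>set ps. D v p \<Longrightarrow> D v x \<Longrightarrow> fs pr F v (ps @ [x]) \<longleftrightarrow> K v x"
  obtains b where "D w b" "\<And>v x. w \<sqsubseteq> v \<Longrightarrow> M v x b \<longleftrightarrow> M v x a \<and> K v x"
proof -
  obtain r where r: "is_param ps r" "\<And>i. D w (r i)" using ex_param assms(2,3) by blast
  have "fs r (Separation (F (Suc (length ps)))) w []"
    using assms(1) r(2) by (intro axiom_fs scheme_in_CZF UnI1)
  from fs_allD[OF this[unfolded Separation_def] assms(2)]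
  obtain b where b: "D w b"
      "\<And>v x. w \<sqsubseteq> v \<Longrightarrow> D v x \<Longrightarrow> M v x b \<longleftrightarrow> M v x a \<and> fs (\<lambda>i. r (i + length ps)) F v (ps @ [x])"
    by (auto simp: sat_param1[OF r(1)])
  have "fs (\<lambda>i. r (i + length ps)) F v (ps @ [x]) \<longleftrightarrow> K v x" if "w \<sqsubseteq> v" "D v x" for v x
    using assms(3,4) that D_mono by blast
  then show thesis using that[OF b(1)] b(2) M_D by blast
qed

lemma strong_collection:
  assumes "D w a" "\<forall>p\<in>set ps. D w p"
    and "\<And>pr v x y. w \<sqsubseteq> v \<Longrightarrow> \<forall>p\<in>set ps. D v p \<Longrightarrow> D v x \<Longrightarrow> D v y \<Longrightarrow>
      fs pr F v (ps @ [y, x]) \<longleftrightarrow> K v x y"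
    and "\<And>v x. w \<sqsubseteq> v \<Longrightarrow> M v x a \<Longrightarrow> \<exists>y. D v y \<and> K v x y"
  obtains b where "D w b" "\<And>v x. w \<sqsubseteq> v \<Longrightarrow> M v x a \<Longrightarrow> \<exists>y. M v y b \<and> K v x y"
    "\<And>v y. w \<sqsubseteq> v \<Longrightarrow> M v y b \<Longrightarrow> \<exists>x. M v x a \<and> K v x y"
proof -
  obtain r where r: "is_param ps r" "\<And>i. D w (r i)" using ex_param assms(1,2) by blast
  let ?p = "F (Suc (Suc (length ps)))"
  let ?K = "\<lambda>v x y. fs (\<lambda>i. r (i + length ps)) F v (ps @ [y, x])"
  have K: "?K v x y \<longleftrightarrow> K v x y" if "w \<sqsubseteq> v" "D v x" "D v y" for v x y
    using assms(2,3) that D_mono by blast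
  have "fs r (Strong_Collection ?p) w []"
    using r(2) by (intro axiom_fs scheme_in_CZF UnI1)
  note fs_impD[OF fs_allD[OF this[unfolded Strong_Collection_def] assms(1)]]
  then have coll: "(\<forall>v. w \<sqsubseteq> v \<longrightarrow> (\<forall>x. M v x a \<longrightarrow> (\<exists>y. D v y \<and> ?K v x y))) \<Longrightarrow>
     (\<exists>b. D w b \<and> (\<forall>v. w \<sqsubseteq> v \<longrightarrow> (\<forall>x. M v x a \<longrightarrow> (\<exists>y. M v y b \<and> ?K v x y))) \<and>
        (\<forall>v. w \<sqsubseteq> v \<longrightarrow> (\<forall>y. M v y b \<longrightarrow> (\<exists>x. M v x a \<and> ?K v x y))))"
    by (simp add: sat_param2[OF r(1)])
  have "\<forall>v. w \<sqsubseteq> v \<longrightarrow> (\<forall>x. M v x a \<longrightarrow> (\<exists>y. D v y \<and> ?K v x y))"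
    using assms(4) K M_D by blast
  from coll[OF this] obtain b where b: "D w b"
      "\<And>v x. w \<sqsubseteq> v \<Longrightarrow> M v x a \<Longrightarrow> \<exists>y. M v y b \<and> ?K v x y"
      "\<And>v y. w \<sqsubseteq> v \<Longrightarrow> M v y b \<Longrightarrow> \<exists>x. M v x a \<and> ?K v x y"
    by (elim exE conjE) (rule that, assumption, simp_all)
  show thesis
  proof (rule that[OF b(1)])
    show "\<exists>y. M v y b \<and> K v x y" if vx: "w \<sqsubseteq> v" "M v x a" for v x
    proof -
      obtain y where y: "M v y b" "?K v x y" using b(2)[OF vx] by blast
      then show ?thesis using K[OF vx(1), of x y] M_D[OF y(1)] M_D[OF vx(2)] by auto
    qed
    show "\<exists>x. M v x a \<and> K v x y" if vy: "w \<sqsubseteq> v" "M v y b" for v y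
    proof -
      obtain x where x: "M v x a" "?K v x y" using b(3)[OF vy] by blast
      then show ?thesis using K[OF vy(1), of x y] M_D[OF x(1)] M_D[OF vy(2)] by auto
    qed
  qed
qed

lemma set_induction:
  assumes "\<forall>p\<in>set ps. D w p"
    and "\<And>pr v x. w \<sqsubseteq> v \<Longrightarrow> \<forall>p\<in>set ps. D v p \<Longrightarrow> D v x \<Longrightarrow> fs pr F v (ps @ [x]) \<longleftrightarrow> K v x"
    and "\<And>v x. w \<sqsubseteq> v \<Longrightarrow> D v x \<Longrightarrow> (\<And>u y. v \<sqsubseteq> u \<Longrightarrow> M u y x \<Longrightarrow> K u y) \<Longrightarrow> K v x"
    and "D w a"
  shows "K w a"
proof -
  obtain r where r: "is_param ps r" "\<And>i. D w (r i)" using ex_param assms(1,4) by blast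
  let ?p = "F (Suc (length ps))"
  let ?K = "\<lambda>v x. fs (\<lambda>i. r (i + length ps)) F v (ps @ [x])"
  have K: "?K v x \<longleftrightarrow> K v x" if "w \<sqsubseteq> v" "D v x" for v x
    using assms(1,2) that D_mono by blast
  have "fs r (Set_Induction ?p) w []"
    using r(2) by (intro axiom_fs scheme_in_CZF UnI1)
  note fs_impD[OF this[unfolded Set_Induction_def]]
  then have "(\<forall>v. w \<sqsubseteq> v \<longrightarrow> (\<forall>x. D v x \<longrightarrow> (\<forall>u. v \<sqsubseteq> u \<longrightarrow> (\<forall>y. M u y x \<longrightarrow> ?K u y)) \<longrightarrow> ?K v x)) \<Longrightarrow>
     (\<forall>v. w \<sqsubseteq> v \<longrightarrow> (\<forall>x. D v x \<longrightarrow> ?K v x))"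
    by (simp add: sat_param1[OF r(1)])
  moreover have "?K v x"
    if vx: "w \<sqsubseteq> v" "D v x" "\<forall>u. v \<sqsubseteq> u \<longrightarrow> (\<forall>y. M u y x \<longrightarrow> ?K u y)" for v x
  proof -
    have "K u y" if "v \<sqsubseteq> u" "M u y x" for u y
      using K[of u y] vx(3) that M_D[OF that(2)] le_trans[OF vx(1) that(1)] by auto
    then show ?thesis using assms(3)[OF vx(1,2)] K[OF vx(1,2)] by simp
  qed
  ultimately show ?thesis using K[OF le_refl assms(4)] assms(4) le_refl[of w] by simp
qed

end

section \<open>Elementary set theory inside a model\<close>

lemma bounded_forms [simp]:
  "bounded ((x \<^bold>\<in> y) n)"
  "bounded ((x \<^bold>= y) n)"
  "bounded (\<^bold>\<bottom> n)"
  "bounded (p n) \<Longrightarrow> bounded (q n) \<Longrightarrow> bounded ((p \<^bold>\<and> q) n)"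
  "bounded (p n) \<Longrightarrow> bounded (q n) \<Longrightarrow> bounded ((p \<^bold>\<or> q) n)"
  "bounded (p n) \<Longrightarrow> bounded (q n) \<Longrightarrow> bounded ((p \<^bold>\<longrightarrow> q) n)"
  "bounded (p n) \<Longrightarrow> bounded (q n) \<Longrightarrow> bounded ((p \<^bold>\<longleftrightarrow> q) n)"
  by (simp_all add: mem_def eq_def falsum_def conj_def disj_def imp_def iff_def bounded.intros)

lemma bounded_ball [simp]:
  assumes "a < n" "bounded (P n (Suc n))"
  shows "bounded (ball a P n)"
proof -
  obtain k where "n - a = Suc k" using assms(1) by (metis Suc_diff_Suc)
  then show ?thesis
    using assms(2) by (simp add: ball_def all_def imp_def mem_def bounded.intros)
qed

lemma bounded_bex [simp]:
  assumes "a < n" "bounded (P n (Suc n))"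
  shows "bounded (bex a P n)"
proof -
  obtain k where "n - a = Suc k" using assms(1) by (metis Suc_diff_Suc)
  then show ?thesis
    using assms(2) by (simp add: bex_def ex_def conj_def mem_def bounded.intros)
qed

text \<open>Unlike \<^const>\<open>is_pair\<close>, its bounded version forces the components to exist in the current
  world, so that it can be evaluated without side conditions.\<close>

definition b_upair :: "nat \<Rightarrow> nat \<Rightarrow> nat \<Rightarrow> form" where
  "b_upair z x y = (x \<^bold>\<in> z \<^bold>\<and> y \<^bold>\<in> z \<^bold>\<and> ball z (\<lambda>t. t \<^bold>= x \<^bold>\<or> t \<^bold>= y))"

definition b_pair :: "nat \<Rightarrow> nat \<Rightarrow> nat \<Rightarrow> form" where
  "b_pair p x y = (bex p (\<lambda>u. b_upair u x x) \<^bold>\<and> bex p (\<lambda>u. b_upair u x y) \<^bold>\<and>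
     ball p (\<lambda>u. b_upair u x x \<^bold>\<or> b_upair u x y))"

definition b_pm :: "nat \<Rightarrow> nat \<Rightarrow> nat \<Rightarrow> form" where
  "b_pm x y r = bex r (\<lambda>p. b_pair p x y)"

lemma bounded_b_pair [simp]: "p < n \<Longrightarrow> x < n \<Longrightarrow> y < n \<Longrightarrow> bounded (b_pair p x y n)"
  by (simp add: b_pair_def b_upair_def)

lemma bounded_b_pm [simp]: "r < n \<Longrightarrow> x < n \<Longrightarrow> y < n \<Longrightarrow> bounded (b_pm x y r n)"
  by (simp add: b_pm_def)

context kripke
begin

text \<open>Inclusion is a universal statement and so has to hold at all later worlds; inclusion
  among the elements present at one world would not persist.\<close>

definition sub :: "'w \<Rightarrow> 'd \<Rightarrow> 'd \<Rightarrow> bool" where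
  "sub w a b \<longleftrightarrow> (\<forall>v x. w \<sqsubseteq> v \<longrightarrow> M v x a \<longrightarrow> M v x b)"

definition upair :: "'w \<Rightarrow> 'd \<Rightarrow> 'd \<Rightarrow> 'd \<Rightarrow> bool" where
  "upair w z x y \<longleftrightarrow> (\<forall>v t. w \<sqsubseteq> v \<longrightarrow> (M v t z \<longleftrightarrow> E v t x \<or> E v t y))"

definition op :: "'w \<Rightarrow> 'd \<Rightarrow> 'd \<Rightarrow> 'd \<Rightarrow> bool" where
  "op w p x y \<longleftrightarrow> D w p \<and> D w x \<and> D w y \<and>
     (\<forall>v z. w \<sqsubseteq> v \<longrightarrow> D v z \<longrightarrow> (M v z p \<longleftrightarrow> upair v z x x \<or> upair v z x y))"

definition pm :: "'w \<Rightarrow> 'd \<Rightarrow> 'd \<Rightarrow> 'd \<Rightarrow> bool" where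
  "pm w x y r \<longleftrightarrow> (\<exists>p. M w p r \<and> op w p x y)"

definition closed :: "'w \<Rightarrow> 'd \<Rightarrow> 'd \<Rightarrow> bool" where
  "closed w R Y \<longleftrightarrow> (\<forall>v a b. w \<sqsubseteq> v \<longrightarrow> pm v a b R \<longrightarrow> sub v a Y \<longrightarrow> (\<exists>z. M v z b \<and> M v z Y))"

definition rule_set :: "'w \<Rightarrow> 'd \<Rightarrow> 'd \<Rightarrow> bool" where
  "rule_set w R X \<longleftrightarrow>
     (\<forall>v r. w \<sqsubseteq> v \<longrightarrow> M v r R \<longrightarrow> (\<exists>a b. op v r a b \<and> sub v a X \<and> sub v b X))"

lemma sub_mono: "sub w a b \<Longrightarrow> w \<sqsubseteq> v \<Longrightarrow> sub v a b"
  unfolding sub_def by (meson le_trans)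

lemma subD: "sub w a b \<Longrightarrow> M w x a \<Longrightarrow> M w x b"
  unfolding sub_def by (meson le_refl)

lemma sub_trans: "sub w a b \<Longrightarrow> sub w b c \<Longrightarrow> sub w a c"
  unfolding sub_def by meson

lemma closed_mono: "closed w R Y \<Longrightarrow> w \<sqsubseteq> v \<Longrightarrow> closed v R Y"
  unfolding closed_def by (meson le_trans)

lemma closedD: "closed w R Y \<Longrightarrow> pm w a b R \<Longrightarrow> sub w a Y \<Longrightarrow> \<exists>z. M w z b \<and> M w z Y"
  unfolding closed_def by (meson le_refl)

lemma upair_mono: "upair w z x y \<Longrightarrow> w \<sqsubseteq> v \<Longrightarrow> upair v z x y"
  unfolding upair_def by (meson le_trans)

lemma upairD: "upair w z x y \<Longrightarrow> M w t z \<longleftrightarrow> E w t x \<or> E w t y"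
  unfolding upair_def by (meson le_refl)

lemma op_D: "op w p x y \<Longrightarrow> D w p" "op w p x y \<Longrightarrow> D w x" "op w p x y \<Longrightarrow> D w y"
  by (simp_all add: op_def)

lemma op_self: "op v p x y \<Longrightarrow> E v p p \<and> E v x x \<and> E v y y"
  using op_D E_refl by blast

lemma op_mono: "op w p x y \<Longrightarrow> w \<sqsubseteq> v \<Longrightarrow> op v p x y"
  unfolding op_def by (meson le_trans D_mono)

lemma opD: "op w p x y \<Longrightarrow> D w z \<Longrightarrow> M w z p \<longleftrightarrow> upair w z x x \<or> upair w z x y"
  unfolding op_def by (meson le_refl)

lemma M_Ds: "M w x y \<Longrightarrow> D w x" "M w x y \<Longrightarrow> D w y"
  using M_D by blast+

lemma pm_mono: "pm w x y r \<Longrightarrow> w \<sqsubseteq> v \<Longrightarrow> pm v x y r"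
  unfolding pm_def by (meson op_mono M_mono)

lemma pm_D: "pm w x y r \<Longrightarrow> D w x" "pm w x y r \<Longrightarrow> D w y" "pm w x y r \<Longrightarrow> D w r"
  unfolding pm_def by (meson op_D M_Ds)+

lemma pmI: "M w p r \<Longrightarrow> op w p x y \<Longrightarrow> pm w x y r"
  unfolding pm_def by blast

end

section \<open>Kuratowski pairs and simple set constructions\<close>

context czf
begin

lemma E_iff:
  assumes "E w x x'" "w \<sqsubseteq> v"
  shows "M v t x \<longleftrightarrow> M v t x'" "M v x t \<longleftrightarrow> M v x' t" "E v t x \<longleftrightarrow> E v t x'" "E v x t \<longleftrightarrow> E v x' t"
proof -
  have e: "E v x x'" using E_mono assms by blast
  have e': "E v x' x" using e E_sym by blast
  show "E v t x \<longleftrightarrow> E v t x'" "E v x t \<longleftrightarrow> E v x' t" using E_trans e e' by blast+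
  have "E v t t" if "M v t s" for s using that E_refl M_D by blast
  moreover have "E v t t" if "M v s t" for s using that E_refl M_D by blast
  ultimately show "M v t x \<longleftrightarrow> M v t x'" "M v x t \<longleftrightarrow> M v x' t" using M_cong e e' by blast+
qed

lemma sub_antisym: "sub w a b \<Longrightarrow> sub w b a \<Longrightarrow> D w a \<Longrightarrow> D w b \<Longrightarrow> E w a b"
  unfolding sub_def by (intro extensionality) blast+

lemma E_sub: "E w a b \<Longrightarrow> sub w a b"
  unfolding sub_def using E_iff(1) by blast

lemma upair_cong: "E w z z' \<Longrightarrow> E w x x' \<Longrightarrow> E w y y' \<Longrightarrow> upair w z x y \<Longrightarrow> upair w z' x' y'"
  unfolding upair_def using E_iff by blast

lemma op_cong:
  assumes "op w p x y" "E w p p'" "E w x x'" "E w y y'"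
  shows "op w p' x' y'"
  unfolding op_def
proof (intro conjI allI impI)
  show "D w p'" "D w x'" "D w y'" using assms(2-4) E_D by blast+
  fix v z assume v: "w \<sqsubseteq> v" and z: "D v z"
  have e: "E v z z" "E v x x'" "E v y y'" "E v x' x" "E v y' y"
    using E_refl[OF z] assms E_mono[OF _ v] E_sym by blast+
  have "M v z p' \<longleftrightarrow> M v z p" using E_iff(1)[OF assms(2) v] by blast
  also have "\<dots> \<longleftrightarrow> upair v z x x \<or> upair v z x y" using opD[OF op_mono[OF assms(1) v] z] .
  also have "\<dots> \<longleftrightarrow> upair v z x' x' \<or> upair v z x' y'" using upair_cong e by blast
  finally show "M v z p' \<longleftrightarrow> upair v z x' x' \<or> upair v z x' y'" .
qed

lemma upair_exists:
  assumes "D w x" "D w y"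
  obtains z where "D w z" "upair w z x y"
  using pairing[OF assms] unfolding upair_def by metis

lemma upair_unique: "upair w z x y \<Longrightarrow> upair w z' x y \<Longrightarrow> D w z \<Longrightarrow> D w z' \<Longrightarrow> E w z z'"
  unfolding upair_def by (intro extensionality) blast+

lemma op_exists:
  assumes "D w x" "D w y"
  obtains p where "op w p x y"
proof -
  obtain a where a: "D w a" "upair w a x x" using upair_exists assms(1) by blast
  obtain b where b: "D w b" "upair w b x y" using upair_exists assms by blast
  obtain p where p: "D w p" "\<And>v z. w \<sqsubseteq> v \<Longrightarrow> M v z p \<longleftrightarrow> E v z a \<or> E v z b"
    using pairing[OF a(1) b(1)] by blast
  have "op w p x y"
    unfolding op_def
  proof (intro conjI allI impI)
    fix v z assume v: "w \<sqsubseteq> v" and z: "D v z"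
    have 1: "E v z a \<longleftrightarrow> upair v z x x"
      using upair_unique[OF _ upair_mono[OF a(2) v] z D_mono[OF a(1) v]]
        upair_cong[of v a z x x x x] E_sym E_refl[OF D_mono[OF assms(1) v]] upair_mono[OF a(2) v]
      by blast
    have 2: "E v z b \<longleftrightarrow> upair v z x y"
      using upair_unique[OF _ upair_mono[OF b(2) v] z D_mono[OF b(1) v]]
        upair_cong[of v b z x x y y] E_sym E_refl[OF D_mono[OF assms(1) v]]
        E_refl[OF D_mono[OF assms(2) v]] upair_mono[OF b(2) v]
      by blast
    show "M v z p \<longleftrightarrow> upair v z x x \<or> upair v z x y" using p(2)[OF v] 1 2 by blast
  qed (use assms p in auto)
  then show thesis by (rule that)
qed

lemma op_unique:
  assumes "op w p x y" "op w p' x y"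
  shows "E w p p'"
proof (rule extensionality)
  show "M v z p \<longleftrightarrow> M v z p'" if "w \<sqsubseteq> v" for v z
    using opD[OF op_mono[OF assms(1) that], of z] opD[OF op_mono[OF assms(2) that], of z] M_Ds
    by blast
qed (use assms op_D in blast)+

text \<open>No decision between \<open>x\<close> = \<open>y\<close> and its negation is required.
  The sets {x}, {x, y} and {x', y'} exist at the world, and each membership in \<open>p\<close>
  yields a disjunction that is settled at that world.\<close>

lemma op_inj:
  assumes "op w p x y" "op w p x' y'"
  shows "E w x x'" "E w y y'"
proof -
  have D: "D w x" "D w y" "D w x'" "D w y'" using assms op_D by blast+
  note refl = D[THEN E_refl]
  obtain a where a: "D w a" "upair w a x x" using upair_exists D by blast
  then have "M w a p" using opD[OF assms(1) a(1)] by blast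
  then have "M w x' a" using opD[OF assms(2) a(1)] upairD refl by blast
  then have x: "E w x' x" using upairD[OF a(2)] by blast
  then show "E w x x'" by (rule E_sym)
  obtain b where b: "D w b" "upair w b x y" using upair_exists D by blast
  then have "M w b p" using opD[OF assms(1) b(1)] by blast
  then consider "upair w b x' x'" | "upair w b x' y'" using opD[OF assms(2) b(1)] by blast
  then show "E w y y'"
  proof cases
    case 1
    then have yx': "E w y x'" using upairD[OF 1, of y] upairD[OF b(2), of y] refl by blast
    obtain b' where b': "D w b'" "upair w b' x' y'" using upair_exists D by blast
    then have "M w b' p" using opD[OF assms(2) b'(1)] by blast
    then have "upair w b' x x \<or> upair w b' x y" using opD[OF assms(1) b'(1)] by blast
    moreover have "M w y' b'" using upairD[OF b'(2)] refl by blast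
    ultimately have "E w y' x \<or> E w y' y" using upairD by blast
    then show ?thesis using yx' x E_sym E_trans by blast
  next
    case 2
    have "M w y b" "M w y' b" using upairD[OF b(2)] upairD[OF 2] refl by blast+
    then have "E w y x' \<or> E w y y'" "E w y' x \<or> E w y' y"
      using upairD[OF b(2)] upairD[OF 2] by blast+
    then show ?thesis using x E_sym E_trans by blast
  qed
qed

lemma pm_cong:
  assumes "pm w x y r" "E w x x'" "E w y y'" "E w r r'"
  shows "pm w x' y' r'"
proof -
  obtain p where p: "M w p r" "op w p x y" using assms(1) unfolding pm_def by blast
  have "E w p p" using M_Ds(1)[OF p(1)] E_refl by blast
  then show ?thesis using op_cong[OF p(2) _ assms(2,3)] M_cong[OF p(1) _ assms(4)] pmI by blast
qed

lemma pm_op: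
  assumes "op w p x y"
  shows "pm w x y r \<longleftrightarrow> M w p r"
proof
  assume "pm w x y r"
  then obtain q where q: "M w q r" "op w q x y" unfolding pm_def by blast
  have "E w q p" "E w r r" using op_unique[OF q(2) assms] E_refl M_Ds(2)[OF q(1)] by blast+
  then show "M w p r" using M_cong[OF q(1)] by blast
qed (use assms pmI in blast)

lemma fs_is_pair:
  "p < length e \<Longrightarrow> x < length e \<Longrightarrow> y < length e \<Longrightarrow> D w (e ! p) \<Longrightarrow> D w (e ! x) \<Longrightarrow>
    D w (e ! y) \<Longrightarrow> fs pr (is_pair p x y) w e \<longleftrightarrow> op w (e ! p) (e ! x) (e ! y)"
proof -
  assume *: "p < length e" "x < length e" "y < length e" "D w (e ! p)" "D w (e ! x)" "D w (e ! y)"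
  have upair: "fs pr (is_upair i j k) v e \<longleftrightarrow> upair v (e ! i) (e ! j) (e ! k)"
    if "i < length e" "j < length e" "k < length e" for i j k v e
    using that by (simp add: is_upair_def upair_def nth_append) (meson M_D E_D)
  show ?thesis using * by (simp add: is_pair_def op_def upair nth_append)
qed

lemma fs_b_upair:
  "z < length e \<Longrightarrow> x < length e \<Longrightarrow> y < length e \<Longrightarrow> fs pr (b_upair z x y) w e \<longleftrightarrow>
    D w (e ! x) \<and> D w (e ! y) \<and> upair w (e ! z) (e ! x) (e ! y)"
proof -
  have "M w x z \<and> M w y z \<and> (\<forall>v. w \<sqsubseteq> v \<longrightarrow> (\<forall>t. M v t z \<longrightarrow> E v t x \<or> E v t y)) \<longleftrightarrow>
      D w x \<and> D w y \<and> upair w z x y" for x y z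
  proof (intro iffI)
    assume *: "M w x z \<and> M w y z \<and> (\<forall>v. w \<sqsubseteq> v \<longrightarrow> (\<forall>t. M v t z \<longrightarrow> E v t x \<or> E v t y))"
    then have D: "D w x" "D w y" "D w z" using M_Ds by blast+
    have "M v t z" if "w \<sqsubseteq> v" "E v t x \<or> E v t y" for v t
      using that M_cong[of v _ z t z] E_sym E_refl[OF D_mono[OF D(3) that(1)]] * M_mono[OF _ that(1)]
      by blast
    then show "D w x \<and> D w y \<and> upair w z x y" using D * unfolding upair_def by blast
  next
    assume *: "D w x \<and> D w y \<and> upair w z x y"
    then show "M w x z \<and> M w y z \<and> (\<forall>v. w \<sqsubseteq> v \<longrightarrow> (\<forall>t. M v t z \<longrightarrow> E v t x \<or> E v t y))"
      using upairD[of w z x y] E_refl unfolding upair_def by blast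
  qed
  then show "z < length e \<Longrightarrow> x < length e \<Longrightarrow> y < length e \<Longrightarrow> ?thesis"
    by (simp add: b_upair_def nth_append)
qed

lemma fs_b_pair [simp]:
  "p < length e \<Longrightarrow> x < length e \<Longrightarrow> y < length e \<Longrightarrow>
    fs pr (b_pair p x y) w e \<longleftrightarrow> op w (e ! p) (e ! x) (e ! y)"
proof -
  have "(\<exists>u. M w u p \<and> D w x \<and> upair w u x x) \<and> (\<exists>u. M w u p \<and> D w x \<and> D w y \<and> upair w u x y) \<and>
      (\<forall>v. w \<sqsubseteq> v \<longrightarrow> (\<forall>u. M v u p \<longrightarrow> D v x \<and> upair v u x x \<or> D v x \<and> D v y \<and> upair v u x y)) \<longleftrightarrow>
    op w p x y" for p x y
  proof
    assume *: "(\<exists>u. M w u p \<and> D w x \<and> upair w u x x) \<and>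
      (\<exists>u. M w u p \<and> D w x \<and> D w y \<and> upair w u x y) \<and>
      (\<forall>v. w \<sqsubseteq> v \<longrightarrow> (\<forall>u. M v u p \<longrightarrow> D v x \<and> upair v u x x \<or> D v x \<and> D v y \<and> upair v u x y))"
    then obtain a b where ab: "M w a p" "upair w a x x" "M w b p" "upair w b x y" "D w x" "D w y"
      by blast
    have "M v z p" if v: "w \<sqsubseteq> v" and z: "D v z" "upair v z x x \<or> upair v z x y" for v z
    proof -
      have "E v z a \<or> E v z b"
        using z upair_unique upair_mono[OF ab(2) v] upair_mono[OF ab(4) v] M_Ds M_mono ab(1,3) v
        by meson
      then show ?thesis
        using M_cong[OF M_mono[OF ab(1) v]] M_cong[OF M_mono[OF ab(3) v]] E_sym E_refl M_Ds(2)
          M_mono[OF ab(1) v] by meson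
    qed
    then show "op w p x y" using ab * M_Ds unfolding op_def by blast
  next
    assume *: "op w p x y"
    obtain a where a: "D w a" "upair w a x x" using upair_exists op_D[OF *] by blast
    obtain b where b: "D w b" "upair w b x y" using upair_exists op_D[OF *] by blast
    have "D v x \<and> D v y \<and> (upair v u x x \<or> upair v u x y)" if "w \<sqsubseteq> v" "M v u p" for v u
      using opD[OF op_mono[OF * that(1)] M_Ds(1)[OF that(2)]] op_D[OF op_mono[OF * that(1)]] that(2)
      by blast
    moreover have "M w a p" "M w b p" using opD[OF *] a b by blast+
    ultimately show "(\<exists>u. M w u p \<and> D w x \<and> upair w u x x) \<and>
      (\<exists>u. M w u p \<and> D w x \<and> D w y \<and> upair w u x y) \<and>
      (\<forall>v. w \<sqsubseteq> v \<longrightarrow> (\<forall>u. M v u p \<longrightarrow> D v x \<and> upair v u x x \<or> D v x \<and> D v y \<and> upair v u x y))"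
      using a b op_D[OF *] by blast
  qed
  then show "p < length e \<Longrightarrow> x < length e \<Longrightarrow> y < length e \<Longrightarrow> ?thesis"
    by (simp add: b_pair_def fs_b_upair nth_append)
qed

lemma fs_b_pm [simp]:
  "r < length e \<Longrightarrow> x < length e \<Longrightarrow> y < length e \<Longrightarrow>
    fs pr (b_pm x y r) w e \<longleftrightarrow> pm w (e ! x) (e ! y) (e ! r)"
  by (simp add: b_pm_def pm_def nth_append)

text \<open>If for each \<open>x\<close> in \<open>a\<close> the class of all \<open>y\<close> with
  \<open>K v x y\<close> is a set, the union of these sets is a set. Strong Collection gathers the
  sets: its first half gives all required elements, its second half excludes others. The levels are
  the gathered set \<open>s\<close>, its index \<open>x\<close> and an element
  \<open>y\<close>.\<close>

lemma union_image:
  assumes "D w a" "\<forall>p\<in>set ps. D w p"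
    and "\<And>pr v s x y. w \<sqsubseteq> v \<Longrightarrow> \<forall>p\<in>set ps. D v p \<Longrightarrow> D v s \<Longrightarrow> D v x \<Longrightarrow> D v y \<Longrightarrow>
      fs pr F v (ps @ [s, x, y]) \<longleftrightarrow> K v x y"
    and "\<And>v x. w \<sqsubseteq> v \<Longrightarrow> M v x a \<Longrightarrow>
      \<exists>s. D v s \<and> (\<forall>u y. v \<sqsubseteq> u \<longrightarrow> D u y \<longrightarrow> (M u y s \<longleftrightarrow> K u x y))"
  obtains c where "D w c" "\<And>v y. w \<sqsubseteq> v \<Longrightarrow> D v y \<Longrightarrow> M v y c \<longleftrightarrow> (\<exists>x. M v x a \<and> K v x y)"
proof -
  let ?K = "\<lambda>v x s. \<forall>u y. v \<sqsubseteq> u \<longrightarrow> D u y \<longrightarrow> (M u y s \<longleftrightarrow> K u x y)"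
  let ?F = "\<^bold>\<forall>y. y \<^bold>\<in> length ps \<^bold>\<longleftrightarrow> F"
  obtain b where b: "D w b" "\<And>v x. w \<sqsubseteq> v \<Longrightarrow> M v x a \<Longrightarrow> \<exists>s. M v s b \<and> ?K v x s"
    "\<And>v s. w \<sqsubseteq> v \<Longrightarrow> M v s b \<Longrightarrow> \<exists>x. M v x a \<and> ?K v x s"
  proof (rule strong_collection[where K = ?K and F = ?F, OF assms(1,2)])
    fix pr v x s assume v: "w \<sqsubseteq> v" and ps: "\<forall>p\<in>set ps. D v p" and D: "D v x" "D v s"
    have "fs pr F u (ps @ [s, x, y]) \<longleftrightarrow> K u x y" if "v \<sqsubseteq> u" "D u y" for u y
      using assms(3)[OF le_trans[OF v that(1)]] ps D that D_mono by blast
    then show "fs pr ?F v (ps @ [s, x]) \<longleftrightarrow> ?K v x s" by (simp add: nth_append)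
  qed (use assms(4) in blast)+
  obtain c where c: "D w c" "\<And>v y. w \<sqsubseteq> v \<Longrightarrow> M v y c \<longleftrightarrow> (\<exists>s. M v s b \<and> M v y s)"
    using union[OF b(1)] by blast
  have "M v y c \<longleftrightarrow> (\<exists>x. M v x a \<and> K v x y)" if v: "w \<sqsubseteq> v" and y: "D v y" for v y
  proof
    assume "M v y c"
    then obtain s where s: "M v s b" "M v y s" using c(2)[OF v] by blast
    then obtain x where "M v x a" "?K v x s" using b(3)[OF v] by blast
    then show "\<exists>x. M v x a \<and> K v x y" using s(2) y le_refl by blast
  next
    assume "\<exists>x. M v x a \<and> K v x y"
    then obtain x where x: "M v x a" "K v x y" by blast
    then obtain s where "M v s b" "?K v x s" using b(2)[OF v] by blast
    then show "M v y c" using x(2) y c(2)[OF v] le_refl by blast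
  qed
  then show thesis using that c(1) by blast
qed

lemma empty_exists:
  assumes "D w a"
  obtains z where "D w z" "\<And>v x. w \<sqsubseteq> v \<Longrightarrow> \<not> M v x z"
  using infinity[OF assms] M_Ds(1) by metis

lemma binary_union:
  assumes "D w a" "D w b"
  obtains c where "D w c" "\<And>v x. w \<sqsubseteq> v \<Longrightarrow> M v x c \<longleftrightarrow> M v x a \<or> M v x b"
proof -
  obtain p where p: "D w p" "\<And>v x. w \<sqsubseteq> v \<Longrightarrow> M v x p \<longleftrightarrow> E v x a \<or> E v x b"
    using pairing[OF assms] by blast
  obtain c where c: "D w c" "\<And>v x. w \<sqsubseteq> v \<Longrightarrow> M v x c \<longleftrightarrow> (\<exists>y. M v y p \<and> M v x y)"
    using union[OF p(1)] by blast
  have "M v x c \<longleftrightarrow> M v x a \<or> M v x b" if v: "w \<sqsubseteq> v" for v x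
  proof -
    have "E v a a" "E v b b" using assms D_mono[OF _ v] E_refl by blast+
    then show ?thesis using p(2)[OF v] c(2)[OF v] E_iff(1)[OF _ le_refl] by blast
  qed
  then show thesis using that c(1) by blast
qed

lemma insert_exists:
  assumes "D w a" "D w e"
  obtains c where "D w c" "\<And>v x. w \<sqsubseteq> v \<Longrightarrow> M v x c \<longleftrightarrow> M v x a \<or> E v x e"
proof -
  obtain s where s: "D w s" "\<And>v x. w \<sqsubseteq> v \<Longrightarrow> M v x s \<longleftrightarrow> E v x e \<or> E v x e"
    using pairing[OF assms(2,2)] by blast
  obtain c where "D w c" "\<And>v x. w \<sqsubseteq> v \<Longrightarrow> M v x c \<longleftrightarrow> M v x a \<or> M v x s"
    using binary_union[OF assms(1) s(1)] by blast
  then show thesis using that s(2) by blast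
qed

text \<open>This makes a set \<open>X\<close> available as an object outside \<open>X\<close>, which
  is how a new element gets adjoined to \<open>X\<close> below.\<close>

lemma mem_irrefl: "\<not> M w x x"
proof
  assume *: "M w x x"
  have "\<forall>u. w \<sqsubseteq> u \<longrightarrow> \<not> M u x x"
  proof (rule set_induction[where ps = "[]" and F = "0 \<^bold>\<in> 0 \<^bold>\<longrightarrow> \<^bold>\<bottom>" and K = "\<lambda>v x. \<forall>u. v \<sqsubseteq> u \<longrightarrow> \<not> M u x x"])
    fix v x assume IH: "\<And>u y. v \<sqsubseteq> u \<Longrightarrow> M u y x \<Longrightarrow> \<forall>t. u \<sqsubseteq> t \<longrightarrow> \<not> M t y y"
    show "\<forall>u. v \<sqsubseteq> u \<longrightarrow> \<not> M u x x" using IH le_refl by blast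
  qed (use M_Ds(1)[OF *] in simp_all)
  then show False using * le_refl by blast
qed

lemma nid:
  assumes "D w X" "D w R" "rule_set w R X"
  obtains G where "D w G"
    "\<And>v \<beta>. w \<sqsubseteq> v \<Longrightarrow> M v \<beta> G \<Longrightarrow> sub v \<beta> X" "\<And>v \<beta>. w \<sqsubseteq> v \<Longrightarrow> M v \<beta> G \<Longrightarrow> closed v R \<beta>"
    "\<And>v \<alpha> x. w \<sqsubseteq> v \<Longrightarrow> D v \<alpha> \<Longrightarrow> sub v \<alpha> X \<Longrightarrow> closed v R \<alpha> \<Longrightarrow> M v x \<alpha> \<Longrightarrow>
      \<exists>\<beta>. M v \<beta> G \<and> M v x \<beta> \<and> sub v \<beta> \<alpha>"
proof -
  have sub: "fs pr (a \<^bold>\<subseteq> b) v e \<longleftrightarrow> sub v (e ! a) (e ! b)"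
    if "a < length e" "b < length e" for a b pr v e
    using that by (auto simp: subset_def sub_def nth_append)
  have pm: "fs pr (pair_mem a b r) v e \<longleftrightarrow> pm v (e ! a) (e ! b) (e ! r)"
    if "a < length e" "b < length e" "r < length e" "D v (e ! a)" "D v (e ! b)" for a b r pr v e
    using that M_Ds(1) by (auto simp: pair_mem_def pm_def nth_append fs_is_pair)
  have closed: "fs pr (is_closed r y) v e \<longleftrightarrow> closed v (e ! r) (e ! y)"
    if len: "r < length e" "y < length e" for r y pr v e
  proof
    assume *: "fs pr (is_closed r y) v e"
    show "closed v (e ! r) (e ! y)" unfolding closed_def
    proof (intro allI impI)
      fix u a b assume u: "v \<sqsubseteq> u" and ab: "pm u a b (e ! r)" "sub u a (e ! y)"
      from fs_impD[OF fs_impD[OF fs_allD[OF fs_allD[OF fs_mono[OF *[unfolded is_closed_def] u]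
            pm_D(1)[OF ab(1)]] pm_D(2)[OF ab(1)]]]]
      show "\<exists>z. M u z b \<and> M u z (e ! y)"
        using ab pm_D[OF ab(1)] len by (auto simp: pm sub nth_append)
    qed
  next
    assume *: "closed v (e ! r) (e ! y)"
    have "\<exists>z. M u z b \<and> M u z (e ! y)"
      if "v \<sqsubseteq> u" "pm u' a b (e ! r)" "u' \<sqsubseteq> u" "sub u a (e ! y)" for u u' a b
      using closedD[OF closed_mono[OF * that(1)] pm_mono[OF that(2,3)] that(4)] .
    then show "fs pr (is_closed r y) v e"
      using len by (auto simp: is_closed_def fs_all pm sub nth_append D_mono)
        (metis (no_types, lifting) D_mono M_Ds(1) le_trans)
  qed
  have "fs (\<lambda>_. X) NID w []"
    by (rule axiom_fs) (simp_all add: assms)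
  from fs_impD[OF fs_allD[OF fs_allD[OF this[unfolded NID_def] assms(1)] assms(2)]]
  have "fs (\<lambda>_. X) (is_rule_set 1 0) w [X, R] \<Longrightarrow>
      fs (\<lambda>_. X) (set_generated (\<lambda>Y. Y \<^bold>\<subseteq> 0 \<^bold>\<and> is_closed 1 Y)) w [X, R]"
    by simp
  moreover have "fs (\<lambda>_. X) (is_rule_set 1 0) w [X, R]"
    using assms(3)
    by (auto simp: is_rule_set_def rule_set_def sub fs_is_pair M_Ds cong: conj_cong)
      (metis op_D(2,3))
  ultimately have "fs (\<lambda>_. X) (set_generated (\<lambda>Y. Y \<^bold>\<subseteq> 0 \<^bold>\<and> is_closed 1 Y)) w [X, R]" by blast
  then obtain G where G: "D w G"
    "\<forall>v \<beta>. w \<sqsubseteq> v \<longrightarrow> M v \<beta> G \<longrightarrow> sub v \<beta> X \<and> closed v R \<beta>"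
    "\<forall>v. w \<sqsubseteq> v \<longrightarrow> (\<forall>\<alpha>. D v \<alpha> \<longrightarrow> sub v \<alpha> X \<and> closed v R \<alpha> \<longrightarrow>
      (\<forall>u. v \<sqsubseteq> u \<longrightarrow> (\<forall>x. M u x \<alpha> \<longrightarrow> (\<exists>\<beta>. M u \<beta> G \<and> M u x \<beta> \<and> sub u \<beta> \<alpha>))))"
    by (auto simp: set_generated_def sub closed)
  show thesis
  proof (rule that[OF G(1)])
    show "\<exists>\<beta>. M v \<beta> G \<and> M v x \<beta> \<and> sub v \<beta> \<alpha>"
      if "w \<sqsubseteq> v" "D v \<alpha>" "sub v \<alpha> X" "closed v R \<alpha>" "M v x \<alpha>" for v \<alpha> x
      using G(3) that le_refl by blast
  qed (use G(2) in blast)+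
qed

text \<open>A set generating the closed classes need not contain the least closed set unless every closed
  set is inhabited. To ensure this, adjoin \<open>X\<close> itself as a new element which every closed set must
  contain; then intersect the generating set.\<close>

lemma least_closed:
  assumes X: "D w X" and R: "D w R" "rule_set w R X"
    and single: "\<And>v a b. w \<sqsubseteq> v \<Longrightarrow> pm v a b R \<Longrightarrow> \<exists>x. D v x \<and> upair v b x x"
  obtains I where "D w I" "sub w I X" "closed w R I"
    "\<And>v Y. w \<sqsubseteq> v \<Longrightarrow> D v Y \<Longrightarrow> sub v Y X \<Longrightarrow> closed v R Y \<Longrightarrow> sub v I Y"
proof -
  obtain X' where X': "D w X'" "\<And>v x. w \<sqsubseteq> v \<Longrightarrow> M v x X' \<longleftrightarrow> M v x X \<or> E v x X"
    using insert_exists[OF X X] by blast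
  obtain z0 where z0: "D w z0" "\<And>v x. w \<sqsubseteq> v \<Longrightarrow> \<not> M v x z0" using empty_exists[OF X] by blast
  obtain s where s: "D w s" "upair w s X X" using upair_exists[OF X X] by blast
  \<comment> \<open>The rule with empty premise and conclusion {X}: it forces the new element
    \<open>X\<close> into every closed set.\<close>
  obtain r0 where r0: "op w r0 z0 s" using op_exists[OF z0(1) s(1)] by blast
  obtain R' where R': "D w R'" "\<And>v x. w \<sqsubseteq> v \<Longrightarrow> M v x R' \<longleftrightarrow> M v x R \<or> E v x r0"
    using insert_exists[OF R(1) op_D(1)[OF r0]] by blast
  have "rule_set w R' X'"
    unfolding rule_set_def
  proof (intro allI impI)
    fix v r assume v: "w \<sqsubseteq> v" and r: "M v r R'"
    then consider "M v r R" | "E v r r0" using R'(2) by blast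
    then show "\<exists>a b. op v r a b \<and> sub v a X' \<and> sub v b X'"
    proof cases
      case 1
      then obtain a b where ab: "op v r a b" "sub v a X" "sub v b X"
        using R(2) v unfolding rule_set_def by blast
      have "sub v X X'" unfolding sub_def using X'(2) le_trans[OF v] by blast
      then show ?thesis using ab sub_trans by blast
    next
      case 2
      have Dv: "D v z0" "D v s" using z0(1) s(1) D_mono[OF _ v] by blast+
      have "op v r z0 s" using op_cong[OF op_mono[OF r0 v] E_sym[OF 2]] E_refl Dv by blast
      moreover have "sub v z0 X'" unfolding sub_def using z0(2) le_trans[OF v] by blast
      moreover have "sub v s X'"
        unfolding sub_def using X'(2) le_trans[OF v] upairD[OF upair_mono[OF s(2)]] by blast
      ultimately show ?thesis by blast
    qed
  qed
  from nid[OF X'(1) R'(1) this] obtain G where G: "D w G"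
    "\<And>v \<beta>. w \<sqsubseteq> v \<Longrightarrow> M v \<beta> G \<Longrightarrow> sub v \<beta> X'" "\<And>v \<beta>. w \<sqsubseteq> v \<Longrightarrow> M v \<beta> G \<Longrightarrow> closed v R' \<beta>"
    "\<And>v \<alpha> x. w \<sqsubseteq> v \<Longrightarrow> D v \<alpha> \<Longrightarrow> sub v \<alpha> X' \<Longrightarrow> closed v R' \<alpha> \<Longrightarrow> M v x \<alpha> \<Longrightarrow>
      \<exists>\<beta>. M v \<beta> G \<and> M v x \<beta> \<and> sub v \<beta> \<alpha>"
    by blast
  \<comment> \<open>The intersection of all members of \<open>G\<close>, cut down to
    \<open>X\<close>. Quantifying over the set \<open>G\<close> is what makes this a bounded
    separation.\<close>
  obtain I where I: "D w I"
    "\<And>v x. w \<sqsubseteq> v \<Longrightarrow> M v x I \<longleftrightarrow> M v x X \<and> (\<forall>u. v \<sqsubseteq> u \<longrightarrow> (\<forall>\<beta>. M u \<beta> G \<longrightarrow> M u x \<beta>))"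
    by (rule separation[where ps = "[G]" and F = "ball 0 (\<lambda>\<beta>. 1 \<^bold>\<in> \<beta>)" and w = w and a = X])
      (use X G(1) in auto)
  have RR': "pm v a b R'" if "w \<sqsubseteq> v" "pm v a b R" for v a b
    using that R'(2) unfolding pm_def by blast
  show thesis
  proof (rule that[OF I(1)])
    show "sub w I X" unfolding sub_def using I(2) by blast
    show "closed w R I"
      unfolding closed_def
    proof (intro allI impI)
      fix v a b assume v: "w \<sqsubseteq> v" and ab: "pm v a b R" "sub v a I"
      obtain x where x: "D v x" "upair v b x x" using single v ab(1) by blast
      obtain r where r: "M v r R" "op v r a b" using ab(1) unfolding pm_def by blast
      then obtain a' b' where ab': "op v r a' b'" "sub v b' X"
        using R(2) v unfolding rule_set_def by blast
      then have bX: "sub v b X"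
        using E_sub op_inj(2)[OF r(2)] sub_trans by blast
      \<comment> \<open>Each member of \<open>G\<close> meets the conclusion \<open>b\<close>. As
        \<open>b\<close> is a singleton, they all contain the same \<open>x\<close>, so
        \<open>x\<close> lies in the intersection.\<close>
      have in_all: "M u x \<beta>" if u: "v \<sqsubseteq> u" and \<beta>: "M u \<beta> G" for u \<beta>
      proof -
        have wu: "w \<sqsubseteq> u" using le_trans v u by blast
        have "sub u a \<beta>" unfolding sub_def
        proof (intro allI impI)
          fix t y assume t: "u \<sqsubseteq> t" "M t y a"
          have wt: "w \<sqsubseteq> t" using le_trans wu t by blast
          have "M t y I" using ab(2) le_trans[OF u t(1)] t(2) unfolding sub_def by blast
          then show "M t y \<beta>" using I(2)[OF wt] M_mono[OF \<beta> t(1)] le_refl by blast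
        qed
        then obtain z where "M u z b" "M u z \<beta>"
          using closedD[OF G(3)[OF wu \<beta>] RR'[OF wu pm_mono[OF ab(1) u]]] by blast
        then show ?thesis
          using upairD[OF upair_mono[OF x(2) u]] E_iff(2)[OF _ le_refl] by blast
      qed
      have "M v x b" using upairD[OF x(2)] E_refl[OF x(1)] by blast
      then have "M v x X" using subD[OF bX] by blast
      then show "\<exists>z. M v z b \<and> M v z I" using \<open>M v x b\<close> I(2)[OF v] in_all by blast
    qed
    show "sub v I Y" if v: "w \<sqsubseteq> v" and Y: "D v Y" "sub v Y X" "closed v R Y" for v Y
    proof -
      \<comment> \<open>Adjoining the new element makes \<open>Y\<close> closed under the enlarged
        rules: premises of old rules lie in \<open>X\<close>, and since \<open>X\<close> is not an
        element of itself they already lie in \<open>Y\<close>.\<close>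
      obtain Y' where Y': "D v Y'" "\<And>u x. v \<sqsubseteq> u \<Longrightarrow> M u x Y' \<longleftrightarrow> M u x Y \<or> E u x X"
        using insert_exists[OF Y(1) D_mono[OF X v]] by blast
      have "sub v Y' X'"
        unfolding sub_def using Y'(2) X'(2) Y(2) le_trans[OF v] unfolding sub_def by blast
      moreover have "closed v R' Y'"
        unfolding closed_def
      proof (intro allI impI)
        fix u a b assume u: "v \<sqsubseteq> u" and ab: "pm u a b R'" "sub u a Y'"
        have wu: "w \<sqsubseteq> u" using le_trans v u by blast
        obtain r where r: "M u r R'" "op u r a b" using ab(1) unfolding pm_def by blast
        then consider "M u r R" | "E u r r0" using R'(2)[OF wu] by blast
        then show "\<exists>z. M u z b \<and> M u z Y'"
        proof cases
          case 1
          then obtain a' b' where ab': "op u r a' b'" "sub u a' X"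
            using R(2) wu unfolding rule_set_def by blast
          then have aX: "sub u a X" using E_sub op_inj(1)[OF r(2)] sub_trans by blast
          have "sub u a Y" unfolding sub_def
          proof (intro allI impI)
            fix t y assume t: "u \<sqsubseteq> t" "M t y a"
            have "M t y X" using aX t unfolding sub_def by blast
            then have "\<not> E t y X" using mem_irrefl E_iff(2)[OF _ le_refl] by blast
            then show "M t y Y" using ab(2) t Y'(2)[OF le_trans[OF u t(1)]] unfolding sub_def by blast
          qed
          then obtain z where "M u z b" "M u z Y"
            using closedD[OF closed_mono[OF Y(3) u] pmI[OF 1 r(2)]] by blast
          then show ?thesis using Y'(2)[OF u] by blast
        next
          case 2
          have Du: "D u z0" "D u s" "D u X" using z0(1) s(1) X D_mono[OF _ wu] by blast+
          have "op u r z0 s" using op_cong[OF op_mono[OF r0 wu] E_sym[OF 2]] E_refl Du by blast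
          then have "E u s b" using op_inj(2) r(2) by blast
          then have "M u X b"
            using upairD[OF upair_mono[OF s(2) wu], of X] E_refl[OF Du(3)] E_iff(1)[OF _ le_refl]
            by blast
          then show ?thesis using Y'(2)[OF u, of X] E_refl[OF Du(3)] by blast
        qed
      qed
      \<comment> \<open>\<open>X\<close> is the element at which generation is applied: it gives a
        member of \<open>G\<close> inside \<open>Y'\<close>, and \<open>I\<close> is contained in
        that member.\<close>
      moreover have "M v X Y'" using Y'(2)[OF le_refl] E_refl[OF D_mono[OF X v]] by blast
      ultimately obtain \<beta> where \<beta>: "M v \<beta> G" "sub v \<beta> Y'" using G(4)[OF v Y'(1)] by blast
      show "sub v I Y" unfolding sub_def
      proof (intro allI impI)
        fix u x assume u: "v \<sqsubseteq> u" and x: "M u x I"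
        have wu: "w \<sqsubseteq> u" using le_trans v u by blast
        have "M u x \<beta>" "M u x X" using I(2)[OF wu] x M_mono[OF \<beta>(1) u] le_refl by blast+
        then have "M u x Y \<or> E u x X" using \<beta>(2) Y'(2)[OF u] u unfolding sub_def by blast
        then show "M u x Y" using \<open>M u x X\<close> mem_irrefl E_iff(2)[OF _ le_refl] by blast
      qed
    qed
  qed
qed

end

section \<open>Orbits of definable operations\<close>

context czf
begin

text \<open>Replacement with an exact description of the image. Collection alone may gather only
  some values for each \<open>x\<close>; uniqueness up to \<open>E\<close> identifies any value with
  a gathered one.\<close>

lemma image:
  assumes "D w a" "\<forall>p\<in>set ps. D w p"
    and "\<And>pr v x y. w \<sqsubseteq> v \<Longrightarrow> \<forall>p\<in>set ps. D v p \<Longrightarrow> D v x \<Longrightarrow> D v y \<Longrightarrow>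
      fs pr F v (ps @ [y, x]) \<longleftrightarrow> K v x y"
    and ex: "\<And>v x. w \<sqsubseteq> v \<Longrightarrow> M v x a \<Longrightarrow> \<exists>y. D v y \<and> K v x y"
    and uniq: "\<And>v x y y'. w \<sqsubseteq> v \<Longrightarrow> M v x a \<Longrightarrow> D v y \<Longrightarrow> K v x y \<Longrightarrow> K v x y' \<Longrightarrow> E v y y'"
  obtains c where "D w c" "\<And>v y. w \<sqsubseteq> v \<Longrightarrow> D v y \<Longrightarrow> M v y c \<longleftrightarrow> (\<exists>x. M v x a \<and> K v x y)"
proof -
  obtain c where c: "D w c" "\<And>v x. w \<sqsubseteq> v \<Longrightarrow> M v x a \<Longrightarrow> \<exists>y. M v y c \<and> K v x y"
    "\<And>v y. w \<sqsubseteq> v \<Longrightarrow> M v y c \<Longrightarrow> \<exists>x. M v x a \<and> K v x y"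
    by (rule strong_collection[where K = K and F = F, OF assms(1-4)]) blast+
  have "M v y c" if v: "w \<sqsubseteq> v" and y: "D v y" and x: "M v x a" "K v x y" for v x y
  proof -
    obtain y' where y': "M v y' c" "K v x y'" using c(2)[OF v x(1)] by blast
    have "E v y y'" using uniq[OF v x(1) y x(2) y'(2)] .
    then show ?thesis using y'(1) E_iff(2)[OF _ le_refl] by blast
  qed
  then show thesis using that c(1,3) by blast
qed

lemma op_inhabited: "op w p x y \<Longrightarrow> \<exists>z. M w z p"
  using upair_exists[of w x x] op_D(2)[of w p x y] opD[of w p x y] by blast

text \<open>The union of a Kuratowski pair is the unordered pair of its components; thus components
  of pairs in a set can be reached by the Union axiom.\<close>

lemma op_members:
  assumes "op w p x y"
  shows "(\<exists>c. M w c p \<and> M w z c) \<longleftrightarrow> E w z x \<or> E w z y"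
proof
  assume "\<exists>c. M w c p \<and> M w z c"
  then obtain c where c: "M w c p" "M w z c" by blast
  then show "E w z x \<or> E w z y" using opD[OF assms M_Ds(1)[OF c(1)]] upairD by blast
next
  assume *: "E w z x \<or> E w z y"
  obtain b where b: "D w b" "upair w b x y" using upair_exists op_D(2,3)[OF assms] by blast
  then have "M w b p" "M w z b" using opD[OF assms b(1)] upairD[OF b(2)] * by blast+
  then show "\<exists>c. M w c p \<and> M w z c" by blast
qed

text \<open>The orbit of \<open>r0\<close> under \<open>Step\<close> is indexed by \<open>\<omega>\<close>: \<open>r\<close> is reached at \<open>n\<close> if it is \<open>r0\<close>, or
  the result of a step from some element reached at some \<open>m \<in> n\<close>. The witness \<open>e\<close> is a set of pairs
  \<open>(n, r)\<close> justified by earlier ones.\<close>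

lemma orbit:
  assumes r0: "D w r0" and ps: "\<forall>p\<in>set ps. D w p"
    and F: "\<And>pr v e i j. w \<sqsubseteq> v \<Longrightarrow> i < length e \<Longrightarrow> j < length e \<Longrightarrow> take (length ps) e = ps \<Longrightarrow>
      fs pr (F i j) v e \<longleftrightarrow> Step v (e ! i) (e ! j)"
    and mono: "\<And>u v r r'. w \<sqsubseteq> u \<Longrightarrow> u \<sqsubseteq> v \<Longrightarrow> Step u r r' \<Longrightarrow> Step v r r'"
    and cong: "\<And>v r r' r''. w \<sqsubseteq> v \<Longrightarrow> Step v r r' \<Longrightarrow> E v r' r'' \<Longrightarrow> Step v r r''"
    and Step_D: "\<And>v r r'. w \<sqsubseteq> v \<Longrightarrow> Step v r r' \<Longrightarrow> D v r'"
    and P: "\<And>v r. w \<sqsubseteq> v \<Longrightarrow> E v r r0 \<Longrightarrow> P v r" "\<And>v r r'. w \<sqsubseteq> v \<Longrightarrow> Step v r r' \<Longrightarrow> P v r'"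
    and set: "\<And>v r. w \<sqsubseteq> v \<Longrightarrow> P v r \<Longrightarrow>
      \<exists>s. D v s \<and> (\<forall>u y. v \<sqsubseteq> u \<longrightarrow> D u y \<longrightarrow> (M u y s \<longleftrightarrow> Step u r y))"
  obtains R where "D w R" "M w r0 R"
    "\<And>v r r'. w \<sqsubseteq> v \<Longrightarrow> M v r R \<Longrightarrow> Step v r r' \<Longrightarrow> M v r' R"
    "\<And>v r. w \<sqsubseteq> v \<Longrightarrow> M v r R \<Longrightarrow> E v r r0 \<or> (\<exists>r'. M v r' R \<and> Step v r' r)"
proof -
  obtain N where N: "D w N" "\<exists>z. M w z N \<and> (\<forall>v x. w \<sqsubseteq> v \<longrightarrow> \<not> M v x z)"
    "\<And>v x. w \<sqsubseteq> v \<Longrightarrow> M v x N \<Longrightarrow> \<exists>y. M v y N \<and> M v x y"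
    using infinity[OF r0] by blast
  let ?k = "length ps"
  let ?qs = "ps @ [N, r0]"
  define ok where "ok v e z \<longleftrightarrow> (\<exists>n. D v n \<and> (\<exists>r. D v r \<and> op v z n r \<and> (E v r r0 \<or>
      (\<exists>m. D v m \<and> M v m n \<and> M v m N \<and> (\<exists>r'. D v r' \<and> pm v m r' e \<and> Step v r' r)))))" for v e z
  define att where "att v e \<longleftrightarrow> (\<forall>u. v \<sqsubseteq> u \<longrightarrow> (\<forall>z. M u z e \<longrightarrow> ok u e z))" for v e
  \<comment> \<open>The witness \<open>e\<close> is quantified without bound, so
    \<open>reach\<close> is not a formula for Separation. It occurs in Strong Collection and Set
    Induction, which accept arbitrary formulas.\<close>
  define reach where "reach v n r \<longleftrightarrow> (\<exists>e. D v e \<and> att v e \<and> pm v n r e)" for v n r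
  let ?ok = "\<lambda>e z. \<^bold>\<exists>n. \<^bold>\<exists>r. b_pair z n r \<^bold>\<and> (r \<^bold>= Suc ?k \<^bold>\<or>
    (\<^bold>\<exists>m. m \<^bold>\<in> n \<^bold>\<and> m \<^bold>\<in> ?k \<^bold>\<and> (\<^bold>\<exists>r'. b_pm m r' e \<^bold>\<and> F r' r)))"
  define rF where "rF = (\<lambda>n r. \<^bold>\<exists>e. ball e (\<lambda>z. ?ok e z) \<^bold>\<and> b_pm n r e)"
  have reachF: "fs pr (rF i j) v e \<longleftrightarrow> reach v (e ! i) (e ! j)"
    if "w \<sqsubseteq> v" "i < length e" "j < length e" "take (Suc (Suc ?k)) e = ?qs" for pr v e i j
  proof -
    have len: "Suc ?k < length e" using arg_cong[OF that(4), of length] by simp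
    have nth: "e ! ?k = N" "e ! Suc ?k = r0" "take ?k e = ps"
      using arg_cong[OF that(4), of "\<lambda>l. l ! ?k"] arg_cong[OF that(4), of "\<lambda>l. l ! Suc ?k"]
        arg_cong[OF that(4), of "take ?k"] by (simp_all add: nth_append)
    show ?thesis
      using that(2,3) len nth le_trans[OF that(1)]
      by (simp add: rF_def reach_def att_def ok_def nth_append F)
  qed
  have ok_cong: "ok v e' z'" if "ok v e z" "E v z z'" "sub v e e'" for v e e' z z'
  proof -
    have "op v z' n r" if "op v z n r" for n r
      using op_cong[OF that \<open>E v z z'\<close>] op_D(2,3)[OF that] E_refl by blast
    moreover have "pm v m r' e'" if "pm v m r' e" for m r'
      using that subD[OF \<open>sub v e e'\<close>] unfolding pm_def by blast
    ultimately show ?thesis using that(1) unfolding ok_def by meson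
  qed
  have att_mono: "att v e" if "att u e" "u \<sqsubseteq> v" for u v e
    using that le_trans unfolding att_def by blast
  have reach_mono: "reach v n r" if "reach u n r" "u \<sqsubseteq> v" for u v n r
    using that att_mono D_mono pm_mono unfolding reach_def by meson
  have reach_D: "D v n" "D v r" if "reach v n r" for v n r
    using that pm_D unfolding reach_def by meson+
  have reach_0: "reach v n r" if v: "w \<sqsubseteq> v" and n: "D v n" and r: "E v r r0" for v n r
  proof -
    have Dr: "D v r" using E_D[OF r] by blast
    obtain z where z: "op v z n r" using op_exists[OF n Dr] by blast
    obtain e where e: "D v e" "upair v e z z" using upair_exists op_D(1)[OF z] by blast
    have "att v e" unfolding att_def
    proof (intro allI impI)
      fix u y assume u: "v \<sqsubseteq> u" and y: "M u y e"
      have "E u y z" using upairD[OF upair_mono[OF e(2) u]] y by blast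
      then have "op u y n r"
        using op_cong[OF op_mono[OF z u]] E_sym E_refl D_mono[OF n u] D_mono[OF Dr u] by blast
      then show "ok u e y"
        unfolding ok_def using D_mono[OF n u] D_mono[OF Dr u] E_mono[OF r u] by blast
    qed
    moreover have "pm v n r e" using pmI[OF _ z] upairD[OF e(2)] E_refl[OF op_D(1)[OF z]] by blast
    ultimately show ?thesis unfolding reach_def using e(1) by blast
  qed
  have reach_step: "reach v n r"
    if v: "w \<sqsubseteq> v" and n: "reach v m r'" "M v m n" "M v m N" "Step v r' r" for v n m r r'
  proof -
    obtain e where e: "D v e" "att v e" "pm v m r' e" using n(1) unfolding reach_def by blast
    have Dn: "D v n" "D v r" using M_Ds(2)[OF n(2)] Step_D[OF v n(4)] by blast+
    obtain z where z: "op v z n r" using op_exists[OF Dn] by blast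
    \<comment> \<open>A justification of \<open>r'\<close> at stage \<open>m\<close> becomes one of
      \<open>r\<close> at stage \<open>n\<close> by adding the single pair (n, r).\<close>
    obtain e' where e': "D v e'" "\<And>u x. v \<sqsubseteq> u \<Longrightarrow> M u x e' \<longleftrightarrow> M u x e \<or> E u x z"
      using insert_exists[OF e(1) op_D(1)[OF z]] by blast
    have see': "sub u e e'" if "v \<sqsubseteq> u" for u
      unfolding sub_def using e'(2)[OF le_trans[OF that]] by blast
    have pm': "pm v m r' e'"
      using e(3) subD[OF see'[OF le_refl]] unfolding pm_def by blast
    have "att v e'" unfolding att_def
    proof (intro allI impI)
      fix u y assume u: "v \<sqsubseteq> u" and y: "M u y e'"
      then consider "M u y e" | "E u y z" using e'(2)[OF u] by blast
      then show "ok u e' y"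
      proof cases
        case 1
        then have "ok u e y" using e(2) u unfolding att_def by blast
        then show ?thesis using ok_cong[OF _ E_refl[OF M_Ds(1)[OF y]] see'[OF u]] by blast
      next
        case 2
        then have "op u y n r"
          using op_cong[OF op_mono[OF z u]] E_sym E_refl D_mono[OF _ u] Dn by blast
        moreover have "M u m n" "M u m N" "Step u r' r" "pm u m r' e'"
          using n M_mono[OF _ u] mono[OF v u] pm_mono[OF pm' u] by blast+
        ultimately show ?thesis
          unfolding ok_def using op_D(2,3) pm_D(1,2) by meson
      qed
    qed
    moreover have "pm v n r e'" using pmI[OF _ z] e'(2)[OF le_refl] E_refl[OF op_D(1)[OF z]] by blast
    ultimately show ?thesis unfolding reach_def using e'(1) by blast
  qed
  have reach_cases: "E v r r0 \<or> (\<exists>m r'. M v m n \<and> M v m N \<and> reach v m r' \<and> Step v r' r)"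
    if v: "w \<sqsubseteq> v" and n: "reach v n r" for v n r
  proof -
    obtain e where e: "D v e" "att v e" "pm v n r e" using n unfolding reach_def by blast
    then obtain z where z: "M v z e" "op v z n r" unfolding pm_def by blast
    then have "ok v e z" using e(2) le_refl unfolding att_def by blast
    then obtain n' r' where n': "op v z n' r'" "E v r' r0 \<or>
        (\<exists>m. M v m n' \<and> M v m N \<and> (\<exists>q. pm v m q e \<and> Step v q r'))"
      unfolding ok_def by blast
    have eq: "E v n' n" "E v r' r" using op_inj[OF n'(1) z(2)] by blast+
    from n'(2) show ?thesis
    proof
      assume "E v r' r0"
      then show ?thesis using eq(2) E_sym E_trans by blast
    next
      assume "\<exists>m. M v m n' \<and> M v m N \<and> (\<exists>q. pm v m q e \<and> Step v q r')"
      then obtain m q where m: "M v m n'" "M v m N" "pm v m q e" "Step v q r'" by blast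
      have "M v m n" using m(1) E_iff(1)[OF eq(1) le_refl] by blast
      moreover have "reach v m q" using e(1,2) m(3) unfolding reach_def by blast
      ultimately show ?thesis using m cong[OF v m(4) eq(2)] by blast
    qed
  qed
  have reach_P: "P v r" if "w \<sqsubseteq> v" "reach v n r" for v n r
    using reach_cases[OF that] P that(1) by blast
  \<comment> \<open>To be proved by Set Induction on \<open>x\<close>: the elements reached at some
    stage in \<open>x\<close> form a set. The instance \<open>x\<close> = \<open>N\<close> is the
    orbit.\<close>
  define uset where "uset v x \<longleftrightarrow> (\<exists>h. D v h \<and> (\<forall>u. v \<sqsubseteq> u \<longrightarrow> (\<forall>r. D u r \<longrightarrow>
    (M u r h \<longleftrightarrow> (\<exists>y. M u y x \<and> M u y N \<and> reach u y r)))))" for v x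
  have "uset w N"
  proof (rule set_induction[where ps = ?qs and K = uset and
        F = "\<^bold>\<exists>h. \<^bold>\<forall>r. r \<^bold>\<in> h \<^bold>\<longleftrightarrow> bex (?k + 2) (\<lambda>y. y \<^bold>\<in> ?k \<^bold>\<and> rF y r)"])
    show "\<forall>p\<in>set ?qs. D w p" using ps N(1) r0 by auto
    show "D w N" by (rule N(1))
    fix pr v x assume v: "w \<sqsubseteq> v"
    show "fs pr (\<^bold>\<exists>h. \<^bold>\<forall>r. r \<^bold>\<in> h \<^bold>\<longleftrightarrow> bex (?k + 2) (\<lambda>y. y \<^bold>\<in> ?k \<^bold>\<and> rF y r)) v (?qs @ [x]) \<longleftrightarrow>
        uset v x"
      using le_trans[OF v] by (simp add: uset_def nth_append reachF)
  next
    fix v x assume v: "w \<sqsubseteq> v" and x: "D v x"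
      and IH: "\<And>u y. v \<sqsubseteq> u \<Longrightarrow> M u y x \<Longrightarrow> uset u y"
    have reach_set: "\<exists>s. D u s \<and> (\<forall>t r. u \<sqsubseteq> t \<longrightarrow> D t r \<longrightarrow> (M t r s \<longleftrightarrow> reach t y r))"
      if u: "v \<sqsubseteq> u" and y: "M u y x" "M u y N" for u y
    proof -
      have wu: "w \<sqsubseteq> u" using le_trans v u by blast
      obtain h where h: "D u h"
        "\<And>t r. u \<sqsubseteq> t \<Longrightarrow> D t r \<Longrightarrow> M t r h \<longleftrightarrow> (\<exists>m. M t m y \<and> M t m N \<and> reach t m r)"
        using IH[OF u y(1)] unfolding uset_def by blast
      \<comment> \<open>What is reached at \<open>y\<close> is \<open>r0\<close> together with all
        steps from what is reached at members of \<open>y\<close>. The latter elements form the set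
        \<open>h\<close> by the induction hypothesis, so their steps form a union of sets.\<close>
      obtain c where c: "D u c" "\<And>t r. u \<sqsubseteq> t \<Longrightarrow> D t r \<Longrightarrow> M t r c \<longleftrightarrow> (\<exists>q. M t q h \<and> Step t q r)"
      proof (rule union_image[where K = Step and ps = ps and F = "F (?k + 1) (?k + 2)", OF h(1)])
        show "\<forall>p\<in>set ps. D u p" using ps D_mono[OF _ wu] by blast
        show "fs pr (F (?k + 1) (?k + 2)) t (ps @ [s, q, r]) \<longleftrightarrow> Step t q r" if "u \<sqsubseteq> t" for pr t s q r
          using F[OF le_trans[OF wu that]] by (simp add: nth_append)
        show "\<exists>s. D t s \<and> (\<forall>t' r. t \<sqsubseteq> t' \<longrightarrow> D t' r \<longrightarrow> (M t' r s \<longleftrightarrow> Step t' q r))"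
          if t: "u \<sqsubseteq> t" and q: "M t q h" for t q
        proof -
          obtain m where m: "reach t m q" using h(2)[OF t M_Ds(1)[OF q]] q by blast
          show ?thesis using set[OF le_trans[OF wu t] reach_P[OF le_trans[OF wu t] m]] .
        qed
      qed blast
      obtain s where s: "D u s" "\<And>t r. u \<sqsubseteq> t \<Longrightarrow> M t r s \<longleftrightarrow> M t r c \<or> E t r r0"
        using insert_exists[OF c(1) D_mono[OF r0 wu]] by blast
      have "M t r s \<longleftrightarrow> reach t y r" if t: "u \<sqsubseteq> t" and r: "D t r" for t r
      proof
        have wt: "w \<sqsubseteq> t" using le_trans wu t by blast
        show "reach t y r" if rs: "M t r s"
        proof (cases "E t r r0")
          case True
          then show ?thesis using reach_0[OF wt D_mono[OF M_Ds(1)[OF y(1)] t]] by blast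
        next
          case False
          then obtain q where q: "M t q h" "Step t q r" using rs s(2)[OF t] c(2)[OF t r] by blast
          then obtain m where "M t m y" "M t m N" "reach t m q" using h(2)[OF t M_Ds(1)[OF q(1)]] by blast
          then show ?thesis using reach_step[OF wt _ _ _ q(2)] by blast
        qed
        assume *: "reach t y r"
        from reach_cases[OF wt *] show "M t r s"
        proof
          assume "\<exists>m r'. M t m y \<and> M t m N \<and> reach t m r' \<and> Step t r' r"
          then obtain m r' where m: "M t m y" "M t m N" "reach t m r'" "Step t r' r" by blast
          then have "M t r' h" using h(2)[OF t reach_D(2)[OF m(3)]] by blast
          then show ?thesis using c(2)[OF t r] s(2)[OF t] m(4) by blast
        qed (use s(2)[OF t] in blast)
      qed
      then show ?thesis using s(1) by blast
    qed
    have DN: "D v N" "\<forall>p\<in>set ?qs. D v p" using D_mono[OF _ v] ps N(1) r0 by auto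
    obtain x0 where x0: "D v x0" "\<And>u y. v \<sqsubseteq> u \<Longrightarrow> M u y x0 \<longleftrightarrow> M u y x \<and> M u y N"
      by (rule separation[where ps = "[N]" and F = "1 \<^bold>\<in> 0" and w = v and a = x]) (use x DN in auto)
    obtain h where h: "D v h" "\<And>u r. v \<sqsubseteq> u \<Longrightarrow> D u r \<Longrightarrow> M u r h \<longleftrightarrow> (\<exists>y. M u y x0 \<and> reach u y r)"
    proof (rule union_image[where K = reach and ps = ?qs and F = "rF (?k + 3) (?k + 4)", OF x0(1) DN(2)])
      show "fs pr (rF (?k + 3) (?k + 4)) u (?qs @ [s, y, r]) \<longleftrightarrow> reach u y r" if "v \<sqsubseteq> u" for pr u s y r
        using reachF[OF le_trans[OF v that], of "?k + 3" "?qs @ [s, y, r]" "?k + 4" pr]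
        by (simp add: nth_append numeral_eq_Suc)
      show "\<exists>s. D u s \<and> (\<forall>t r. u \<sqsubseteq> t \<longrightarrow> D t r \<longrightarrow> (M t r s \<longleftrightarrow> reach t y r))"
        if "v \<sqsubseteq> u" "M u y x0" for u y
        using reach_set[OF that(1)] x0(2)[OF that(1)] that(2) by blast
    qed blast
    then show "uset v x" unfolding uset_def using x0(2) by blast
  qed
  then obtain R where R: "D w R"
    "\<And>v r. w \<sqsubseteq> v \<Longrightarrow> D v r \<Longrightarrow> M v r R \<longleftrightarrow> (\<exists>y. M v y N \<and> reach v y r)"
    unfolding uset_def by blast
  show thesis
  proof (rule that[OF R(1)])
    obtain z where z: "M w z N" using N(2) by blast
    then show "M w r0 R" using R(2)[OF le_refl r0] reach_0[OF le_refl M_Ds(1)[OF z]] E_refl[OF r0] by blast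
    show "M v r' R" if v: "w \<sqsubseteq> v" and r: "M v r R" "Step v r r'" for v r r'
    proof -
      obtain n where n: "M v n N" "reach v n r" using R(2)[OF v M_Ds(1)[OF r(1)]] r(1) by blast
      \<comment> \<open>There is no last stage: a result found at \<open>n\<close> can be stepped
        once more at a stage containing \<open>n\<close>.\<close>
      then obtain n' where "M v n' N" "M v n n'" using N(3)[OF v] by blast
      then show ?thesis using reach_step[OF v n(2) _ n(1) r(2)] R(2)[OF v Step_D[OF v r(2)]] by blast
    qed
    show "E v r r0 \<or> (\<exists>r'. M v r' R \<and> Step v r' r)" if v: "w \<sqsubseteq> v" and r: "M v r R" for v r
    proof -
      obtain n where "M v n N" "reach v n r" using R(2)[OF v M_Ds(1)[OF r]] r by blast
      then show ?thesis using reach_cases[OF v] R(2)[OF v] reach_D by meson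
    qed
  qed
qed

end

section \<open>Trees as minimal closed sets of paths\<close>

text \<open>A path \<open>b\<^sub>1 \<dots> b\<^sub>k\<close> ending in a label \<open>a\<close> is coded as \<open>(b\<^sub>1, (b\<^sub>2, \<dots> (b\<^sub>k, (a, \<emptyset>))))\<close>. The first component
  of a rule lists the labels above a node, the second one all possible labels of that node. All rules
  arise from the one for the root, \<open>(\<emptyset>, {(a, \<emptyset>) | a \<in> A})\<close>, by translation along \<open>b \<in> B\<close>: this
  prefixes \<open>b\<close> to all paths and adds the label \<open>f b\<close> of the new root to the first component.\<close>

locale family = czf +
  fixes w0 A B f
  assumes A: "D w0 A" and B: "D w0 B" and f: "D w0 f"
    and f_in: "w0 \<sqsubseteq> v \<Longrightarrow> pm v b a f \<Longrightarrow> M v b B \<and> M v a A"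
    and f_ex: "w0 \<sqsubseteq> v \<Longrightarrow> M v b B \<Longrightarrow> \<exists>a. pm v b a f"
    and f_unique: "w0 \<sqsubseteq> v \<Longrightarrow> pm v b a f \<Longrightarrow> pm v b a' f \<Longrightarrow> E v a a'"
begin

text \<open>The empty set, used both as end mark of coded paths and as premise of the root rule.
  Thus \<open>pm v a z0 y\<close> reads: \<open>y\<close> has the root label
  \<open>a\<close>.\<close>

definition z0 where "z0 = (SOME z. D w0 z \<and> (\<forall>v x. w0 \<sqsubseteq> v \<longrightarrow> \<not> M v x z))"

lemma z0: "D w0 z0" "w0 \<sqsubseteq> v \<Longrightarrow> \<not> M v x z0"
proof -
  have "\<exists>z. D w0 z \<and> (\<forall>v x. w0 \<sqsubseteq> v \<longrightarrow> \<not> M v x z)" using empty_exists[OF A] by metis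
  from someI_ex[OF this] show "D w0 z0" "w0 \<sqsubseteq> v \<Longrightarrow> \<not> M v x z0" unfolding z0_def by blast+
qed

lemma Ds: "w0 \<sqsubseteq> v \<Longrightarrow> D v A" "w0 \<sqsubseteq> v \<Longrightarrow> D v B" "w0 \<sqsubseteq> v \<Longrightarrow> D v f" "w0 \<sqsubseteq> v \<Longrightarrow> D v z0"
  using A B f z0 D_mono by blast+

lemma not_root: "w0 \<sqsubseteq> v \<Longrightarrow> M v t q \<Longrightarrow> \<not> E v q z0"
  using z0(2) E_iff(1)[OF _ le_refl] by blast

section \<open>Translating rules along an edge\<close>

definition shift where
  "shift v y b x \<longleftrightarrow> (\<forall>t z. v \<sqsubseteq> t \<longrightarrow> D t z \<longrightarrow> (M t z y \<longleftrightarrow> (\<exists>q. M t q x \<and> op t z b q)))"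

text \<open>The premise of a translated rule. Its member (a, z0) makes the rule effective only in
  trees with root label \<open>a\<close>, that is, where the edge \<open>b\<close> over
  \<open>a\<close> exists.\<close>

definition guard where
  "guard v y a b x \<longleftrightarrow>
     (\<forall>t z. v \<sqsubseteq> t \<longrightarrow> D t z \<longrightarrow> (M t z y \<longleftrightarrow> op t z a z0 \<or> (\<exists>q. M t q x \<and> op t z b q)))"

text \<open>The nested \<open>D v\<close> conditions follow the quantifiers of
  \<open>tr_form\<close>, so that the definition is literally its forcing clause; \<open>trE\<close>
  and \<open>trI\<close> hide them.\<close>

definition tr where
  "tr v b r r' \<longleftrightarrow> (\<exists>u. D v u \<and> (\<exists>x. D v x \<and> (\<exists>u'. D v u' \<and> (\<exists>x'. D v x' \<and> (\<exists>a. D v a \<and>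
     op v r u x \<and> op v r' u' x' \<and> pm v b a f \<and> guard v u' a b u \<and> shift v x' b x)))))"

definition step where
  "step v r r' \<longleftrightarrow> (\<exists>b. M v b B \<and> tr v b r r')"

text \<open>The constants are levels: 0, 1 and 2 hold \<open>B\<close>, \<open>f\<close> and
  \<open>z0\<close>. The formula is unbounded and is meant for Collection.\<close>

definition tr_form :: "nat \<Rightarrow> nat \<Rightarrow> nat \<Rightarrow> form" where
  "tr_form b r r' = (\<^bold>\<exists>u. \<^bold>\<exists>x. \<^bold>\<exists>u'. \<^bold>\<exists>x'. \<^bold>\<exists>a. b_pair r u x \<^bold>\<and> b_pair r' u' x' \<^bold>\<and> b_pm b a 1 \<^bold>\<and>
     (\<^bold>\<forall>z. z \<^bold>\<in> u' \<^bold>\<longleftrightarrow> b_pair z a 2 \<^bold>\<or> bex u (\<lambda>q. b_pair z b q)) \<^bold>\<and>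
     (\<^bold>\<forall>z. z \<^bold>\<in> x' \<^bold>\<longleftrightarrow> bex x (\<lambda>q. b_pair z b q)))"

lemma fs_tr_form:
  assumes "take 3 e = [B, f, z0]" "b < length e" "r < length e" "r' < length e"
  shows "fs pr (tr_form b r r') v e \<longleftrightarrow> tr v (e ! b) (e ! r) (e ! r')"
proof -
  obtain l where "e = B # f # z0 # l"
    using assms(1) by (metis append_Cons append_Nil append_take_drop_id)
  then have len: "2 < length e" "1 < length e" and nth: "e ! 1 = f" "e ! 2 = z0" by simp_all
  show ?thesis
    using assms(2-4) len nth by (simp add: tr_form_def tr_def guard_def shift_def nth_append)
qed

lemma shift_mono: "shift u y b x \<Longrightarrow> u \<sqsubseteq> v \<Longrightarrow> shift v y b x"
  unfolding shift_def using le_trans by blast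

lemma guard_mono: "guard u y a b x \<Longrightarrow> u \<sqsubseteq> v \<Longrightarrow> guard v y a b x"
  unfolding guard_def using le_trans by blast

lemma trE:
  assumes "tr v b r r'"
  obtains u x u' x' a where "op v r u x" "op v r' u' x'" "pm v b a f" "guard v u' a b u"
    "shift v x' b x"
  using assms unfolding tr_def by blast

lemma trI:
  "op v r u x \<Longrightarrow> op v r' u' x' \<Longrightarrow> pm v b a f \<Longrightarrow> guard v u' a b u \<Longrightarrow> shift v x' b x \<Longrightarrow> tr v b r r'"
  unfolding tr_def using op_D(2,3) pm_D(2) by meson

lemma tr_mono: "tr u b r r' \<Longrightarrow> u \<sqsubseteq> v \<Longrightarrow> tr v b r r'"
  by (elim trE) (rule trI; (rule op_mono pm_mono guard_mono shift_mono; assumption))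

lemma shift_exists:
  assumes "D v b" "D v x"
  obtains y where "D v y" "shift v y b x"
proof -
  obtain y where "D v y" "\<And>t z. v \<sqsubseteq> t \<Longrightarrow> D t z \<Longrightarrow> M t z y \<longleftrightarrow> (\<exists>q. M t q x \<and> op t z b q)"
  proof (rule image[where ps = "[b]" and F = "b_pair 1 0 2" and K = "\<lambda>t q z. op t z b q"
        and w = v and a = x])
    show "\<exists>y. D t y \<and> op t y b q" if "v \<sqsubseteq> t" "M t q x" for t q
      using op_exists[OF D_mono[OF assms(1) that(1)] M_Ds(1)[OF that(2)]] op_D(1) by metis
  qed (use assms op_unique in auto)
  then show thesis using that unfolding shift_def by blast
qed

lemma guard_exists:
  assumes "D v a" "D v b" "D v x" "w0 \<sqsubseteq> v"
  obtains y where "D v y" "guard v y a b x"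
proof -
  obtain s where s: "D v s" "shift v s b x" using shift_exists[OF assms(2,3)] by blast
  obtain p where p: "op v p a z0" using op_exists[OF assms(1) Ds(4)[OF assms(4)]] by blast
  obtain y where y: "D v y" "\<And>t z. v \<sqsubseteq> t \<Longrightarrow> M t z y \<longleftrightarrow> M t z s \<or> E t z p"
    using insert_exists[OF s(1) op_D(1)[OF p]] by blast
  have "E t z p \<longleftrightarrow> op t z a z0" if "v \<sqsubseteq> t" for t z
    using op_unique[OF _ op_mono[OF p that]] op_cong[OF op_mono[OF p that]]
      op_self[OF op_mono[OF p that]] E_sym by blast
  then have "guard v y a b x" using y(2) s(2) unfolding guard_def shift_def by blast
  then show thesis using that y(1) by blast
qed

lemma shift_unique: "shift v y b x \<Longrightarrow> shift v y' b x' \<Longrightarrow> D v y \<Longrightarrow> D v y' \<Longrightarrow> E v x x' \<Longrightarrow> E v y y'"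
proof (rule extensionality)
  assume *: "shift v y b x" "shift v y' b x'" "E v x x'"
  show "M t z y \<longleftrightarrow> M t z y'" if "v \<sqsubseteq> t" for t z
    using * that M_Ds(1)[of t z] E_iff(1)[OF *(3) that] unfolding shift_def by blast
qed

lemma guard_unique:
  "guard v y a b x \<Longrightarrow> guard v y' a' b x' \<Longrightarrow> D v y \<Longrightarrow> D v y' \<Longrightarrow> E v a a' \<Longrightarrow> E v x x' \<Longrightarrow> E v y y'"
proof (rule extensionality)
  assume *: "guard v y a b x" "guard v y' a' b x'" "E v a a'" "E v x x'"
  show "M t z y \<longleftrightarrow> M t z y'" if t: "v \<sqsubseteq> t" for t z
  proof -
    have "op t z a z0 \<longleftrightarrow> op t z a' z0"
      using op_cong op_self E_mono[OF *(3) t] E_sym by meson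
    then show ?thesis
      using *(1,2) t M_Ds(1)[of t z] E_iff(1)[OF *(4) t] unfolding guard_def by blast
  qed
qed

lemma tr_unique:
  assumes "w0 \<sqsubseteq> v" "tr v b r r'" "tr v b r r''"
  shows "E v r' r''"
proof -
  from assms(2) obtain u x u' x' a where 1: "op v r u x" "op v r' u' x'" "pm v b a f"
    "guard v u' a b u" "shift v x' b x" by (rule trE)
  from assms(3) obtain u2 x2 u3 x3 a2 where 2: "op v r u2 x2" "op v r'' u3 x3" "pm v b a2 f"
    "guard v u3 a2 b u2" "shift v x3 b x2" by (rule trE)
  have "E v u u2" "E v x x2" using op_inj[OF 1(1) 2(1)] by blast+
  then have "E v u' u3" "E v x' x3"
    using guard_unique[OF 1(4) 2(4)] shift_unique[OF 1(5) 2(5)] f_unique[OF assms(1) 1(3) 2(3)]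
      op_D[OF 1(2)] op_D[OF 2(2)] by blast+
  then have "op v r' u3 x3" using op_cong[OF 1(2)] op_self[OF 1(2)] by blast
  then show ?thesis using op_unique 2(2) by blast
qed

lemma tr_exists:
  assumes v: "w0 \<sqsubseteq> v" and r: "op v r u x" and b: "M v b B"
  obtains r' where "tr v b r r'"
proof -
  obtain a where a: "pm v b a f" using f_ex[OF v b] by blast
  note D = pm_D[OF a] op_D[OF r]
  obtain u' where u': "D v u'" "guard v u' a b u" using guard_exists[OF _ _ _ v] D by blast
  obtain x' where x': "D v x'" "shift v x' b x" using shift_exists D by blast
  obtain r' where "op v r' u' x'" using op_exists u'(1) x'(1) by blast
  then show thesis using that trI[OF r _ a u'(2) x'(2)] by blast
qed

lemma tr_cong: "tr v b r r' \<Longrightarrow> E v r' r'' \<Longrightarrow> tr v b r r''"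
proof -
  assume *: "tr v b r r'" "E v r' r''"
  from *(1) obtain u x u' x' a where 1: "op v r u x" "op v r' u' x'" "pm v b a f"
    "guard v u' a b u" "shift v x' b x" by (rule trE)
  have "op v r'' u' x'" using op_cong[OF 1(2) *(2)] op_self[OF 1(2)] by blast
  then show ?thesis using 1 trI by blast
qed

definition root_rule where
  "root_rule r \<longleftrightarrow> (\<exists>s. op w0 r z0 s \<and>
     (\<forall>t z. w0 \<sqsubseteq> t \<longrightarrow> D t z \<longrightarrow> (M t z s \<longleftrightarrow> (\<exists>a. M t a A \<and> op t z a z0))))"

lemma root_rule_exists: "\<exists>r. root_rule r"
proof -
  obtain s where s: "D w0 s" "\<And>t z. w0 \<sqsubseteq> t \<Longrightarrow> D t z \<Longrightarrow> M t z s \<longleftrightarrow> (\<exists>a. M t a A \<and> op t z a z0)"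
  proof (rule image[where ps = "[z0]" and F = "b_pair 1 2 0" and K = "\<lambda>t a z. op t z a z0"
        and w = w0 and a = A])
    show "\<exists>y. D t y \<and> op t y q z0" if "w0 \<sqsubseteq> t" "M t q A" for t q
      using op_exists[OF M_Ds(1)[OF that(2)] Ds(4)[OF that(1)]] op_D(1) by metis
  qed (use A z0(1) op_unique in auto)
  obtain r where "op w0 r z0 s" using op_exists[OF z0(1) s(1)] by blast
  then show ?thesis unfolding root_rule_def using s(2) by blast
qed

section \<open>The set of rules and the set of paths\<close>

definition orb where
  "orb r R \<longleftrightarrow> root_rule r \<and> D w0 R \<and> M w0 r R \<and>
    (\<forall>v q q'. w0 \<sqsubseteq> v \<longrightarrow> M v q R \<longrightarrow> step v q q' \<longrightarrow> M v q' R) \<and>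
    (\<forall>v q. w0 \<sqsubseteq> v \<longrightarrow> M v q R \<longrightarrow> E v q r \<or> (\<exists>q'. M v q' R \<and> step v q' q))"

lemma orb_exists: "\<exists>R r. orb r R"
proof -
  obtain r where r: "root_rule r" using root_rule_exists by blast
  then obtain s where rs: "op w0 r z0 s" unfolding root_rule_def by blast
  have "\<exists>R. D w0 R \<and> M w0 r R \<and>
    (\<forall>v q q'. w0 \<sqsubseteq> v \<longrightarrow> M v q R \<longrightarrow> step v q q' \<longrightarrow> M v q' R) \<and>
    (\<forall>v q. w0 \<sqsubseteq> v \<longrightarrow> M v q R \<longrightarrow> E v q r \<or> (\<exists>q'. M v q' R \<and> step v q' q))"
  proof (rule orbit[where w = w0 and ?r0.0 = r and Step = step and ps = "[B, f, z0]"
        and P = "\<lambda>v q. \<exists>u x. op v q u x" and F = "\<lambda>i j. bex 0 (\<lambda>b. tr_form b i j)"])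
    show "fs pr (bex 0 (\<lambda>b. tr_form b i j)) v e \<longleftrightarrow> step v (e ! i) (e ! j)"
      if e: "i < length e" "j < length e" "take (length [B, f, z0]) e = [B, f, z0]" for pr v e i j
    proof -
      obtain l where l: "e = B # f # z0 # l"
        using e(3) by (metis append_Cons append_Nil append_take_drop_id)
      have "fs pr (tr_form (length e) i j) v (e @ [b]) \<longleftrightarrow> tr v b (e ! i) (e ! j)" for b
      proof -
        have "take 3 (e @ [b]) = [B, f, z0]" using l by simp
        from fs_tr_form[OF this, of "length e" i j] show ?thesis using e(1,2) by (simp add: nth_append)
      qed
      then show ?thesis using l by (simp add: step_def)
    qed
    show "\<exists>s. D v s \<and> (\<forall>u y. v \<sqsubseteq> u \<longrightarrow> D u y \<longrightarrow> (M u y s \<longleftrightarrow> step u q y))"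
      if v: "w0 \<sqsubseteq> v" and q: "\<exists>u x. op v q u x" for v q
    proof -
      obtain u x where ux: "op v q u x" using q by blast
      \<comment> \<open>A rule has exactly one translate for each \<open>b\<close> in
        \<open>B\<close>, so its translates are an image of \<open>B\<close>.\<close>
      obtain s where "D v s" "\<And>t y. v \<sqsubseteq> t \<Longrightarrow> D t y \<Longrightarrow> M t y s \<longleftrightarrow> (\<exists>b. M t b B \<and> tr t b q y)"
      proof (rule image[where ps = "[B, f, z0, q]" and F = "tr_form 5 3 4"
            and K = "\<lambda>t b y. tr t b q y" and w = v and a = B])
        show "\<exists>y. D t y \<and> tr t b q y" if t: "v \<sqsubseteq> t" "M t b B" for t b
          using tr_exists[OF le_trans[OF v t(1)] op_mono[OF ux t(1)] t(2)]
          by (metis op_D(1) trE)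
        show "fs pr (tr_form 5 3 4) t ([B, f, z0, q] @ [y, b]) \<longleftrightarrow> tr t b q y" for pr t b y
          using fs_tr_form[of "[B, f, z0, q] @ [y, b]" 5 3 4 pr t] by simp
        show "E t y y'" if "v \<sqsubseteq> t" "tr t b q y" "tr t b q y'" for t b y y'
          using tr_unique[OF le_trans[OF v that(1)] that(2,3)] .
      qed (use Ds[OF v] op_D[OF ux] in auto)
      then show ?thesis unfolding step_def by blast
    qed
    show "\<exists>u x. op v q u x" if "w0 \<sqsubseteq> v" "E v q r" for v q
      using op_cong[OF op_mono[OF rs that(1)] E_sym[OF that(2)]] op_self[OF op_mono[OF rs that(1)]] by blast
    show "\<exists>u x. op v q' u x" if "step v q q'" for v q q'
      using that unfolding step_def by (meson trE)
    show "step v q q'" if "u \<sqsubseteq> v" "step u q q'" for u v q q'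
      using that tr_mono M_mono unfolding step_def by meson
    show "step v q q''" if "step v q q'" "E v q' q''" for v q q' q''
      using that tr_cong unfolding step_def by meson
    show "D v q'" if "step v q q'" for v q q'
      using that op_D(1) unfolding step_def by (meson trE)
    show "D w0 r" using op_D(1)[OF rs] .
    show "\<forall>p\<in>set [B, f, z0]. D w0 p" using B f z0(1) by simp
  qed blast
  then show ?thesis using r unfolding orb_def by blast
qed

definition R where "R = (SOME R. \<exists>r. orb r R)"

lemma R:
  obtains r where "orb r R"
  using someI_ex[OF orb_exists] unfolding R_def by blast

lemma R_D: "D w0 R"
  using R unfolding orb_def by blast

lemma R_step: "w0 \<sqsubseteq> v \<Longrightarrow> M v q R \<Longrightarrow> step v q q' \<Longrightarrow> M v q' R"
  using R unfolding orb_def by metis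

lemma R_root:
  obtains s where "D w0 s" "w0 \<sqsubseteq> v \<Longrightarrow> pm v z0 s R"
    "\<And>v z. w0 \<sqsubseteq> v \<Longrightarrow> M v z s \<longleftrightarrow> (\<exists>a. M v a A \<and> op v z a z0)"
proof -
  obtain r where r: "orb r R" by (rule R)
  then obtain s where s: "op w0 r z0 s"
    "\<forall>t z. w0 \<sqsubseteq> t \<longrightarrow> D t z \<longrightarrow> (M t z s \<longleftrightarrow> (\<exists>a. M t a A \<and> op t z a z0))"
    unfolding orb_def root_rule_def by blast
  have "pm w0 z0 s R" using pmI[OF _ s(1)] r unfolding orb_def by blast
  then show thesis using that[of s] s op_D[OF s(1)] pm_mono M_Ds(1) by (meson op_D(1))
qed

lemma R_cases:
  assumes v: "w0 \<sqsubseteq> v" and ux: "pm v u x R"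
  obtains (root) "\<And>t z. v \<sqsubseteq> t \<Longrightarrow> \<not> M t z u"
      "\<And>t z. v \<sqsubseteq> t \<Longrightarrow> M t z x \<longleftrightarrow> (\<exists>a. M t a A \<and> op t z a z0)"
    | (step) u1 x1 b a where "pm v u1 x1 R" "pm v b a f" "guard v u a b u1" "shift v x b x1"
proof -
  obtain r where r: "orb r R" by (rule R)
  then obtain s where s: "op w0 r z0 s"
    "\<forall>t z. w0 \<sqsubseteq> t \<longrightarrow> D t z \<longrightarrow> (M t z s \<longleftrightarrow> (\<exists>a. M t a A \<and> op t z a z0))"
    unfolding orb_def root_rule_def by blast
  obtain q where q: "M v q R" "op v q u x" using ux unfolding pm_def by blast
  have "E v q r \<or> (\<exists>q'. M v q' R \<and> step v q' q)" using r v q(1) unfolding orb_def by blast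
  then show thesis
  proof
    assume e: "E v q r"
    have "op v q z0 s" using op_cong[OF op_mono[OF s(1) v] E_sym[OF e]] op_self[OF op_mono[OF s(1) v]] by blast
    then have eq: "E v u z0" "E v x s" using op_inj[OF q(2)] by blast+
    show thesis
    proof (rule root)
      show "\<not> M t z u" if "v \<sqsubseteq> t" for t z
        using E_iff(1)[OF eq(1) that] z0(2)[OF le_trans[OF v that]] by blast
      show "M t z x \<longleftrightarrow> (\<exists>a. M t a A \<and> op t z a z0)" if "v \<sqsubseteq> t" for t z
        using E_iff(1)[OF eq(2) that] s(2) le_trans[OF v that] op_D(1) M_Ds(1) by meson
    qed
  next
    assume "\<exists>q'. M v q' R \<and> step v q' q"
    then obtain q' b where q': "M v q' R" "tr v b q' q" unfolding step_def by blast
    from q'(2) obtain u1 x1 u' x' a where 1: "op v q' u1 x1" "op v q u' x'" "pm v b a f"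
      "guard v u' a b u1" "shift v x' b x1" by (rule trE)
    have eq: "E v u' u" "E v x' x" using op_inj[OF 1(2) q(2)] by blast+
    have "guard v u a b u1" "shift v x b x1"
      using 1(4,5) E_iff(1)[OF eq(1)] E_iff(1)[OF eq(2)] unfolding guard_def shift_def by blast+
    then show thesis using step pmI[OF q'(1) 1(1)] 1(3) by blast
  qed
qed

lemma R_translate:
  assumes v: "w0 \<sqsubseteq> v" and ux: "pm v u x R" and b: "pm v b a f"
  obtains u' x' where "pm v u' x' R" "guard v u' a b u" "shift v x' b x"
proof -
  obtain q where q: "M v q R" "op v q u x" using ux unfolding pm_def by blast
  have bB: "M v b B" using f_in[OF v b] by blast
  obtain q' where q': "tr v b q q'" using tr_exists[OF v q(2) bB] by blast
  then have qR: "M v q' R" using R_step[OF v q(1)] bB unfolding step_def by blast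
  from q' obtain u1 x1 u' x' a' where 1: "op v q u1 x1" "op v q' u' x'" "pm v b a' f"
    "guard v u' a' b u1" "shift v x' b x1" by (rule trE)
  have eq: "E v u1 u" "E v x1 x" "E v a' a" using op_inj[OF 1(1) q(2)] f_unique[OF v 1(3) b] by blast+
  have "op t z a' z0 \<longleftrightarrow> op t z a z0" if "v \<sqsubseteq> t" for t z
    using op_cong op_self E_mono[OF eq(3) that] E_sym by meson
  then have "guard v u' a b u" "shift v x' b x"
    using 1(4,5) E_iff(1)[OF eq(1)] E_iff(1)[OF eq(2)] unfolding guard_def shift_def by simp_all
  then show thesis using that pmI[OF qR 1(2)] by blast
qed

text \<open>The paths are obtained from the rules: those that occur in a premise or a conclusion.
  This avoids a second recursion on the length of paths.\<close>

definition X where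
  "X = (SOME X. D w0 X \<and> (\<forall>v q. w0 \<sqsubseteq> v \<longrightarrow>
     (M v q X \<longleftrightarrow> (\<exists>u x. pm v u x R \<and> (M v q u \<or> M v q x)))))"

lemma R_pairs: assumes v: "w0 \<sqsubseteq> v" and r: "M v r R" shows "\<exists>u x. op v r u x"
proof -
  obtain r' where r': "orb r' R" by (rule R)
  then obtain s where s: "op w0 r' z0 s" unfolding orb_def root_rule_def by blast
  have "E v r r' \<or> (\<exists>q'. M v q' R \<and> step v q' r)" using r' v r unfolding orb_def by blast
  then show ?thesis
  proof
    assume e: "E v r r'"
    show ?thesis using op_cong[OF op_mono[OF s(1) v] E_sym[OF e]] op_self[OF op_mono[OF s(1) v]] by blast
  next
    assume "\<exists>q'. M v q' R \<and> step v q' r"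
    then show ?thesis unfolding step_def by (meson trE)
  qed
qed

lemma X: "D w0 X" "w0 \<sqsubseteq> v \<Longrightarrow> M v q X \<longleftrightarrow> (\<exists>u x. pm v u x R \<and> (M v q u \<or> M v q x))"
proof -
  \<comment> \<open>Three unions unpack the rules: from a rule (u, x) to its Kuratowski members,
    from these to \<open>u\<close> and \<open>x\<close>, from these to paths.\<close>
  obtain U1 where U1: "D w0 U1" "\<And>v x. w0 \<sqsubseteq> v \<Longrightarrow> M v x U1 \<longleftrightarrow> (\<exists>y. M v y R \<and> M v x y)"
    using union[OF R_D] by blast
  obtain U2 where U2: "D w0 U2" "\<And>v x. w0 \<sqsubseteq> v \<Longrightarrow> M v x U2 \<longleftrightarrow> (\<exists>y. M v y U1 \<and> M v x y)"
    using union[OF U1(1)] by blast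
  obtain U3 where U3: "D w0 U3" "\<And>v x. w0 \<sqsubseteq> v \<Longrightarrow> M v x U3 \<longleftrightarrow> (\<exists>y. M v y U2 \<and> M v x y)"
    using union[OF U2(1)] by blast
  have "M v q U3 \<longleftrightarrow> (\<exists>u x. pm v u x R \<and> (M v q u \<or> M v q x))" if v: "w0 \<sqsubseteq> v" for v q
  proof
    assume "M v q U3"
    then obtain y c r where y: "M v r R" "M v c r" "M v y c" "M v q y"
      unfolding U3(2)[OF v] U2(2)[OF v] U1(2)[OF v] by blast
    obtain u x where ux: "op v r u x" using R_pairs[OF v y(1)] by blast
    then have "E v y u \<or> E v y x" using op_members y(2,3) by blast
    then show "\<exists>u x. pm v u x R \<and> (M v q u \<or> M v q x)"
      using pmI[OF y(1) ux] y(4) E_iff(1)[OF _ le_refl] by blast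
  next
    assume "\<exists>u x. pm v u x R \<and> (M v q u \<or> M v q x)"
    then obtain r u x where ux: "M v r R" "op v r u x" "M v q u \<or> M v q x" unfolding pm_def by blast
    have "E v u u" "E v x x" using op_self[OF ux(2)] by blast+
    then have "M v u U2" "M v x U2"
      using op_members[OF ux(2)] U1(2)[OF v] U2(2)[OF v] ux(1) by blast+
    then show "M v q U3" using U3(2)[OF v] ux(3) by blast
  qed
  then have "\<exists>X. D w0 X \<and> (\<forall>v q. w0 \<sqsubseteq> v \<longrightarrow>
     (M v q X \<longleftrightarrow> (\<exists>u x. pm v u x R \<and> (M v q u \<or> M v q x))))" using U3(1) by blast
  from someI_ex[OF this] show "D w0 X"
    "w0 \<sqsubseteq> v \<Longrightarrow> M v q X \<longleftrightarrow> (\<exists>u x. pm v u x R \<and> (M v q u \<or> M v q x))"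
    unfolding X_def by blast+
qed

lemma rule_sub: "w0 \<sqsubseteq> v \<Longrightarrow> pm v u x R \<Longrightarrow> sub v u X" "w0 \<sqsubseteq> v \<Longrightarrow> pm v u x R \<Longrightarrow> sub v x X"
  unfolding sub_def using X(2) pm_mono le_trans by blast+

lemma X_rule_set: "rule_set w0 R X"
  unfolding rule_set_def using R_pairs rule_sub pmI by blast

text \<open>A path is a Kuratowski pair and so inhabited, unlike the end mark. Hence a root label
  (a, z0) never equals a longer path (b, q), even if \<open>A\<close> and \<open>B\<close>
  overlap.\<close>

lemma X_inhabited:
  assumes v: "w0 \<sqsubseteq> v" and q: "M v q X"
  shows "\<exists>t. M v t q"
proof -
  obtain u x where ux: "pm v u x R" "M v q u \<or> M v q x" using X(2)[OF v] q by blast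
  have Dq: "D v q" using q M_Ds(1) by blast
  from v ux(1) show ?thesis
  proof (cases rule: R_cases)
    case root
    then show ?thesis using ux(2) le_refl op_inhabited by blast
  next
    case (step u1 x1 b a)
    then have "op v q a z0 \<or> (\<exists>p. op v q b p)"
      using ux(2) Dq le_refl[of v] unfolding guard_def shift_def by blast
    then show ?thesis using op_inhabited by blast
  qed
qed

lemma X_root: "w0 \<sqsubseteq> v \<Longrightarrow> M v a A \<Longrightarrow> op v q a z0 \<Longrightarrow> M v q X"
  using R_root X(2) by metis

lemma X_node:
  assumes v: "w0 \<sqsubseteq> v" and b: "M v b B" and q: "M v q X" "op v p b q"
  shows "M v p X"
proof -
  obtain u x where ux: "pm v u x R" "M v q u \<or> M v q x" using X(2)[OF v] q by blast
  obtain a where a: "pm v b a f" using f_ex[OF v b] by blast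
  obtain u' x' where ux': "pm v u' x' R" "guard v u' a b u" "shift v x' b x"
    using R_translate[OF v ux(1) a] by blast
  have "M v p u' \<or> M v p x'"
    using ux'(2,3) ux(2) q(2) op_D(1)[OF q(2)] le_refl[of v] unfolding guard_def shift_def by blast
  then show ?thesis using X(2)[OF v] ux'(1) by blast
qed

lemma not_z0: "w0 \<sqsubseteq> v \<Longrightarrow> M v q X \<Longrightarrow> \<not> E v q z0"
  using X_inhabited not_root by blast

text \<open>The root rule has an empty premise and all root labels as conclusion. In particular
  every closed set is inhabited, as the generation argument requires.\<close>

lemma closed_root:
  assumes v: "w0 \<sqsubseteq> v" and Y: "closed v R Y"
  obtains a where "M v a A" "pm v a z0 Y"
proof -
  obtain s where s: "D w0 s" "w0 \<sqsubseteq> v \<Longrightarrow> pm v z0 s R"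
    "\<And>v z. w0 \<sqsubseteq> v \<Longrightarrow> M v z s \<longleftrightarrow> (\<exists>a. M v a A \<and> op v z a z0)"
    using R_root[of v] by blast
  have "sub v z0 Y" unfolding sub_def using z0(2) le_trans[OF v] by blast
  then obtain z where "M v z s" "M v z Y" using closedD[OF Y s(2)[OF v]] by blast
  then show thesis using s(3)[OF v] pmI that by blast
qed

text \<open>\<open>s\<close> is the subtree of \<open>y\<close> at \<open>b\<close>.\<close>

definition child where
  "child v s b y \<longleftrightarrow> (\<forall>t q. v \<sqsubseteq> t \<longrightarrow> (M t q s \<longleftrightarrow> M t q X \<and> pm t b q y))"

lemma child_exists:
  assumes v: "w0 \<sqsubseteq> v" and D: "D v b" "D v y"
  obtains s where "D v s" "child v s b y"
proof -
  obtain s where "D v s" "\<And>t q. v \<sqsubseteq> t \<Longrightarrow> M t q s \<longleftrightarrow> M t q X \<and> pm t b q y"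
    by (rule separation[where ps = "[b, y]" and F = "b_pm 0 2 1" and w = v and a = X])
      (use D D_mono[OF X(1) v] in auto)
  then show thesis using that unfolding child_def by blast
qed

text \<open>A rule holds for the subtree at \<open>b\<close> because its translate along
  \<open>b\<close> holds for \<open>Y\<close>: the translated premise consists of the root label
  \<open>a\<close>, which is in \<open>Y\<close>, and of paths that start with \<open>b\<close> and
  continue in \<open>s\<close>.\<close>

lemma child_closed:
  assumes v: "w0 \<sqsubseteq> v" and Y: "closed v R Y" and b: "pm v b a f" "pm v a z0 Y"
    and s: "child v s b Y"
  shows "closed v R s"
  unfolding closed_def
proof (intro allI impI)
  fix t u x assume t: "v \<sqsubseteq> t" and ux: "pm t u x R" and us: "sub t u s"
  have wt: "w0 \<sqsubseteq> t" using le_trans v t by blast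
  obtain u' x' where ux': "pm t u' x' R" "guard t u' a b u" "shift t x' b x"
    using R_translate[OF wt ux pm_mono[OF b(1) t]] by blast
  have "sub t u' Y" unfolding sub_def
  proof (intro allI impI)
    fix t' z assume t': "t \<sqsubseteq> t'" and z: "M t' z u'"
    have vt': "v \<sqsubseteq> t'" using le_trans t t' by blast
    have "op t' z a z0 \<or> (\<exists>q. M t' q u \<and> op t' z b q)"
      using ux'(2) t' z M_Ds(1)[OF z] unfolding guard_def by blast
    then show "M t' z Y"
    proof
      assume "op t' z a z0"
      then show ?thesis using pm_mono[OF b(2) vt'] pm_op by blast
    next
      assume "\<exists>q. M t' q u \<and> op t' z b q"
      then obtain q where q: "M t' q u" "op t' z b q" by blast
      then have "M t' q s" using us t' unfolding sub_def by blast
      then have "pm t' b q Y" using s vt' unfolding child_def by blast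
      then show ?thesis using pm_op[OF q(2)] by blast
    qed
  qed
  then obtain z where z: "M t z x'" "M t z Y" using closedD[OF closed_mono[OF Y t] ux'(1)] by blast
  then obtain q where q: "M t q x" "op t z b q"
    using ux'(3) le_refl[of t] M_Ds(1)[OF z(1)] unfolding shift_def by blast
  have "M t q X" using subD[OF rule_sub(2)[OF wt ux] q(1)] .
  moreover have "pm t b q Y" using pmI[OF z(2) q(2)] .
  ultimately have "M t q s" using s t unfolding child_def by blast
  then show "\<exists>z. M t z x \<and> M t z s" using q(1) by blast
qed

definition minimal where
  "minimal v y \<longleftrightarrow> D v y \<and> sub v y X \<and> closed v R y \<and>
     (\<forall>t z. v \<sqsubseteq> t \<longrightarrow> D t z \<longrightarrow> closed t R z \<longrightarrow> sub t z y \<longrightarrow> sub t y z)"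

lemma minimal_mono: "minimal u y \<Longrightarrow> u \<sqsubseteq> v \<Longrightarrow> minimal v y"
  unfolding minimal_def using D_mono sub_mono closed_mono le_trans by blast

text \<open>\<open>s\<close> is a function from the fibre of \<open>a\<close> to \<open>Z\<close>.\<close>

definition fam where
  "fam v a s Z \<longleftrightarrow> D v s \<and>
     (\<forall>t p. v \<sqsubseteq> t \<longrightarrow> M t p s \<longrightarrow> (\<exists>b y. pm t b a f \<and> M t y Z \<and> op t p b y)) \<and>
     (\<forall>t b. v \<sqsubseteq> t \<longrightarrow> pm t b a f \<longrightarrow> (\<exists>y. pm t b y s)) \<and>
     (\<forall>t b y y'. v \<sqsubseteq> t \<longrightarrow> pm t b y s \<longrightarrow> pm t b y' s \<longrightarrow> E t y y')"

lemma fam_mono: assumes "fam u a s Z" "u \<sqsubseteq> v" shows "fam v a s Z"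
proof -
  have "D v s" using assms D_mono unfolding fam_def by blast
  then show ?thesis using assms(1) le_trans[OF assms(2)] unfolding fam_def by simp
qed

lemma fam_in:
  assumes "fam v a s Z" "pm v b y s"
  shows "pm v b a f" "M v y Z"
proof -
  obtain p where p: "M v p s" "op v p b y" using assms(2) unfolding pm_def by blast
  then obtain b' y' where b': "pm v b' a f" "M v y' Z" "op v p b' y'"
    using assms(1) le_refl unfolding fam_def by blast
  have eq: "E v b' b" "E v y' y" using op_inj[OF b'(3) p(2)] by blast+
  show "pm v b a f" using pm_cong[OF b'(1) eq(1)] E_refl pm_D[OF b'(1)] by blast
  show "M v y Z" using b'(2) E_iff(2)[OF eq(2) le_refl] by blast
qed

lemma fam_ex: "fam v a s Z \<Longrightarrow> pm v b a f \<Longrightarrow> \<exists>y. pm v b y s"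
  unfolding fam_def using le_refl by blast

lemma fam_unique: "fam v a s Z \<Longrightarrow> pm v b y s \<Longrightarrow> pm v b y' s \<Longrightarrow> E v y y'"
  unfolding fam_def using le_refl by blast

lemma fam_sub: "fam v a s Z \<Longrightarrow> sub v Z Z' \<Longrightarrow> fam v a s Z'"
  unfolding fam_def sub_def by blast

text \<open>The constructor of the W-type: the tree with root label \<open>a\<close> whose subtree
  at \<open>b\<close> is the value of \<open>s\<close> at \<open>b\<close>.\<close>

definition sup where
  "sup v y a s \<longleftrightarrow> D v y \<and> (\<forall>t p. v \<sqsubseteq> t \<longrightarrow>
     (M t p y \<longleftrightarrow> op t p a z0 \<or> (\<exists>b z q. pm t b z s \<and> M t q z \<and> op t p b q)))"

lemma sup_mono: assumes "sup u y a s" "u \<sqsubseteq> v" shows "sup v y a s"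
proof -
  have "D v y" using assms D_mono unfolding sup_def by blast
  then show ?thesis using assms(1) le_trans[OF assms(2)] unfolding sup_def by simp
qed

lemma sup_unique: assumes "sup v y a s" "sup v y' a s" shows "E v y y'"
proof (rule extensionality)
  show "M t p y \<longleftrightarrow> M t p y'" if "v \<sqsubseteq> t" for t p
    using assms that unfolding sup_def by simp
qed (use assms in \<open>simp_all add: sup_def\<close>)

section \<open>Joining trees below a root\<close>

definition trees where
  "trees v Z \<longleftrightarrow> (\<forall>t y. v \<sqsubseteq> t \<longrightarrow> M t y Z \<longrightarrow> minimal t y)"

lemma trees_mono: "trees u Z \<Longrightarrow> u \<sqsubseteq> v \<Longrightarrow> trees v Z"
  unfolding trees_def using le_trans by blast

lemma fam_minimal: "fam v a s Z \<Longrightarrow> trees v Z \<Longrightarrow> pm v b y s \<Longrightarrow> minimal v y"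
  using fam_in(2) le_refl unfolding trees_def by blast

lemma minimal_X: "minimal v y \<Longrightarrow> M v q y \<Longrightarrow> M v q X"
  unfolding minimal_def using subD by blast

text \<open>The only path of length one in \<open>y\<close> is the intended one: all others continue
  with a path in some subtree, which is inhabited and so differs from \<open>z0\<close>.\<close>

lemma sup_root:
  assumes v: "w0 \<sqsubseteq> v" and s: "fam v a s Z" "trees v Z" and y: "sup v y a s" and a': "pm v a' z0 y"
  shows "E v a' a"
proof -
  obtain p where p: "M v p y" "op v p a' z0" using a' unfolding pm_def by blast
  then have "op v p a z0 \<or> (\<exists>b z q. pm v b z s \<and> M v q z \<and> op v p b q)"
    using y le_refl unfolding sup_def by blast
  then show ?thesis
  proof
    assume "op v p a z0"
    then show ?thesis using op_inj(1) p(2) by blast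
  next
    assume "\<exists>b z q. pm v b z s \<and> M v q z \<and> op v p b q"
    then obtain b z q where b: "pm v b z s" "M v q z" "op v p b q" by blast
    have "M v q X" using minimal_X[OF fam_minimal[OF s b(1)] b(2)] .
    moreover have "E v q z0" using op_inj(2)[OF b(3) p(2)] .
    ultimately show ?thesis using not_z0[OF v] by blast
  qed
qed

lemma sup_node:
  assumes v: "w0 \<sqsubseteq> v" and s: "fam v a s Z" "trees v Z" and y: "sup v y a s"
    and b: "pm v b z s" and q: "M v q X"
  shows "pm v b q y \<longleftrightarrow> M v q z"
proof
  assume "pm v b q y"
  then obtain p where p: "M v p y" "op v p b q" unfolding pm_def by blast
  then have "op v p a z0 \<or> (\<exists>b z q. pm v b z s \<and> M v q z \<and> op v p b q)"
    using y le_refl unfolding sup_def by blast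
  then show "M v q z"
  proof
    assume "op v p a z0"
    then show ?thesis using op_inj(2)[OF p(2)] not_z0[OF v q] by blast
  next
    assume "\<exists>b z q. pm v b z s \<and> M v q z \<and> op v p b q"
    then obtain b' z' q' where b': "pm v b' z' s" "M v q' z'" "op v p b' q'" by blast
    have eq: "E v b' b" "E v q' q" using op_inj[OF b'(3) p(2)] by blast+
    have "pm v b z' s" using pm_cong[OF b'(1) eq(1)] E_refl pm_D[OF b'(1)] by blast
    then have "E v z' z" using fam_unique[OF s(1) _ b] by blast
    then show ?thesis using M_cong[OF b'(2) eq(2)] by blast
  qed
next
  assume *: "M v q z"
  obtain p where p: "op v p b q" using op_exists[OF pm_D(1)[OF b] M_Ds(1)[OF q]] by blast
  then have "M v p y" using y b * le_refl unfolding sup_def by blast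
  then show "pm v b q y" using p pmI by blast
qed

lemma sup_child:
  assumes v: "w0 \<sqsubseteq> v" and s: "fam v a s Z" "trees v Z" and y: "sup v y a s" and b: "pm v b z s"
  shows "child v z b y"
  unfolding child_def
proof (intro allI impI)
  fix t q assume t: "v \<sqsubseteq> t"
  have "M t q z \<Longrightarrow> M t q X"
    using minimal_X[OF minimal_mono[OF fam_minimal[OF s b] t]] .
  then show "M t q z \<longleftrightarrow> M t q X \<and> pm t b q y"
    using sup_node[OF le_trans[OF v t] fam_mono[OF s(1) t] trees_mono[OF s(2) t] sup_mono[OF y t]
        pm_mono[OF b t]] by blast
qed

lemma child_unique: "child v s b y \<Longrightarrow> child v s' b y \<Longrightarrow> D v s \<Longrightarrow> D v s' \<Longrightarrow> E v s s'"
  unfolding child_def by (intro extensionality) blast+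

text \<open>Closedness: a rule translated along \<open>b\<close> has the label \<open>f b\<close> in
  its premise; if that premise lies in \<open>y\<close>, the label is \<open>a\<close>, so
  \<open>s\<close> has a value at \<open>b\<close>, and this value obeys the untranslated rule.
  Minimality: a closed \<open>Y\<close> inside \<open>y\<close> has root label \<open>a\<close>, and
  its subtree at each \<open>b\<close> is a closed subset of the minimal value of
  \<open>s\<close>.\<close>

lemma sup_minimal:
  assumes v: "w0 \<sqsubseteq> v" and a: "M v a A" and s: "fam v a s Z" "trees v Z" and y: "sup v y a s"
  shows "minimal v y"
  unfolding minimal_def
proof (intro conjI allI impI)
  note up = le_trans[OF v] fam_mono[OF s(1)] trees_mono[OF s(2)] sup_mono[OF y]
  have root_y: "pm t a z0 y" if t: "v \<sqsubseteq> t" for t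
  proof -
    obtain p where p: "op t p a z0"
      using op_exists[OF D_mono[OF M_Ds(1)[OF a] t] Ds(4)[OF up(1)[OF t]]] by blast
    then show ?thesis using y t pmI unfolding sup_def by blast
  qed
  show "D v y" using y unfolding sup_def by blast
  show "sub v y X" unfolding sub_def
  proof (intro allI impI)
    fix t p assume t: "v \<sqsubseteq> t" and p: "M t p y"
    then consider "op t p a z0" | b z q where "pm t b z s" "M t q z" "op t p b q"
      using y unfolding sup_def by blast
    then show "M t p X"
    proof cases
      case 1
      then show ?thesis using X_root[OF up(1)[OF t] M_mono[OF a t]] by blast
    next
      case 2
      have "M t q X" using minimal_X[OF fam_minimal[OF up(2)[OF t] up(3)[OF t] 2(1)] 2(2)] .
      moreover have "M t b B" using f_in[OF up(1)[OF t] fam_in(1)[OF up(2)[OF t] 2(1)]] by blast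
      ultimately show ?thesis using X_node[OF up(1)[OF t] _ _ 2(3)] by blast
    qed
  qed
  show "closed v R y" unfolding closed_def
  proof (intro allI impI)
    fix t u x assume t: "v \<sqsubseteq> t" and ux: "pm t u x R" and uy: "sub t u y"
    note wt = up(1)[OF t] and st = up(2)[OF t] and Zt = up(3)[OF t] and yt = up(4)[OF t]
    from wt ux show "\<exists>z. M t z x \<and> M t z y"
    proof (cases rule: R_cases)
      case root
      obtain p where p: "M t p y" "op t p a z0" using root_y[OF t] unfolding pm_def by blast
      then show ?thesis using root(2)[OF le_refl] M_mono[OF a t] by blast
    next
      case (step u1 x1 b a')
      \<comment> \<open>The guard puts the label (a', z0) into the premise \<open>u\<close>, hence
        into \<open>y\<close>, and \<open>y\<close> has just one root label; so \<open>b\<close>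
        lies over \<open>a\<close>.\<close>
      have "\<exists>p. M t p u \<and> op t p a' z0"
        using op_exists[OF pm_D(2)[OF step(2)] Ds(4)[OF wt]] step(3) le_refl[of t] op_D(1)
        unfolding guard_def by metis
      then have "pm t a' z0 y" using subD[OF uy] pmI by blast
      then have "E t a' a" using sup_root[OF wt st Zt yt] by blast
      then have ba: "pm t b a f" using pm_cong[OF step(2)] E_refl pm_D[OF step(2)] by blast
      then obtain z where z: "pm t b z s" using fam_ex[OF st] by blast
      have "sub t u1 z" unfolding sub_def
      proof (intro allI impI)
        fix t' q assume t': "t \<sqsubseteq> t'" and q: "M t' q u1"
        have wt': "w0 \<sqsubseteq> t'" using le_trans wt t' by blast
        obtain p where p: "op t' p b q"
          using op_exists[OF D_mono[OF pm_D(1)[OF z] t'] M_Ds(1)[OF q]] by blast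
        then have "M t' p u" using step(3) t' q op_D(1)[OF p] unfolding guard_def by blast
        then have "M t' p y" using uy t' unfolding sub_def by blast
        then have "pm t' b q y" using p pmI by blast
        moreover have "M t' q X" using rule_sub(1)[OF wt step(1)] t' q unfolding sub_def by blast
        ultimately show "M t' q z"
          using sup_node[OF wt' fam_mono[OF st t'] trees_mono[OF Zt t'] sup_mono[OF yt t'] pm_mono[OF z t']]
          by blast
      qed
      moreover have "closed t R z" using fam_minimal[OF st Zt z] unfolding minimal_def by blast
      ultimately obtain q where q: "M t q x1" "M t q z" using closedD step(1) by blast
      obtain p where p: "op t p b q" using op_exists[OF pm_D(1)[OF z] M_Ds(1)[OF q(1)]] by blast
      have "M t p x" using step(4) le_refl[of t] q(1) p op_D(1)[OF p] unfolding shift_def by blast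
      moreover have "M t p y" using yt le_refl[of t] z q(2) p unfolding sup_def by blast
      ultimately show ?thesis by blast
    qed
  qed
  fix t Y assume t: "v \<sqsubseteq> t" and Y: "D t Y" "closed t R Y" "sub t Y y"
  note wt = up(1)[OF t] and st = up(2)[OF t] and Zt = up(3)[OF t] and yt = up(4)[OF t]
  obtain a' where a': "pm t a' z0 Y" using closed_root[OF wt Y(2)] by blast
  have pmY: "pm t' x x' y" if "pm t' x x' Y" "t \<sqsubseteq> t'" for t' x x'
    using that Y(3) unfolding pm_def sub_def by blast
  have "E t a' a" using sup_root[OF wt st Zt yt pmY[OF a' le_refl]] .
  then have aY: "pm t a z0 Y" using pm_cong[OF a'] E_refl pm_D[OF a'] by blast
  show "sub t y Y" unfolding sub_def
  proof (intro allI impI)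
    fix t' p assume t': "t \<sqsubseteq> t'" and p: "M t' p y"
    have wt': "w0 \<sqsubseteq> t'" using le_trans wt t' by blast
    note st' = fam_mono[OF st t'] and Zt' = trees_mono[OF Zt t'] and yt' = sup_mono[OF yt t']
    consider "op t' p a z0" | b z q where "pm t' b z s" "M t' q z" "op t' p b q"
      using yt' le_refl[of t'] p unfolding sup_def by blast
    then show "M t' p Y"
    proof cases
      case 1
      then show ?thesis using pm_mono[OF aY t'] pm_op by blast
    next
      case 2
      have DY: "D t' Y" using D_mono[OF Y(1) t'] .
      \<comment> \<open>The subtree \<open>c\<close> of \<open>Y\<close> at \<open>b\<close> is
        closed and contained in \<open>z\<close>; minimality of \<open>z\<close> makes them equal
        and carries \<open>q\<close> into \<open>Y\<close>.\<close>
      obtain c where c: "D t' c" "child t' c b Y" using child_exists[OF wt' pm_D(1)[OF 2(1)] DY] by blast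
      have zmin: "minimal t' z" using fam_minimal[OF st' Zt' 2(1)] .
      have "closed t' R c"
        using child_closed[OF wt' closed_mono[OF Y(2) t'] fam_in(1)[OF st' 2(1)] pm_mono[OF aY t'] c(2)] .
      moreover have "sub t' c z" unfolding sub_def
      proof (intro allI impI)
        fix t2 q2 assume t2: "t' \<sqsubseteq> t2" and q2: "M t2 q2 c"
        then have "M t2 q2 X" "pm t2 b q2 Y" using c(2) unfolding child_def by blast+
        then show "M t2 q2 z"
          using sup_node[OF le_trans[OF wt' t2] fam_mono[OF st' t2] trees_mono[OF Zt' t2]
              sup_mono[OF yt' t2] pm_mono[OF 2(1) t2]] pmY[OF _ le_trans[OF t' t2]] by blast
      qed
      ultimately have "sub t' z c" using zmin c(1) le_refl[of t'] unfolding minimal_def by blast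
      then have "M t' q c" using subD 2(2) by blast
      then have "pm t' b q Y" using c(2) le_refl[of t'] unfolding child_def by blast
      then show ?thesis using pm_op[OF 2(3)] by blast
    qed
  qed
qed

definition T where
  "T = (SOME T. D w0 T \<and> (\<forall>v y. w0 \<sqsubseteq> v \<longrightarrow> (M v y T \<longleftrightarrow> minimal v y)))"

lemma T: "D w0 T" "w0 \<sqsubseteq> v \<Longrightarrow> M v y T \<longleftrightarrow> minimal v y"
proof -
  from nid[OF X(1) R_D X_rule_set] obtain G where G: "D w0 G"
    "\<And>v \<beta>. w0 \<sqsubseteq> v \<Longrightarrow> M v \<beta> G \<Longrightarrow> sub v \<beta> X" "\<And>v \<beta>. w0 \<sqsubseteq> v \<Longrightarrow> M v \<beta> G \<Longrightarrow> closed v R \<beta>"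
    "\<And>v \<alpha> x. w0 \<sqsubseteq> v \<Longrightarrow> D v \<alpha> \<Longrightarrow> sub v \<alpha> X \<Longrightarrow> closed v R \<alpha> \<Longrightarrow> M v x \<alpha> \<Longrightarrow>
      \<exists>\<beta>. M v \<beta> G \<and> M v x \<beta> \<and> sub v \<beta> \<alpha>"
    by blast
  \<comment> \<open>A closed set contains some root path; generation at that path yields a member of
    \<open>G\<close> below it.\<close>
  have dense: "\<exists>\<beta>. M v \<beta> G \<and> sub v \<beta> y"
    if v: "w0 \<sqsubseteq> v" and y: "D v y" "sub v y X" "closed v R y" for v y
  proof -
    obtain a where "pm v a z0 y" using closed_root[OF v y(3)] by blast
    then show ?thesis using G(4)[OF v y] unfolding pm_def by blast
  qed
  \<comment> \<open>Minimality is tested against members of \<open>G\<close> alone, which is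
    bounded. This suffices because \<open>dense\<close> puts a member of \<open>G\<close> below any
    closed set.\<close>
  obtain S where T: "D w0 S" "\<And>v y. w0 \<sqsubseteq> v \<Longrightarrow> M v y S \<longleftrightarrow> M v y G \<and>
      (\<forall>t. v \<sqsubseteq> t \<longrightarrow> (\<forall>\<beta>. M t \<beta> G \<longrightarrow> (\<forall>u. t \<sqsubseteq> u \<longrightarrow> sub u \<beta> y \<longrightarrow> sub u y \<beta>)))"
  proof (rule separation[where ps = "[G]" and w = w0 and a = G and
        F = "ball 0 (\<lambda>\<beta>. ball \<beta> (\<lambda>x. x \<^bold>\<in> 1) \<^bold>\<longrightarrow> ball 1 (\<lambda>x. x \<^bold>\<in> \<beta>))"])
  qed (use G(1) in \<open>auto simp: sub_def\<close>)
  have "M v y S \<longleftrightarrow> minimal v y" if v: "w0 \<sqsubseteq> v" for v y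
  proof
    assume "M v y S"
    then have y: "M v y G" "\<And>u \<beta>. v \<sqsubseteq> u \<Longrightarrow> M u \<beta> G \<Longrightarrow> sub u \<beta> y \<Longrightarrow> sub u y \<beta>"
      using T(2)[OF v] le_refl by blast+
    show "minimal v y" unfolding minimal_def
    proof (intro conjI allI impI)
      show "D v y" using M_Ds(1)[OF y(1)] .
      show "sub v y X" "closed v R y" using G(2,3)[OF v y(1)] .
      fix t z assume t: "v \<sqsubseteq> t" and z: "D t z" "closed t R z" "sub t z y"
      have "sub t z X" using sub_trans[OF z(3)] sub_mono[OF G(2)[OF v y(1)] t] by blast
      then obtain \<beta> where \<beta>: "M t \<beta> G" "sub t \<beta> z" using dense[OF le_trans[OF v t] z(1) _ z(2)] by blast
      then have "sub t y \<beta>" using y(2)[OF t \<beta>(1)] sub_trans z(3) by blast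
      then show "sub t y z" using sub_trans \<beta>(2) by blast
    qed
  next
    assume y: "minimal v y"
    then have y': "D v y" "sub v y X" "closed v R y" unfolding minimal_def by blast+
    then obtain \<beta> where \<beta>: "M v \<beta> G" "sub v \<beta> y" using dense[OF v] by blast
    have min: "sub u y z" if "v \<sqsubseteq> u" "M u z G" "sub u z y" for u z
      using y that G(3)[OF le_trans[OF v that(1)] that(2)] M_Ds(1)[OF that(2)]
      unfolding minimal_def by blast
    have "E v \<beta> y" using sub_antisym[OF \<beta>(2) min[OF le_refl \<beta>]] M_Ds(1)[OF \<beta>(1)] y'(1) by blast
    then have "M v y G" using \<beta>(1) E_iff(2)[OF _ le_refl] by blast
    moreover have "sub u y z" if "v \<sqsubseteq> t" "M t z G" "t \<sqsubseteq> u" "sub u z y" for t u z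
      using min[OF le_trans[OF that(1,3)] M_mono[OF that(2,3)] that(4)] .
    ultimately show "M v y S" using T(2)[OF v] by blast
  qed
  then have "\<exists>T. D w0 T \<and> (\<forall>v y. w0 \<sqsubseteq> v \<longrightarrow> (M v y T \<longleftrightarrow> minimal v y))" using T(1) by blast
  from someI_ex[OF this] show "D w0 T" "w0 \<sqsubseteq> v \<Longrightarrow> M v y T \<longleftrightarrow> minimal v y"
    unfolding T_def by blast+
qed

lemma trees_T: "w0 \<sqsubseteq> v \<Longrightarrow> trees v T"
  unfolding trees_def using T(2) le_trans by blast

lemma sup_exists:
  assumes v: "w0 \<sqsubseteq> v" and a: "M v a A" and s: "fam v a s T"
  obtains y where "sup v y a s"
proof -
  have Ds': "D v X" "D v T" "D v s" "D v a" "D v z0" "D v B"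
    using D_mono[OF X(1) v] D_mono[OF T(1) v] s M_Ds(1)[OF a] Ds[OF v] unfolding fam_def by blast+
  \<comment> \<open>\<open>sup\<close> itself is unbounded. Bounding \<open>b\<close> by
    \<open>B\<close>, \<open>z\<close> by \<open>T\<close> and the path by \<open>X\<close> gives an
    admissible formula, and the bounds turn out to hold automatically.\<close>
  obtain y where y: "D v y" "\<And>t p. v \<sqsubseteq> t \<Longrightarrow> M t p y \<longleftrightarrow> M t p X \<and> (op t p a z0 \<or>
      (\<exists>b. M t b B \<and> (\<exists>z. M t z T \<and> pm t b z s \<and> (\<exists>q. M t q z \<and> op t p b q))))"
    by (rule separation[where ps = "[a, z0, B, T, s]" and w = v and a = X and
        F = "b_pair 5 0 1 \<^bold>\<or> bex 2 (\<lambda>b. bex 3 (\<lambda>z. b_pm b z 4 \<^bold>\<and> bex z (\<lambda>q. b_pair 5 b q)))"])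
      (use Ds' in auto)
  have "M t p X \<and> M t b B \<and> M t z T"
    if t: "v \<sqsubseteq> t" and b: "pm t b z s" "M t q z" "op t p b q" for t p b z q
  proof -
    have wt: "w0 \<sqsubseteq> t" using le_trans v t by blast
    have zT: "M t z T" and bf: "pm t b a f" using fam_in[OF fam_mono[OF s t] b(1)] by blast+
    have qX: "M t q X" using minimal_X T(2)[OF wt] zT b(2) by blast
    have bB: "M t b B" using f_in[OF wt bf] by blast
    show ?thesis using X_node[OF wt bB qX b(3)] zT bB by blast
  qed
  moreover have "M t p X" if "v \<sqsubseteq> t" "op t p a z0" for t p
    using X_root[OF le_trans[OF v that(1)] M_mono[OF a that(1)] that(2)] .
  ultimately have "sup v y a s" unfolding sup_def using y by blast
  then show thesis by (rule that)
qed

end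

section \<open>Well-founded trees\<close>

context family
begin

section \<open>Immediate subtrees and their bounded formulas\<close>

lemma child_cong:
  assumes "child v s b y" "E v s s'" "E v b b'" "E v y y'"
  shows "child v s' b' y'"
  unfolding child_def
proof (intro allI impI)
  fix t q assume t: "v \<sqsubseteq> t"
  have e: "E t b b'" "E t y y'" "E t b' b" "E t y' y"
    using assms(3,4) E_mono[OF _ t] E_sym by blast+
  have "pm t b q y \<longleftrightarrow> pm t b' q y'"
    using pm_cong[of t b q y b' q y'] pm_cong[of t b' q y' b q y] e E_refl pm_D(2) by blast
  then show "M t q s' \<longleftrightarrow> M t q X \<and> pm t b' q y'"
    using assms(1) t E_iff(1)[OF assms(2) t] unfolding child_def by blast
qed

lemma sup_cong: "sup v y a s \<Longrightarrow> E v y y' \<Longrightarrow> sup v y' a s"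
  using E_D E_iff(1) unfolding sup_def by simp

lemma sup_rootI: "w0 \<sqsubseteq> v \<Longrightarrow> M v a A \<Longrightarrow> sup v y a s \<Longrightarrow> pm v a z0 y"
  using op_exists[of v a z0] Ds(4) M_Ds(1) pmI le_refl unfolding sup_def by metis

text \<open>That the subtrees of a minimal closed set are minimal is not established; it is imposed
  here as a condition. Elements of \<open>W\<close> satisfy it by \<open>W_subtrees\<close>.\<close>

definition good where
  "good v y \<longleftrightarrow> (\<forall>t b a. v \<sqsubseteq> t \<longrightarrow> pm t b a f \<longrightarrow> pm t a z0 y \<longrightarrow> (\<exists>s. M t s T \<and> child t s b y))"

definition subtree where
  "subtree v y s \<longleftrightarrow> M v s T \<and> (\<exists>b a. pm v b a f \<and> pm v a z0 y \<and> child v s b y)"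

text \<open>These parameters occupy the levels 0 to 5, which explains the numerals in the formulas
  that follow.\<close>

abbreviation params where "params \<equiv> [A, B, f, z0, T, X]"

lemma params: "w0 \<sqsubseteq> v \<Longrightarrow> \<forall>p\<in>set params. D v p"
  using Ds D_mono[OF T(1)] D_mono[OF X(1)] by simp

lemma take_params:
  assumes "take 6 e = params"
  shows "5 < length e" "e \<noteq> []" "e ! 0 = A" "e ! 1 = B" "e ! 2 = f" "e ! 3 = z0" "e ! 4 = T" "e ! 5 = X"
proof -
  obtain l where "e = params @ l" using assms by (metis append_take_drop_id)
  then show "5 < length e" "e \<noteq> []" "e ! 0 = A" "e ! 1 = B" "e ! 2 = f" "e ! 3 = z0" "e ! 4 = T" "e ! 5 = X"
    by simp_all
qed

definition child_form :: "nat \<Rightarrow> nat \<Rightarrow> nat \<Rightarrow> form" where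
  "child_form s b y = ball 5 (\<lambda>q. q \<^bold>\<in> s \<^bold>\<longleftrightarrow> b_pm b q y)"

text \<open>The formula compares \<open>s\<close> with paths in \<open>X\<close> only. Membership of
  \<open>s\<close> in \<open>T\<close> ensures that \<open>s\<close> has no elements outside
  \<open>X\<close>, so that this comparison determines \<open>s\<close>.\<close>

lemma fs_child_form:
  assumes "take 6 e = params" "w0 \<sqsubseteq> v" "s < length e" "b < length e" "y < length e" "M v (e ! s) T"
  shows "fs pr (child_form s b y) v e \<longleftrightarrow> child v (e ! s) (e ! b) (e ! y)"
proof -
  have sX: "M t q (e ! s) \<Longrightarrow> M t q X" if "v \<sqsubseteq> t" for t q
    using minimal_X T(2)[OF le_trans[OF assms(2) that]] M_mono[OF assms(6) that] by blast
  note nth = take_params[OF assms(1)]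
  have "fs pr (child_form s b y) v e \<longleftrightarrow> (\<forall>t. v \<sqsubseteq> t \<longrightarrow> (\<forall>q. M t q X \<longrightarrow>
      (\<forall>u. t \<sqsubseteq> u \<longrightarrow> (M u q (e ! s) \<longleftrightarrow> pm u (e ! b) q (e ! y)))))"
    using assms(3-5) nth by (simp add: child_form_def nth_append)
  also have "\<dots> \<longleftrightarrow> child v (e ! s) (e ! b) (e ! y)"
  proof
    assume L: "\<forall>t. v \<sqsubseteq> t \<longrightarrow> (\<forall>q. M t q X \<longrightarrow>
      (\<forall>u. t \<sqsubseteq> u \<longrightarrow> (M u q (e ! s) \<longleftrightarrow> pm u (e ! b) q (e ! y))))"
    show "child v (e ! s) (e ! b) (e ! y)" unfolding child_def
    proof (intro allI impI)
      fix t q assume "v \<sqsubseteq> t"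
      then show "M t q (e ! s) \<longleftrightarrow> M t q X \<and> pm t (e ! b) q (e ! y)"
        using L sX le_refl[of t] by blast
    qed
  next
    assume R: "child v (e ! s) (e ! b) (e ! y)"
    have "M u q (e ! s) \<longleftrightarrow> pm u (e ! b) q (e ! y)" if "v \<sqsubseteq> t" "M t q X" "t \<sqsubseteq> u" for t q u
      using R le_trans[OF that(1,3)] M_mono[OF that(2,3)] unfolding child_def by blast
    then show "\<forall>t. v \<sqsubseteq> t \<longrightarrow> (\<forall>q. M t q X \<longrightarrow>
      (\<forall>u. t \<sqsubseteq> u \<longrightarrow> (M u q (e ! s) \<longleftrightarrow> pm u (e ! b) q (e ! y))))" by blast
  qed
  finally show ?thesis .
qed

definition subtree_form :: "nat \<Rightarrow> nat \<Rightarrow> form" where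
  "subtree_form y s = (s \<^bold>\<in> 4 \<^bold>\<and>
     bex 1 (\<lambda>b. bex 0 (\<lambda>a. b_pm b a 2 \<^bold>\<and> b_pm a 3 y \<^bold>\<and> child_form s b y)))"

lemma fs_subtree_form:
  assumes e: "take 6 e = params" and v: "w0 \<sqsubseteq> v" and "s < length e" "y < length e"
  shows "fs pr (subtree_form y s) v e \<longleftrightarrow> subtree v (e ! y) (e ! s)"
proof -
  note nth = take_params[OF e]
  have "fs pr (child_form s (length e) y) v (e @ [b, a]) \<longleftrightarrow> child v (e ! s) b (e ! y)"
    if "M v (e ! s) T" for b a
    using fs_child_form[of "e @ [b, a]" v s "length e" y pr] e v assms(3,4) that nth(1)
    by (simp add: nth_append)
  then have "fs pr (subtree_form y s) v e \<longleftrightarrow> M v (e ! s) T \<and> (\<exists>b. M v b B \<and> (\<exists>a. M v a A \<and>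
      pm v b a f \<and> pm v a z0 (e ! y) \<and> child v (e ! s) b (e ! y)))"
    using assms(3,4) nth by (simp add: subtree_form_def nth_append cong: conj_cong)
  then show ?thesis unfolding subtree_def using f_in[OF v] by blast
qed

definition good_form :: "nat \<Rightarrow> form" where
  "good_form y = ball 1 (\<lambda>b. ball 0 (\<lambda>a. b_pm b a 2 \<^bold>\<longrightarrow> b_pm a 3 y \<^bold>\<longrightarrow>
     bex 4 (\<lambda>s. child_form s b y)))"

lemma fs_good_form:
  assumes e: "take 6 e = params" and v: "w0 \<sqsubseteq> v" and y: "y < length e"
  shows "fs pr (good_form y) v e \<longleftrightarrow> good v (e ! y)"
proof -
  note nth = take_params[OF e]
  have child: "fs pr (child_form (Suc (Suc (length e))) (length e) y) t (e @ [b, a, s]) \<longleftrightarrow>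
      child t s b (e ! y)"
    if "v \<sqsubseteq> t" "M t s T" for t b a s
    using fs_child_form[of "e @ [b, a, s]" t "Suc (Suc (length e))" "length e" y pr]
      e le_trans[OF v that(1)] y that(2) nth(1) by (simp add: nth_append)
  have ex: "(\<exists>s. M t s T \<and> fs pr (child_form (Suc (Suc (length e))) (length e) y) t (e @ [b, a, s])) \<longleftrightarrow>
      (\<exists>s. M t s T \<and> child t s b (e ! y))" if "v \<sqsubseteq> t" for t b a
    using child[OF that] by blast
  have "fs pr (good_form y) v e \<longleftrightarrow> (\<forall>t. v \<sqsubseteq> t \<longrightarrow> (\<forall>b. M t b B \<longrightarrow>
      (\<forall>t1. t \<sqsubseteq> t1 \<longrightarrow> (\<forall>a. M t1 a A \<longrightarrow> (\<forall>t2. t1 \<sqsubseteq> t2 \<longrightarrow> pm t2 b a f \<longrightarrow>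
        (\<forall>t3. t2 \<sqsubseteq> t3 \<longrightarrow> pm t3 a z0 (e ! y) \<longrightarrow>
          (\<exists>s. M t3 s T \<and> fs pr (child_form (Suc (Suc (length e))) (length e) y) t3 (e @ [b, a, s]))))))))"
    using y nth by (simp add: good_form_def nth_append)
  also have "\<dots> \<longleftrightarrow> good v (e ! y)"
  proof
    assume L: "\<forall>t. v \<sqsubseteq> t \<longrightarrow> (\<forall>b. M t b B \<longrightarrow>
      (\<forall>t1. t \<sqsubseteq> t1 \<longrightarrow> (\<forall>a. M t1 a A \<longrightarrow> (\<forall>t2. t1 \<sqsubseteq> t2 \<longrightarrow> pm t2 b a f \<longrightarrow>
        (\<forall>t3. t2 \<sqsubseteq> t3 \<longrightarrow> pm t3 a z0 (e ! y) \<longrightarrow>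
          (\<exists>s. M t3 s T \<and> fs pr (child_form (Suc (Suc (length e))) (length e) y) t3 (e @ [b, a, s])))))))"
    show "good v (e ! y)" unfolding good_def
    proof (intro allI impI)
      fix t b a assume t: "v \<sqsubseteq> t" and ba: "pm t b a f" "pm t a z0 (e ! y)"
      have "M t b B" "M t a A" using f_in[OF le_trans[OF v t] ba(1)] by blast+
      then show "\<exists>s. M t s T \<and> child t s b (e ! y)" using L t ba le_refl[of t] ex[OF t] by blast
    qed
  next
    assume R: "good v (e ! y)"
    have "\<exists>s. M t3 s T \<and> fs pr (child_form (Suc (Suc (length e))) (length e) y) t3 (e @ [b, a, s])"
      if "v \<sqsubseteq> t" "t \<sqsubseteq> t1" "t1 \<sqsubseteq> t2" "pm t2 b a f" "t2 \<sqsubseteq> t3" "pm t3 a z0 (e ! y)" for t t1 t2 t3 a b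
    proof -
      have "v \<sqsubseteq> t3" using le_trans that(1,2,3,5) by blast
      then show ?thesis using R pm_mono[OF that(4,5)] that(6) ex unfolding good_def by blast
    qed
    then show "\<forall>t. v \<sqsubseteq> t \<longrightarrow> (\<forall>b. M t b B \<longrightarrow>
      (\<forall>t1. t \<sqsubseteq> t1 \<longrightarrow> (\<forall>a. M t1 a A \<longrightarrow> (\<forall>t2. t1 \<sqsubseteq> t2 \<longrightarrow> pm t2 b a f \<longrightarrow>
        (\<forall>t3. t2 \<sqsubseteq> t3 \<longrightarrow> pm t3 a z0 (e ! y) \<longrightarrow>
          (\<exists>s. M t3 s T \<and> fs pr (child_form (Suc (Suc (length e))) (length e) y) t3 (e @ [b, a, s])))))))"
      by blast
  qed
  finally show ?thesis .
qed

lemma bounded_tree_forms [simp]: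
  "5 < n \<Longrightarrow> s < n \<Longrightarrow> b < n \<Longrightarrow> y < n \<Longrightarrow> bounded (child_form s b y n)"
  "5 < n \<Longrightarrow> s < n \<Longrightarrow> y < n \<Longrightarrow> bounded (subtree_form y s n)"
  "5 < n \<Longrightarrow> y < n \<Longrightarrow> bounded (good_form y n)"
  by (simp_all add: child_form_def subtree_form_def good_form_def)

text \<open>The rule with all immediate subtrees of \<open>y\<close> as premise and {y} as
  conclusion.\<close>

definition is_rule where
  "is_rule v y C S \<longleftrightarrow> upair v S y y \<and> (\<forall>t. v \<sqsubseteq> t \<longrightarrow> (\<forall>s. D t s \<longrightarrow> (M t s C \<longleftrightarrow> subtree t y s)))"

text \<open>Restricting the conclusions to good trees is essential: a branch whose subtree is not in
  \<open>T\<close> contributes no premise, so without the restriction such a tree would be inferred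
  from too few subtrees.\<close>

lemma tree_rules:
  obtains Q where "D w0 Q"
    "\<And>v C S. w0 \<sqsubseteq> v \<Longrightarrow> pm v C S Q \<Longrightarrow> \<exists>y. M v y T \<and> good v y \<and> is_rule v y C S"
    "\<And>v y. w0 \<sqsubseteq> v \<Longrightarrow> M v y T \<Longrightarrow> good v y \<Longrightarrow> \<exists>C S. pm v C S Q \<and> is_rule v y C S"
    "\<And>v r. w0 \<sqsubseteq> v \<Longrightarrow> M v r Q \<Longrightarrow> \<exists>C S. op v r C S"
proof -
  have C: "\<exists>C. D v C \<and> (\<forall>t. v \<sqsubseteq> t \<longrightarrow> (\<forall>s. D t s \<longrightarrow> (M t s C \<longleftrightarrow> subtree t y s)))"
    if v: "w0 \<sqsubseteq> v" and y: "D v y" for v y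
  proof -
    obtain C where "D v C" "\<And>t s. v \<sqsubseteq> t \<Longrightarrow> M t s C \<longleftrightarrow> M t s T \<and> subtree t y s"
    proof (rule separation[where ps = "params @ [y]" and F = "subtree_form 6 7" and w = v and a = T])
      show "fs pr (subtree_form 6 7) t ((params @ [y]) @ [s]) \<longleftrightarrow> subtree t y s"
        if "v \<sqsubseteq> t" for pr t s
        using fs_subtree_form[of "(params @ [y]) @ [s]" t 7 6 pr] le_trans[OF v that] by simp
    qed (use params[OF v] y in auto)
    then show ?thesis unfolding subtree_def by blast
  qed
  obtain N where N: "D w0 N" "\<And>v y. w0 \<sqsubseteq> v \<Longrightarrow> M v y N \<longleftrightarrow> M v y T \<and> good v y"
  proof (rule separation[where ps = params and F = "good_form 6" and w = w0 and a = T])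
    show "fs pr (good_form 6) t (params @ [s]) \<longleftrightarrow> good t s" if "w0 \<sqsubseteq> t" for pr t s
      using fs_good_form[of "params @ [s]" t 6 pr] that by simp
  qed (use params[OF le_refl] in auto)
  let ?K = "\<lambda>v y r. \<exists>C. D v C \<and> (\<exists>S. D v S \<and> op v r C S \<and> D v y \<and> is_rule v y C S)"
  obtain Q where Q: "D w0 Q" "\<And>v r. w0 \<sqsubseteq> v \<Longrightarrow> D v r \<Longrightarrow> M v r Q \<longleftrightarrow> (\<exists>y. M v y N \<and> ?K v y r)"
  proof (rule image[where ps = params and w = w0 and a = N and K = ?K and
        F = "\<^bold>\<exists>C. \<^bold>\<exists>S. b_pair 6 C S \<^bold>\<and> b_upair S 7 7 \<^bold>\<and> (\<^bold>\<forall>s. s \<^bold>\<in> C \<^bold>\<longleftrightarrow> subtree_form 7 s)"])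
    fix pr v y r assume v: "w0 \<sqsubseteq> v"
    have "fs pr (subtree_form 7 (length (params @ [r, y, C, S]))) t (params @ [r, y, C, S, s]) \<longleftrightarrow>
        subtree t y s" if "v \<sqsubseteq> t" for t C S s
      using fs_subtree_form[of "params @ [r, y, C, S, s]" t "length (params @ [r, y, C, S])" 7 pr]
        le_trans[OF v that] by simp
    then show "fs pr (\<^bold>\<exists>C. \<^bold>\<exists>S. b_pair 6 C S \<^bold>\<and> b_upair S 7 7 \<^bold>\<and> (\<^bold>\<forall>s. s \<^bold>\<in> C \<^bold>\<longleftrightarrow> subtree_form 7 s)) v
        (params @ [r, y]) \<longleftrightarrow> ?K v y r"
      by (simp add: fs_b_upair is_rule_def)
  next
    fix v y assume v: "w0 \<sqsubseteq> v" and y: "M v y N"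
    have Dy: "D v y" using M_Ds(1)[OF y] .
    obtain C where C: "D v C" "\<forall>t. v \<sqsubseteq> t \<longrightarrow> (\<forall>s. D t s \<longrightarrow> (M t s C \<longleftrightarrow> subtree t y s))"
      using C[OF v Dy] by blast
    obtain S where S: "D v S" "upair v S y y" using upair_exists Dy by blast
    obtain r where "op v r C S" using op_exists C(1) S(1) by blast
    then show "\<exists>r. D v r \<and> ?K v y r" using C S Dy op_D(1) unfolding is_rule_def by blast
  next
    fix v y r r' assume v: "w0 \<sqsubseteq> v" and r: "?K v y r" "?K v y r'"
    then obtain C S C' S' where CS: "op v r C S" "is_rule v y C S" "op v r' C' S'" "is_rule v y C' S'"
      by blast
    have "E v S S'" using upair_unique CS op_D(3) unfolding is_rule_def by meson
    moreover have "E v C C'"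
    proof (rule extensionality)
      show "M t s C \<longleftrightarrow> M t s C'" if "v \<sqsubseteq> t" for t s
        using CS(2,4) that M_Ds(1)[of t s] unfolding is_rule_def by blast
    qed (use CS op_D(2) in blast)+
    ultimately have "op v r C' S'" using op_cong[OF CS(1)] op_self[OF CS(1)] by blast
    then show "E v r r'" using op_unique CS(3) by blast
  qed (use N(1) params[OF le_refl] in auto)
  show thesis
  proof (rule that[OF Q(1)])
    fix v C S assume v: "w0 \<sqsubseteq> v" and "pm v C S Q"
    then obtain r where r: "M v r Q" "op v r C S" unfolding pm_def by blast
    then obtain y C' S' where y: "M v y N" "op v r C' S'" "is_rule v y C' S'"
      using Q(2)[OF v M_Ds(1)[OF r(1)]] by blast
    have eq: "E v C' C" "E v S' S" using op_inj[OF y(2) r(2)] by blast+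
    have "upair v S y y"
      using upair_cong[OF eq(2)] y(3) E_refl[OF M_Ds(1)[OF y(1)]] unfolding is_rule_def by blast
    then have "is_rule v y C S" using y(3) E_iff(1)[OF eq(1)] unfolding is_rule_def by blast
    then show "\<exists>y. M v y T \<and> good v y \<and> is_rule v y C S" using N(2)[OF v] y(1) by blast
  next
    fix v y assume v: "w0 \<sqsubseteq> v" and y: "M v y T" "good v y"
    then have yN: "M v y N" using N(2) by blast
    have Dy: "D v y" using M_Ds(1)[OF y(1)] .
    obtain C where C: "D v C" "\<forall>t. v \<sqsubseteq> t \<longrightarrow> (\<forall>s. D t s \<longrightarrow> (M t s C \<longleftrightarrow> subtree t y s))"
      using C[OF v Dy] by blast
    obtain S where S: "D v S" "upair v S y y" using upair_exists Dy by blast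
    obtain r where r: "op v r C S" using op_exists C(1) S(1) by blast
    have rule: "is_rule v y C S" using C(2) S(2) unfolding is_rule_def by blast
    then have "M v r Q" using Q(2)[OF v op_D(1)[OF r]] yN r C(1) S(1) Dy by blast
    then show "\<exists>C S. pm v C S Q \<and> is_rule v y C S" using rule pmI r by blast
  qed (use Q(2) M_Ds(1) in blast)
qed

section \<open>The set W, its constructor and its induction principle\<close>

definition progressive where
  "progressive v Z \<longleftrightarrow> (\<forall>t y. v \<sqsubseteq> t \<longrightarrow> M t y T \<longrightarrow> good t y \<longrightarrow>
     (\<forall>u s. t \<sqsubseteq> u \<longrightarrow> subtree u y s \<longrightarrow> M u s Z) \<longrightarrow> M t y Z)"

text \<open>Closure under the tree rules amounts to being progressive, and each rule has a single
  conclusion, so \<open>least_closed\<close> applies inside \<open>T\<close>.\<close>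

lemma W_exists:
  "\<exists>W. D w0 W \<and> sub w0 W T \<and> progressive w0 W \<and>
    (\<forall>v Z. w0 \<sqsubseteq> v \<longrightarrow> D v Z \<longrightarrow> sub v Z T \<longrightarrow> progressive v Z \<longrightarrow> sub v W Z)"
proof -
  obtain Q where Q: "D w0 Q"
    "\<And>v C S. w0 \<sqsubseteq> v \<Longrightarrow> pm v C S Q \<Longrightarrow> \<exists>y. M v y T \<and> good v y \<and> is_rule v y C S"
    "\<And>v y. w0 \<sqsubseteq> v \<Longrightarrow> M v y T \<Longrightarrow> good v y \<Longrightarrow> \<exists>C S. pm v C S Q \<and> is_rule v y C S"
    "\<And>v r. w0 \<sqsubseteq> v \<Longrightarrow> M v r Q \<Longrightarrow> \<exists>C S. op v r C S"
    using tree_rules by blast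
  have subT: "sub v C T" if "is_rule v y C S" for v y C S
    unfolding sub_def using that M_Ds(1) unfolding is_rule_def subtree_def by blast
  have closed: "closed v Q Z \<longleftrightarrow> progressive v Z" if v: "w0 \<sqsubseteq> v" for v Z
  proof
    assume Z: "closed v Q Z"
    show "progressive v Z" unfolding progressive_def
    proof (intro allI impI)
      fix t y assume t: "v \<sqsubseteq> t" and y: "M t y T" "good t y"
        and Zs: "\<forall>u s. t \<sqsubseteq> u \<longrightarrow> subtree u y s \<longrightarrow> M u s Z"
      obtain C S where CS: "pm t C S Q" "is_rule t y C S" using Q(3)[OF le_trans[OF v t] y] by blast
      have "sub t C Z" unfolding sub_def using CS(2) Zs M_Ds(1) unfolding is_rule_def by blast
      then obtain z where z: "M t z S" "M t z Z" using closedD[OF closed_mono[OF Z t] CS(1)] by blast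
      have "E t z y" using CS(2) z(1) upairD unfolding is_rule_def by blast
      then show "M t y Z" using z(2) E_iff(2)[OF _ le_refl] by blast
    qed
  next
    assume Z: "progressive v Z"
    show "closed v Q Z" unfolding closed_def
    proof (intro allI impI)
      fix t C S assume t: "v \<sqsubseteq> t" and CS: "pm t C S Q" "sub t C Z"
      obtain y where y: "M t y T" "good t y" "is_rule t y C S"
        using Q(2)[OF le_trans[OF v t] CS(1)] by blast
      have "M u s Z" if "t \<sqsubseteq> u" "subtree u y s" for u s
      proof -
        have "D u s" using that(2) M_Ds(1) unfolding subtree_def by blast
        then have "M u s C" using y(3) that unfolding is_rule_def by blast
        then show ?thesis using CS(2) that(1) unfolding sub_def by blast
      qed
      then have "M t y Z" using Z t y(1,2) unfolding progressive_def by blast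
      moreover have "M t y S"
        using y(3) upairD E_refl[OF M_Ds(1)[OF y(1)]] unfolding is_rule_def by blast
      ultimately show "\<exists>z. M t z S \<and> M t z Z" by blast
    qed
  qed
  have rules: "rule_set w0 Q T" unfolding rule_set_def
  proof (intro allI impI)
    fix v r assume v: "w0 \<sqsubseteq> v" and r: "M v r Q"
    obtain C S where CS: "op v r C S" using Q(4)[OF v r] by blast
    obtain y where y: "M v y T" "is_rule v y C S" using Q(2)[OF v pmI[OF r CS]] by blast
    have "M t z T" if "v \<sqsubseteq> t" "M t z S" for t z
    proof -
      have "E t z y" using y(2) that upairD[OF upair_mono[OF _ that(1)]] unfolding is_rule_def by blast
      then show ?thesis using M_mono[OF y(1) that(1)] E_iff(2)[OF _ le_refl] by blast
    qed
    then show "\<exists>a b. op v r a b \<and> sub v a T \<and> sub v b T"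
      using CS subT[OF y(2)] unfolding sub_def by blast
  qed
  have single: "\<exists>x. D v x \<and> upair v b x x" if "w0 \<sqsubseteq> v" "pm v a b Q" for v a b
    using Q(2)[OF that] M_Ds(1) unfolding is_rule_def by blast
  obtain W where W: "D w0 W" "sub w0 W T" "closed w0 Q W"
    "\<And>v Y. w0 \<sqsubseteq> v \<Longrightarrow> D v Y \<Longrightarrow> sub v Y T \<Longrightarrow> closed v Q Y \<Longrightarrow> sub v W Y"
    by (rule least_closed[OF T(1) Q(1) rules], erule (1) single, blast)
  then show ?thesis using closed le_refl by blast
qed

definition W where
  "W = (SOME W. D w0 W \<and> sub w0 W T \<and> progressive w0 W \<and>
    (\<forall>v Z. w0 \<sqsubseteq> v \<longrightarrow> D v Z \<longrightarrow> sub v Z T \<longrightarrow> progressive v Z \<longrightarrow> sub v W Z))"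

lemma W:
  "D w0 W" "sub w0 W T" "progressive w0 W"
  "w0 \<sqsubseteq> v \<Longrightarrow> D v Z \<Longrightarrow> sub v Z T \<Longrightarrow> progressive v Z \<Longrightarrow> sub v W Z"
  using someI_ex[OF W_exists] unfolding W_def[symmetric] by blast+

lemma W_T: "w0 \<sqsubseteq> v \<Longrightarrow> sub v W T"
  using W(2) sub_mono by blast

lemma fam_T: "w0 \<sqsubseteq> v \<Longrightarrow> fam v a s W \<Longrightarrow> fam v a s T"
  using W_T fam_sub by blast

lemma trees_W: "w0 \<sqsubseteq> v \<Longrightarrow> trees v W"
  using trees_T W_T unfolding trees_def sub_def by blast

text \<open>The subtrees of \<open>y\<close> are exactly the values of \<open>s\<close>, because a
  subtree at a given edge is unique. These values lie in \<open>W\<close>, so \<open>y\<close> is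
  good and progressiveness puts it into \<open>W\<close>.\<close>

lemma W_sup:
  assumes v: "w0 \<sqsubseteq> v" and a: "M v a A" and s: "fam v a s W" and y: "sup v y a s"
  shows "M v y W"
proof -
  note Wt = trees_W[OF v]
  have yT: "M v y T" using sup_minimal[OF v a s Wt y] T(2)[OF v] by blast
  have val: "\<exists>z. pm t b z s \<and> child t z b y \<and> M t z W"
    if t: "v \<sqsubseteq> t" and b: "pm t b a' f" "pm t a' z0 y" for t b a'
  proof -
    have wt: "w0 \<sqsubseteq> t" using le_trans v t by blast
    note st = fam_mono[OF s t] and Wtt = trees_mono[OF Wt t] and yt = sup_mono[OF y t]
    have "E t a' a" using sup_root[OF wt st Wtt yt b(2)] .
    then have "pm t b a f" using pm_cong[OF b(1)] E_refl pm_D[OF b(1)] by blast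
    then obtain z where z: "pm t b z s" using fam_ex[OF st] by blast
    then show ?thesis using sup_child[OF wt st Wtt yt z] fam_in(2)[OF st z] by blast
  qed
  have "good v y" unfolding good_def
  proof (intro allI impI)
    fix t b a' assume t: "v \<sqsubseteq> t" and b: "pm t b a' f" "pm t a' z0 y"
    show "\<exists>s. M t s T \<and> child t s b y"
      using val[OF t b] subD[OF W_T[OF le_trans[OF v t]]] by blast
  qed
  moreover have "M t z W" if t: "v \<sqsubseteq> t" and z: "subtree t y z" for t z
  proof -
    obtain b a' where b: "pm t b a' f" "pm t a' z0 y" "child t z b y" "M t z T"
      using z unfolding subtree_def by blast
    obtain z' where z': "child t z' b y" "M t z' W" using val[OF t b(1,2)] by blast
    have "E t z' z" using child_unique[OF z'(1) b(3)] M_Ds(1) z'(2) b(4) by blast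
    then show ?thesis using z'(2) E_iff(2)[OF _ le_refl] by blast
  qed
  ultimately show ?thesis using W(3) v yT unfolding progressive_def by blast
qed

text \<open>Inversion of the rules by leastness: the elements of \<open>W\<close> with the desired
  property form a progressive set, since the premises of an application lie in \<open>W\<close>
  themselves.\<close>

lemma W_subtrees:
  assumes v: "w0 \<sqsubseteq> v" and y: "M v y W"
  shows "good v y" "v \<sqsubseteq> t \<Longrightarrow> subtree t y s \<Longrightarrow> M t s W"
proof -
  let ?K = "\<lambda>v y. good v y \<and> (\<forall>t. v \<sqsubseteq> t \<longrightarrow> (\<forall>s. M t s T \<longrightarrow>
    (\<forall>u. t \<sqsubseteq> u \<longrightarrow> subtree u y s \<longrightarrow> M u s W)))"
  obtain Z where Z: "D w0 Z" "\<And>v y. w0 \<sqsubseteq> v \<Longrightarrow> M v y Z \<longleftrightarrow> M v y W \<and> ?K v y"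
  proof (rule separation[where ps = "params @ [W]" and w = w0 and a = W and K = ?K and
        F = "good_form 7 \<^bold>\<and> ball 4 (\<lambda>s. subtree_form 7 s \<^bold>\<longrightarrow> s \<^bold>\<in> 6)"])
    fix pr v y assume v: "w0 \<sqsubseteq> v"
    have 1: "fs pr (good_form 7) v (params @ [W, y]) \<longleftrightarrow> good v y"
      using fs_good_form[of "params @ [W, y]" v 7 pr] v by simp
    have "fs pr (subtree_form 7 (length (params @ [W, y]))) t (params @ [W, y, s]) \<longleftrightarrow> subtree t y s"
      if "v \<sqsubseteq> t" for t s
      using fs_subtree_form[of "params @ [W, y, s]" t "length (params @ [W, y])" 7 pr]
        le_trans[OF v that] by simp
    then have 2: "fs pr (subtree_form 7 (length (params @ [W, y]))) u (params @ [W, y, s]) \<longleftrightarrow> subtree u y s"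
      if "v \<sqsubseteq> t" "t \<sqsubseteq> u" for t u s
      using le_trans[OF that] by blast
    show "fs pr (good_form 7 \<^bold>\<and> ball 4 (\<lambda>s. subtree_form 7 s \<^bold>\<longrightarrow> s \<^bold>\<in> 6)) v
        ((params @ [W]) @ [y]) \<longleftrightarrow> ?K v y"
      using 1 2 by simp
  qed (use params[OF le_refl] W(1) in auto)
  have "sub w0 Z T" unfolding sub_def using Z(2) W(2) unfolding sub_def by blast
  moreover have "progressive w0 Z" unfolding progressive_def
  proof (intro allI impI)
    fix t y assume t: "w0 \<sqsubseteq> t" and y: "M t y T" "good t y"
      and s: "\<forall>u s. t \<sqsubseteq> u \<longrightarrow> subtree u y s \<longrightarrow> M u s Z"
    have sW: "M u s W" if "t \<sqsubseteq> u" "subtree u y s" for u s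
      using s that Z(2)[OF le_trans[OF t that(1)]] by blast
    then have "M t y W" using W(3) t y unfolding progressive_def by blast
    moreover have "M u2 s W" if "t \<sqsubseteq> u" "u \<sqsubseteq> u2" "subtree u2 y s" for u u2 s
      using sW[OF le_trans[OF that(1,2)] that(3)] .
    ultimately show "M t y Z" using Z(2)[OF t] y(2) by blast
  qed
  ultimately have "sub w0 W Z" using W(4)[OF le_refl Z(1)] by blast
  then have K: "?K v y" using Z(2)[OF v] v y unfolding sub_def by blast
  then show "good v y" by blast
  show "M t s W" if "v \<sqsubseteq> t" "subtree t y s"
    using K that le_refl[of t] unfolding subtree_def by blast
qed

text \<open>Take a root label \<open>a\<close> of \<open>y\<close> and let \<open>s\<close> send
  each edge over \<open>a\<close> to the subtree there. The tree built from \<open>a\<close> and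
  \<open>s\<close> is a closed subset of \<open>y\<close>, and \<open>y\<close> is minimal.\<close>

lemma W_inv:
  assumes v: "w0 \<sqsubseteq> v" and y: "M v y W"
  obtains a s where "M v a A" "fam v a s W" "sup v y a s"
proof -
  have min: "minimal v y" using subD[OF W_T[OF v] y] T(2)[OF v] by blast
  then obtain a where a: "M v a A" "pm v a z0 y"
    using closed_root[OF v] unfolding minimal_def by blast
  have Dv: "D v y" "D v a" "D v W" "D v f" "D v B"
    using M_Ds[OF y] M_Ds(1)[OF a(1)] Ds[OF v] by blast+
  obtain Ba where Ba: "D v Ba" "\<And>t b. v \<sqsubseteq> t \<Longrightarrow> M t b Ba \<longleftrightarrow> M t b B \<and> pm t b a f"
    by (rule separation[where ps = "[a, f]" and w = v and a = B and F = "b_pm 2 0 1"])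
      (use Dv in auto)
  let ?K = "\<lambda>t b p. \<exists>z. M t z W \<and> child t z b y \<and> op t p b z"
  \<comment> \<open>Replacement over the fibre suffices to form \<open>s\<close>: the subtree at an
    edge exists because \<open>y\<close> is good, and it is unique.\<close>
  obtain s where s: "D v s" "\<And>t p. v \<sqsubseteq> t \<Longrightarrow> D t p \<Longrightarrow> M t p s \<longleftrightarrow> (\<exists>b. M t b Ba \<and> ?K t b p)"
  proof (rule image[where ps = "params @ [W, y]" and w = v and a = Ba and K = ?K and
        F = "bex 6 (\<lambda>z. child_form z 9 7 \<^bold>\<and> b_pair 8 9 z)"])
    fix pr t b p assume t: "v \<sqsubseteq> t"
    have wt: "w0 \<sqsubseteq> t" using le_trans v t by blast
    have "fs pr (child_form (length (params @ [W, y, p, b])) 9 7) t (params @ [W, y, p, b, z]) \<longleftrightarrow>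
        child t z b y" if "M t z W" for z
      using fs_child_form[of "params @ [W, y, p, b, z]" t "length (params @ [W, y, p, b])" 9 7 pr] wt
        subD[OF W_T[OF wt] that] by simp
    then show "fs pr (bex 6 (\<lambda>z. child_form z 9 7 \<^bold>\<and> b_pair 8 9 z)) t ((params @ [W, y]) @ [p, b]) \<longleftrightarrow> ?K t b p"
      by (simp cong: conj_cong)
  next
    fix t b assume t: "v \<sqsubseteq> t" and b: "M t b Ba"
    have wt: "w0 \<sqsubseteq> t" using le_trans v t by blast
    have bf: "pm t b a f" using Ba(2)[OF t] b by blast
    have ay: "pm t a z0 y" using pm_mono[OF a(2) t] .
    obtain z where z: "M t z T" "child t z b y"
      using W_subtrees(1)[OF v y] t bf ay unfolding good_def by blast
    then have "M t z W" using W_subtrees(2)[OF v y t] bf ay unfolding subtree_def by blast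
    moreover obtain p where "op t p b z" using op_exists pm_D(1)[OF bf] M_Ds(1)[OF z(1)] by blast
    ultimately show "\<exists>p. D t p \<and> ?K t b p" using z op_D(1) by blast
  next
    fix t b p p' assume t: "v \<sqsubseteq> t" and p: "?K t b p" "?K t b p'"
    then obtain z z' where z: "M t z W" "child t z b y" "op t p b z" "M t z' W" "child t z' b y" "op t p' b z'"
      by blast
    have "E t z z'" using child_unique[OF z(2,5)] M_Ds(1) z(1,4) by blast
    then have "op t p b z'" using op_cong[OF z(3)] op_self[OF z(3)] by blast
    then show "E t p p'" using op_unique z(6) by blast
  qed (use Ba(1) params[OF v] Dv in auto)
  have sval: "child t z b y \<and> pm t b a f \<and> M t z W" if t: "v \<sqsubseteq> t" and z: "pm t b z s" for t b z
  proof -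
    obtain p where p: "M t p s" "op t p b z" using z unfolding pm_def by blast
    then obtain b' z' where b': "M t b' Ba" "M t z' W" "child t z' b' y" "op t p b' z'"
      using s(2)[OF t M_Ds(1)[OF p(1)]] by blast
    have eq: "E t b' b" "E t z' z" using op_inj[OF b'(4) p(2)] by blast+
    have "child t z b y" using child_cong[OF b'(3) eq(2,1)] E_refl D_mono[OF Dv(1) t] by blast
    moreover have "pm t b' a f" using Ba(2)[OF t] b'(1) by blast
    then have "pm t b a f" using pm_cong[OF _ eq(1)] E_refl pm_D by blast
    ultimately show ?thesis using b'(2) E_iff(2)[OF eq(2) le_refl] by blast
  qed
  have fam: "fam v a s W" unfolding fam_def
  proof (intro conjI allI impI)
    show "D v s" by (rule s(1))
    show "\<exists>b z. pm t b a f \<and> M t z W \<and> op t p b z" if t: "v \<sqsubseteq> t" and p: "M t p s" for t p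
      using s(2)[OF t M_Ds(1)[OF p]] p Ba(2)[OF t] by blast
    show "\<exists>z. pm t b z s" if t: "v \<sqsubseteq> t" and b: "pm t b a f" for t b
    proof -
      have wt: "w0 \<sqsubseteq> t" using le_trans v t by blast
      have ay: "pm t a z0 y" using pm_mono[OF a(2) t] .
      obtain z where z: "M t z T" "child t z b y"
        using W_subtrees(1)[OF v y] t b ay unfolding good_def by blast
      have zW: "M t z W" using z W_subtrees(2)[OF v y t] b ay unfolding subtree_def by blast
      obtain p where p: "op t p b z" using op_exists pm_D(1)[OF b] M_Ds(1)[OF z(1)] by blast
      have "M t b Ba" using Ba(2)[OF t] b f_in[OF wt b] by blast
      then have "M t p s" using s(2)[OF t op_D(1)[OF p]] zW z(2) p by blast
      then show ?thesis using p pmI by blast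
    qed
    show "E t z z'" if t: "v \<sqsubseteq> t" and z: "pm t b z s" "pm t b z' s" for t b z z'
      using child_unique sval[OF t z(1)] sval[OF t z(2)] pm_D(2) z by blast
  qed
  obtain y' where y': "sup v y' a s" using sup_exists[OF v a(1) fam_T[OF v fam]] by blast
  \<comment> \<open>This inclusion is immediate from the choice of \<open>s\<close>; the converse
    needs no path chasing, as \<open>y'\<close> is closed and \<open>y\<close> minimal.\<close>
  have "sub v y' y" unfolding sub_def
  proof (intro allI impI)
    fix t p assume t: "v \<sqsubseteq> t" and p: "M t p y'"
    then consider "op t p a z0" | b z q where "pm t b z s" "M t q z" "op t p b q"
      using y' unfolding sup_def by blast
    then show "M t p y"
    proof cases
      case 1
      then show ?thesis using pm_op pm_mono[OF a(2) t] by blast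
    next
      case 2
      then have "pm t b q y" using sval[OF t] le_refl[of t] unfolding child_def by blast
      then show ?thesis using pm_op[OF 2(3)] by blast
    qed
  qed
  moreover have min': "minimal v y'" using sup_minimal[OF v a(1) fam trees_W[OF v] y'] .
  ultimately have "sub v y y'" using min le_refl[of v] unfolding minimal_def by blast
  then have "E v y' y" using sub_antisym[OF \<open>sub v y' y\<close>] min min' unfolding minimal_def by blast
  then show thesis using that a(1) fam sup_cong[OF y'] by blast
qed

text \<open>Induction is for sets \<open>Z\<close> rather than predicates, so each use must first
  separate \<open>Z\<close> by a bounded formula. Good trees with subtrees in \<open>Z\<close> are
  converted to the form \<open>sup\<close> by \<open>W_inv\<close>.\<close>

lemma W_induct:
  assumes v: "w0 \<sqsubseteq> v" and Z: "D v Z" "sub v Z W"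
    and step: "\<And>t y a s. v \<sqsubseteq> t \<Longrightarrow> M t a A \<Longrightarrow> fam t a s Z \<Longrightarrow> sup t y a s \<Longrightarrow> M t y Z"
  shows "sub v W Z"
proof (rule W(4)[OF v Z(1)])
  show "sub v Z T" using sub_trans[OF Z(2) W_T[OF v]] .
  show "progressive v Z" unfolding progressive_def
  proof (intro allI impI)
    fix t y assume t: "v \<sqsubseteq> t" and y: "M t y T" "good t y"
      and sub: "\<forall>u s. t \<sqsubseteq> u \<longrightarrow> subtree u y s \<longrightarrow> M u s Z"
    have wt: "w0 \<sqsubseteq> t" using le_trans v t by blast
    have "M u s W" if "t \<sqsubseteq> u" "subtree u y s" for u s
      using sub that Z(2) le_trans[OF t that(1)] unfolding sub_def by blast
    then have "M t y W" using W(3) wt y unfolding progressive_def by blast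
    then obtain a s where a: "M t a A" "fam t a s W" "sup t y a s" by (rule W_inv[OF wt])
    have Zval: "M u z Z" if u: "t \<sqsubseteq> u" and z: "pm u b z s" for u b z
    proof -
      have wu: "w0 \<sqsubseteq> u" using le_trans wt u by blast
      note su = fam_mono[OF a(2) u] and yu = sup_mono[OF a(3) u]
      have "child u z b y" using sup_child[OF wu su trees_W[OF wu] yu z] .
      moreover have "pm u a z0 y" using sup_rootI[OF wu M_mono[OF a(1) u] yu] .
      moreover have "M u z T" using fam_in(2)[OF su z] subD[OF W_T[OF wu]] by blast
      ultimately have "subtree u y z" using fam_in(1)[OF su z] unfolding subtree_def by blast
      then show ?thesis using sub u by blast
    qed
    have "fam t a s Z" unfolding fam_def
    proof (intro conjI allI impI)
      fix u p assume u: "t \<sqsubseteq> u" and p: "M u p s"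
      then obtain b z where b: "pm u b a f" "op u p b z" using a(2) unfolding fam_def by blast
      then have "pm u b z s" using p pmI by blast
      then show "\<exists>b z. pm u b a f \<and> M u z Z \<and> op u p b z" using Zval[OF u] b by blast
    qed (use a(2) in \<open>unfold fam_def, blast+\<close>)
    then show "M t y Z" using step t a by blast
  qed
qed

lemma fam_cong: "fam v a s Z \<Longrightarrow> E v a a' \<Longrightarrow> fam v a' s Z"
proof -
  assume *: "fam v a s Z" "E v a a'"
  have "pm t b a f \<longleftrightarrow> pm t b a' f" if t: "v \<sqsubseteq> t" for t b
    using pm_cong[of t b a f b a' f] pm_cong[of t b a' f b a f] E_mono[OF *(2) t] E_sym E_refl pm_D
    by blast
  then show ?thesis using *(1) unfolding fam_def by simp
qed

text \<open>Both arguments can be read off the tree: \<open>a\<close> as its root label, and the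
  value of \<open>s\<close> at \<open>b\<close> as its subtree there.\<close>

lemma sup_inj:
  assumes v: "w0 \<sqsubseteq> v" and a: "M v a A" "fam v a s W" "sup v y a s"
    and a': "M v a' A" "fam v a' s' W" "sup v y a' s'"
  shows "E v a a'" "E v s s'"
proof -
  note Wt = trees_W[OF v]
  show eq: "E v a a'" using sup_root[OF v a'(2) Wt a'(3) sup_rootI[OF v a(1,3)]] .
  have "sub v s s'" if a: "fam v a s W" "sup v y a s" and a': "fam v a' s' W" "sup v y a' s'"
    and eq: "E v a a'" for a s a' s'
    unfolding sub_def
  proof (intro allI impI)
    fix t p assume t: "v \<sqsubseteq> t" and p: "M t p s"
    have wt: "w0 \<sqsubseteq> t" using le_trans v t by blast
    note Wtt = trees_W[OF wt]
    obtain b z where b: "pm t b a f" "op t p b z" using a(1) t p unfolding fam_def by blast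
    have z: "pm t b z s" using p b(2) pmI by blast
    have "pm t b a' f" using pm_cong[OF b(1) _ E_mono[OF eq t]] E_refl pm_D[OF b(1)] by blast
    then obtain z' where z': "pm t b z' s'" using fam_ex[OF fam_mono[OF a'(1) t]] by blast
    have "E t z z'"
      using child_unique[OF sup_child[OF wt fam_mono[OF a(1) t] Wtt sup_mono[OF a(2) t] z]
          sup_child[OF wt fam_mono[OF a'(1) t] Wtt sup_mono[OF a'(2) t] z']] pm_D z z' by blast
    then have "op t p b z'" using op_cong[OF b(2)] op_self[OF b(2)] by blast
    then show "M t p s'" using z' pm_op by blast
  qed
  from this[OF a(2,3) a'(2,3) eq] this[OF a'(2,3) a(2,3) E_sym[OF eq]]
  show "E v s s'" using sub_antisym a(2) a'(2) unfolding fam_def by blast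
qed

lemma sup_congs:
  assumes "sup v y a s" "E v a a'" "E v s s'"
  shows "sup v y a' s'"
  unfolding sup_def
proof (intro conjI allI impI)
  show "D v y" using assms(1) unfolding sup_def by blast
  fix t p assume t: "v \<sqsubseteq> t"
  have e: "E t a a'" "E t a' a" "E t s s'" "E t s' s" using assms(2,3) E_mono[OF _ t] E_sym by blast+
  have "op t p a z0 \<longleftrightarrow> op t p a' z0"
    using op_cong[of t p a z0 p a' z0] op_cong[of t p a' z0 p a z0] e op_self by blast
  moreover have "pm t b z s \<longleftrightarrow> pm t b z s'" for b z
    using pm_cong[of t b z s b z s'] pm_cong[of t b z s' b z s] e E_refl pm_D by blast
  ultimately show "M t p y \<longleftrightarrow> op t p a' z0 \<or> (\<exists>b z q. pm t b z s' \<and> M t q z \<and> op t p b q)"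
    using assms(1) t unfolding sup_def by blast
qed

end

section \<open>Functions, composites and the functor\<close>

context czf
begin

definition fn where
  "fn v g X Y \<longleftrightarrow>
     (\<forall>t. v \<sqsubseteq> t \<longrightarrow> (\<forall>p. M t p g \<longrightarrow> (\<exists>x. M t x X \<and> (\<exists>y. M t y Y \<and> op t p x y)))) \<and>
     (\<forall>t. v \<sqsubseteq> t \<longrightarrow> (\<forall>x. M t x X \<longrightarrow> (\<exists>y. D t y \<and> pm t x y g \<and>
       (\<forall>u. t \<sqsubseteq> u \<longrightarrow> (\<forall>y'. D u y' \<longrightarrow> pm u x y' g \<longrightarrow> E u y' y)))))"

definition comp where
  "comp v h g k \<longleftrightarrow> (\<forall>t. v \<sqsubseteq> t \<longrightarrow> (\<forall>p. D t p \<longrightarrow> (M t p h \<longleftrightarrow>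
     (\<exists>x. D t x \<and> (\<exists>y. D t y \<and> (\<exists>z. D t z \<and> op t p x z \<and> pm t x y k \<and> pm t y z g))))))"

lemma fs_pair_mem:
  "x < length e \<Longrightarrow> y < length e \<Longrightarrow> r < length e \<Longrightarrow> D v (e ! x) \<Longrightarrow> D v (e ! y) \<Longrightarrow>
    fs pr (pair_mem x y r) v e \<longleftrightarrow> pm v (e ! x) (e ! y) (e ! r)"
  using M_Ds(1) by (auto simp: pair_mem_def pm_def nth_append fs_is_pair)

lemma fs_is_function:
  assumes "g < length e" "x < length e" "y < length e"
  shows "fs pr (is_function g x y) v e \<longleftrightarrow> fn v (e ! g) (e ! x) (e ! y)"
proof -
  have 1: "fs pr (is_pair (length e) (Suc (length e)) (Suc (Suc (length e)))) t (e @ [p, i, j]) \<longleftrightarrow>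
      op t p i j" if "M t p (e ! g)" "M t i (e ! x)" "M t j (e ! y)" for t p i j
    using fs_is_pair[of "length e" "e @ [p, i, j]" "Suc (length e)" "Suc (Suc (length e))" t pr]
      M_Ds(1) that by (simp add: nth_append)
  have 2: "fs pr (pair_mem (length e) (Suc (length e)) g) t (e @ [i, j]) \<longleftrightarrow> pm t i j (e ! g)"
    if "D t i" "D t j" for t i j
    using fs_pair_mem[of "length e" "e @ [i, j]" "Suc (length e)" g t pr] that assms(1)
    by (simp add: nth_append)
  have 3: "fs pr (pair_mem (length e) (Suc (Suc (length e))) g) t (e @ [i, k, j]) \<longleftrightarrow>
      pm t i j (e ! g)" if "D t i" "D t j" for t i j k
    using fs_pair_mem[of "length e" "e @ [i, k, j]" "Suc (Suc (length e))" g t pr] that assms(1)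
    by (simp add: nth_append)
  have 4: "(\<exists>j. D t j \<and> fs pr (pair_mem (length e) (Suc (length e)) g) t (e @ [i, j]) \<and>
      (\<forall>u. t \<sqsubseteq> u \<longrightarrow> (\<forall>k. D u k \<longrightarrow>
        fs pr (pair_mem (length e) (Suc (Suc (length e))) g) u (e @ [i, j, k]) \<longrightarrow> E u k j))) \<longleftrightarrow>
      (\<exists>j. D t j \<and> pm t i j (e ! g) \<and>
      (\<forall>u. t \<sqsubseteq> u \<longrightarrow> (\<forall>k. D u k \<longrightarrow> pm u i k (e ! g) \<longrightarrow> E u k j)))" if "M t i (e ! x)" for t i
  proof -
    have "D u i" if "t \<sqsubseteq> u" for u using M_Ds(1)[OF M_mono[OF \<open>M t i (e ! x)\<close> that]] .
    then show ?thesis using 2[OF M_Ds(1)[OF that]] 3 by (simp cong: conj_cong)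
  qed
  show ?thesis
    using assms 1 4
    by (simp add: is_function_def ex1_def fn_def nth_append cong: conj_cong)
qed

lemma fs_is_composite:
  assumes "h < length e" "g < length e" "k < length e"
  shows "fs pr (is_composite h g k) v e \<longleftrightarrow> comp v (e ! h) (e ! g) (e ! k)"
  using assms by (simp add: is_composite_def comp_def fs_pair_mem fs_is_pair nth_append cong: conj_cong)

lemma comp_mono: "comp u h g k \<Longrightarrow> u \<sqsubseteq> v \<Longrightarrow> comp v h g k"
  unfolding comp_def using le_trans by blast

lemma comp_iff: "comp v h g k \<Longrightarrow> D v p \<Longrightarrow>
    M v p h \<longleftrightarrow> (\<exists>x y z. op v p x z \<and> pm v x y k \<and> pm v y z g)"
  unfolding comp_def using le_refl op_D(2,3) pm_D(2) by meson

lemma comp_pm: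
  assumes "comp v h g k"
  shows "pm v x z h \<longleftrightarrow> (\<exists>y. pm v x y k \<and> pm v y z g)"
proof
  assume "pm v x z h"
  then obtain p where p: "M v p h" "op v p x z" unfolding pm_def by blast
  then obtain x' y z' where x': "op v p x' z'" "pm v x' y k" "pm v y z' g"
    using comp_iff[OF assms op_D(1)[OF p(2)]] by blast
  have eq: "E v x' x" "E v z' z" using op_inj[OF x'(1) p(2)] by blast+
  have "pm v x y k" using pm_cong[OF x'(2) eq(1)] E_refl pm_D[OF x'(2)] by blast
  moreover have "pm v y z g" using pm_cong[OF x'(3) _ eq(2)] E_refl pm_D[OF x'(3)] by blast
  ultimately show "\<exists>y. pm v x y k \<and> pm v y z g" by blast
next
  assume "\<exists>y. pm v x y k \<and> pm v y z g"
  then obtain y where y: "pm v x y k" "pm v y z g" by blast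
  obtain p where p: "op v p x z" using op_exists pm_D(1)[OF y(1)] pm_D(2)[OF y(2)] by blast
  then have "M v p h" using comp_iff[OF assms op_D(1)[OF p]] y by blast
  then show "pm v x z h" using p pmI by blast
qed

lemma comp_exists:
  assumes "D v g" "D v k"
    and ex: "\<And>t p. v \<sqsubseteq> t \<Longrightarrow> M t p k \<Longrightarrow> \<exists>x y z. op t p x y \<and> pm t y z g"
    and unique: "\<And>t x y z z'. v \<sqsubseteq> t \<Longrightarrow> pm t x y k \<Longrightarrow> pm t y z g \<Longrightarrow> pm t y z' g \<Longrightarrow> E t z z'"
  obtains h where "D v h" "comp v h g k"
proof -
  let ?K = "\<lambda>t p q. \<exists>x. D t x \<and> (\<exists>y. D t y \<and> (\<exists>z. D t z \<and> op t p x y \<and> pm t y z g \<and> op t q x z))"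
  obtain h where h: "D v h" "\<And>t q. v \<sqsubseteq> t \<Longrightarrow> D t q \<Longrightarrow> M t q h \<longleftrightarrow> (\<exists>p. M t p k \<and> ?K t p q)"
  proof (rule image[where ps = "[g]" and w = v and a = k and K = ?K and
        F = "\<^bold>\<exists>x. \<^bold>\<exists>y. \<^bold>\<exists>z. b_pair 2 x y \<^bold>\<and> b_pm y z 0 \<^bold>\<and> b_pair 1 x z"])
    fix t p assume t: "v \<sqsubseteq> t" and p: "M t p k"
    obtain x y z where xyz: "op t p x y" "pm t y z g" using ex[OF t p] by blast
    obtain q where "op t q x z" using op_exists op_D(2)[OF xyz(1)] pm_D(2)[OF xyz(2)] by blast
    then show "\<exists>q. D t q \<and> ?K t p q" using xyz op_D pm_D by meson
  next
    fix t p q q' assume t: "v \<sqsubseteq> t" and p: "M t p k" and q: "?K t p q" "?K t p q'"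
    then obtain x y z x' y' z' where 1: "op t p x y" "pm t y z g" "op t q x z"
      and 2: "op t p x' y'" "pm t y' z' g" "op t q' x' z'" by blast
    have eq: "E t x' x" "E t y' y" using op_inj[OF 2(1) 1(1)] by blast+
    have "pm t y z' g" using pm_cong[OF 2(2) eq(2)] E_refl pm_D[OF 2(2)] by blast
    then have "E t z' z" using unique[OF t pmI[OF p 1(1)]] 1(2) by blast
    then have "op t q' x z" using op_cong[OF 2(3)] op_self[OF 2(3)] eq by blast
    then show "E t q q'" using op_unique 1(3) by blast
  qed (use assms(1,2) in auto)
  have "comp v h g k" unfolding comp_def
  proof (intro allI impI)
    fix t q assume t: "v \<sqsubseteq> t" and q: "D t q"
    show "M t q h \<longleftrightarrow> (\<exists>x. D t x \<and> (\<exists>y. D t y \<and> (\<exists>z. D t z \<and> op t q x z \<and> pm t x y k \<and> pm t y z g)))"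
      using h(2)[OF t q] unfolding pm_def by blast
  qed
  then show thesis using that h(1) by blast
qed

lemma product_exists:
  assumes "D v X" "D v Y"
  obtains Z where "D v Z" "\<And>t p. v \<sqsubseteq> t \<Longrightarrow> M t p Z \<longleftrightarrow> (\<exists>x y. M t x X \<and> M t y Y \<and> op t p x y)"
proof -
  let ?K = "\<lambda>t x p. \<exists>y. M t y Y \<and> op t p x y"
  obtain Z where Z: "D v Z" "\<And>t p. v \<sqsubseteq> t \<Longrightarrow> D t p \<Longrightarrow> M t p Z \<longleftrightarrow> (\<exists>x. M t x X \<and> ?K t x p)"
  proof (rule union_image[where ps = "[Y]" and w = v and a = X and K = ?K and
        F = "bex 0 (\<lambda>y. b_pair 3 2 y)"])
    fix t x assume t: "v \<sqsubseteq> t" and x: "M t x X"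
    obtain s where "D t s" "\<And>u p. t \<sqsubseteq> u \<Longrightarrow> D u p \<Longrightarrow> M u p s \<longleftrightarrow> (\<exists>y. M u y Y \<and> op u p x y)"
    proof (rule image[where ps = "[x]" and w = t and a = Y and K = "\<lambda>u y p. op u p x y" and
          F = "b_pair 1 0 2"])
      show "\<exists>p. D u p \<and> op u p x y" if u: "t \<sqsubseteq> u" and y: "M u y Y" for u y
        using op_exists[OF D_mono[OF M_Ds(1)[OF x] u] M_Ds(1)[OF y]] op_D(1) by metis
    qed (use D_mono[OF assms(2) t] M_Ds(1)[OF x] op_unique in auto)
    then show "\<exists>s. D t s \<and> (\<forall>u p. t \<sqsubseteq> u \<longrightarrow> D u p \<longrightarrow> (M u p s \<longleftrightarrow> ?K u x p))" by blast
  qed (use assms in auto)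
  have "M t p Z \<longleftrightarrow> (\<exists>x y. M t x X \<and> M t y Y \<and> op t p x y)" if t: "v \<sqsubseteq> t" for t p
    using Z(2)[OF t] M_Ds(1)[of t p Z] op_D(1) by blast
  then show thesis using that Z(1) by blast
qed

lemma fn_mono: "fn u g X Y \<Longrightarrow> u \<sqsubseteq> v \<Longrightarrow> fn v g X Y"
  unfolding fn_def using le_trans by meson

lemma fn_elem: "fn v g X Y \<Longrightarrow> M v p g \<Longrightarrow> \<exists>x y. M v x X \<and> M v y Y \<and> op v p x y"
  unfolding fn_def using le_refl by blast

lemma fn_ex: "fn v g X Y \<Longrightarrow> M v x X \<Longrightarrow> \<exists>y. pm v x y g"
  unfolding fn_def using le_refl by blast

lemma fn_in:
  assumes "fn v g X Y" "pm v x y g"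
  shows "M v x X" "M v y Y"
proof -
  obtain p where p: "M v p g" "op v p x y" using assms(2) unfolding pm_def by blast
  then obtain x' y' where x': "M v x' X" "M v y' Y" "op v p x' y'" using fn_elem[OF assms(1)] by blast
  have "E v x' x" "E v y' y" using op_inj[OF x'(3) p(2)] by blast+
  then show "M v x X" "M v y Y" using x'(1,2) E_iff(2)[OF _ le_refl] by blast+
qed

lemma fn_unique:
  assumes "fn v g X Y" "pm v x y g" "pm v x y' g"
  shows "E v y y'"
proof -
  have "M v x X" using fn_in(1)[OF assms(1,2)] .
  then obtain z where z: "\<forall>u. v \<sqsubseteq> u \<longrightarrow> (\<forall>y'. D u y' \<longrightarrow> pm u x y' g \<longrightarrow> E u y' z)"
    using assms(1) le_refl[of v] unfolding fn_def by blast
  then have "E v y z" "E v y' z" using le_refl[of v] assms(2,3) pm_D(2) by blast+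
  then show ?thesis using E_sym E_trans by blast
qed

lemma fnI:
  assumes "\<And>t p. v \<sqsubseteq> t \<Longrightarrow> M t p g \<Longrightarrow> \<exists>x y. M t x X \<and> M t y Y \<and> op t p x y"
    and "\<And>t x. v \<sqsubseteq> t \<Longrightarrow> M t x X \<Longrightarrow> \<exists>y. pm t x y g"
    and "\<And>t x y y'. v \<sqsubseteq> t \<Longrightarrow> pm t x y g \<Longrightarrow> pm t x y' g \<Longrightarrow> E t y y'"
  shows "fn v g X Y"
  unfolding fn_def
proof (intro conjI allI impI)
  fix t p assume "v \<sqsubseteq> t" "M t p g"
  then show "\<exists>x. M t x X \<and> (\<exists>y. M t y Y \<and> op t p x y)" using assms(1) by blast
next
  fix t x assume t: "v \<sqsubseteq> t" and x: "M t x X"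
  obtain y where y: "pm t x y g" using assms(2)[OF t x] by blast
  have "E u y' y" if "t \<sqsubseteq> u" "pm u x y' g" for u y'
    using assms(3)[OF le_trans[OF t that(1)] that(2) pm_mono[OF y that(1)]] .
  then show "\<exists>y. D t y \<and> pm t x y g \<and> (\<forall>u. t \<sqsubseteq> u \<longrightarrow> (\<forall>y'. D u y' \<longrightarrow> pm u x y' g \<longrightarrow> E u y' y))"
    using y pm_D(2)[OF y] by blast
qed

end

section \<open>Fibres, the functor, algebras and morphisms under forcing\<close>

context family
begin

text \<open>From here on the levels 0, 1, 2 hold \<open>A\<close>, \<open>B\<close>,
  \<open>f\<close>, in the order of the quantifiers of \<open>W_types_exist\<close>;
  \<open>tr_form\<close> uses a different order.\<close>

definition fam_form :: "nat \<Rightarrow> nat \<Rightarrow> nat \<Rightarrow> form" where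
  "fam_form a s Z = (\<^bold>\<exists>C. is_fibre C 2 1 a \<^bold>\<and> is_function s C Z)"

text \<open>The fibre over \<open>a\<close>, which \<open>fam\<close> avoids as an object, exists by
  bounded Separation from \<open>B\<close>; this connects \<open>fam\<close> with functions on a
  fibre.\<close>

lemma fam_iff_fn:
  assumes v: "w0 \<sqsubseteq> v" and D: "D v s" "D v a"
  shows "(\<exists>C. D v C \<and> (\<forall>t. v \<sqsubseteq> t \<longrightarrow> (\<forall>b. D t b \<longrightarrow> (M t b C \<longleftrightarrow> M t b B \<and> pm t b a f))) \<and> fn v s C Z) \<longleftrightarrow>
    fam v a s Z" (is "?L \<longleftrightarrow> _")
proof
  assume ?L
  then obtain C where C: "\<forall>t. v \<sqsubseteq> t \<longrightarrow> (\<forall>b. D t b \<longrightarrow> (M t b C \<longleftrightarrow> M t b B \<and> pm t b a f))" "fn v s C Z"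
    by blast
  have C': "M t b C \<longleftrightarrow> pm t b a f" if "v \<sqsubseteq> t" for t b
    using C(1) that f_in[OF le_trans[OF v that]] M_Ds(1)[of t b C] pm_D(1)[of t b a f] by blast
  show "fam v a s Z" unfolding fam_def
  proof (intro conjI allI impI)
    show "D v s" by (rule D(1))
    show "\<exists>b y. pm t b a f \<and> M t y Z \<and> op t p b y" if t: "v \<sqsubseteq> t" and p: "M t p s" for t p
      using fn_elem[OF fn_mono[OF C(2) t] p] C'[OF t] by blast
    show "\<exists>y. pm t b y s" if t: "v \<sqsubseteq> t" and b: "pm t b a f" for t b
      using fn_ex[OF fn_mono[OF C(2) t]] C'[OF t] b by blast
    show "E t y y'" if t: "v \<sqsubseteq> t" and y: "pm t b y s" "pm t b y' s" for t b y y'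
      using fn_unique[OF fn_mono[OF C(2) t] y] .
  qed
next
  assume s: "fam v a s Z"
  obtain C where C: "D v C" "\<And>t b. v \<sqsubseteq> t \<Longrightarrow> M t b C \<longleftrightarrow> M t b B \<and> pm t b a f"
    by (rule separation[where ps = "[a, f]" and w = v and a = B and F = "b_pm 2 0 1"])
      (use Ds[OF v] D in auto)
  have "fn v s C Z"
  proof (rule fnI)
    show "\<exists>x y. M t x C \<and> M t y Z \<and> op t p x y" if t: "v \<sqsubseteq> t" and p: "M t p s" for t p
    proof -
      obtain b y where b: "pm t b a f" "M t y Z" "op t p b y" using s t p unfolding fam_def by blast
      then show ?thesis using C(2)[OF t] f_in[OF le_trans[OF v t] b(1)] by blast
    qed
    show "\<exists>y. pm t b y s" if t: "v \<sqsubseteq> t" and b: "M t b C" for t b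
      using fam_ex[OF fam_mono[OF s t]] C(2)[OF t] b by blast
    show "E t y y'" if t: "v \<sqsubseteq> t" and y: "pm t b y s" "pm t b y' s" for t b y y'
      using fam_unique[OF fam_mono[OF s t] y] .
  qed
  then show ?L using C by blast
qed

lemma fs_fam_form:
  assumes "take 3 e = [A, B, f]" "w0 \<sqsubseteq> v" "a < length e" "s < length e" "Z < length e"
    and "D v (e ! a)" "D v (e ! s)"
  shows "fs pr (fam_form a s Z) v e \<longleftrightarrow> fam v (e ! a) (e ! s) (e ! Z)"
proof -
  obtain l where "e = A # B # f # l"
    using assms(1) by (metis append_Cons append_Nil append_take_drop_id)
  then have nth: "2 < length e" "e ! 1 = B" "e ! 2 = f" "e \<noteq> []" by auto
  have "fs pr (pair_mem (Suc (length e)) a 2) t (e @ [C, b]) \<longleftrightarrow> pm t b (e ! a) f"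
    if "v \<sqsubseteq> t" "D t b" for t b C
    using fs_pair_mem[of "Suc (length e)" "e @ [C, b]" a 2 t pr] nth assms(3) that(2)
      D_mono[OF assms(6) that(1)] by (simp add: nth_append)
  then have "fs pr (is_fibre (length e) 2 1 a) v (e @ [C]) \<longleftrightarrow>
      (\<forall>t. v \<sqsubseteq> t \<longrightarrow> (\<forall>b. D t b \<longrightarrow> (M t b C \<longleftrightarrow> M t b B \<and> pm t b (e ! a) f)))" for C
    using nth by (simp add: is_fibre_def nth_append)
  then have "fs pr (fam_form a s Z) v e \<longleftrightarrow> (\<exists>C. D v C \<and>
      (\<forall>t. v \<sqsubseteq> t \<longrightarrow> (\<forall>b. D t b \<longrightarrow> (M t b C \<longleftrightarrow> M t b B \<and> pm t b (e ! a) f))) \<and> fn v (e ! s) C (e ! Z))"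
    using assms(4,5) by (simp add: fam_form_def fs_is_function nth_append)
  then show ?thesis using fam_iff_fn assms(2,6,7) by simp
qed

definition Pf where
  "Pf v P Y \<longleftrightarrow> (\<forall>t. v \<sqsubseteq> t \<longrightarrow> (\<forall>p. D t p \<longrightarrow> (M t p P \<longleftrightarrow>
     (\<exists>a. M t a A \<and> (\<exists>s. D t s \<and> op t p a s \<and> fam t a s Y)))))"

lemma fs_is_Pf:
  assumes "take 3 e = [A, B, f]" "w0 \<sqsubseteq> v" "P < length e" "Y < length e"
  shows "fs pr (is_Pf 2 1 0 P Y) v e \<longleftrightarrow> Pf v (e ! P) (e ! Y)"
proof -
  obtain l where "e = A # B # f # l"
    using assms(1) by (metis append_Cons append_Nil append_take_drop_id)
  then have nth: "2 < length e" "e ! 0 = A" "e \<noteq> []" by auto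
  let ?n = "length e"
  have 1: "fs pr (is_pair ?n (Suc ?n) (Suc (Suc ?n))) t (e @ [p, a, s]) \<longleftrightarrow> op t p a s"
    if "D t p" "M t a A" "D t s" for t p a s
    using fs_is_pair[of ?n "e @ [p, a, s]" "Suc ?n" "Suc (Suc ?n)" t pr] M_Ds(1) that
    by (simp add: nth_append)
  have 2: "fs pr (fam_form (Suc ?n) (Suc (Suc ?n)) Y) t (e @ [p, a, s]) \<longleftrightarrow> fam t a s (e ! Y)"
    if "v \<sqsubseteq> t" "M t a A" "D t s" for t p a s
    using fs_fam_form[of "e @ [p, a, s]" t "Suc ?n" "Suc (Suc ?n)" Y pr] M_Ds(1) that assms(1,4) nth(1)
      le_trans[OF assms(2) that(1)] by (simp add: nth_append)
  have "is_Pf 2 1 0 P Y = (\<^bold>\<forall>p. p \<^bold>\<in> P \<^bold>\<longleftrightarrow> bex 0 (\<lambda>a. \<^bold>\<exists>s. is_pair p a s \<^bold>\<and> fam_form a s Y))"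
    by (simp add: is_Pf_def fam_form_def)
  then show ?thesis using assms(3) nth 1 2 by (simp add: Pf_def nth_append cong: conj_cong)
qed

lemma Pf_iff: "Pf v P Y \<Longrightarrow> v \<sqsubseteq> t \<Longrightarrow> M t p P \<longleftrightarrow> (\<exists>a s. M t a A \<and> op t p a s \<and> fam t a s Y)"
  unfolding Pf_def using op_D M_Ds(1)[of t p P] by blast

lemma Pf_mono: "Pf u P Y \<Longrightarrow> u \<sqsubseteq> v \<Longrightarrow> Pf v P Y"
  unfolding Pf_def using le_trans by blast

lemma fam_cong_fun:
  assumes "fam v a s Z" "E v s s'"
  shows "fam v a s' Z"
proof -
  have "pm t b y s \<longleftrightarrow> pm t b y s'" if "v \<sqsubseteq> t" for t b y
    using pm_cong[of t b y s b y s'] pm_cong[of t b y s' b y s] E_mono[OF assms(2) that] E_sym E_refl pm_D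
    by blast
  then show ?thesis using assms(1) E_iff(1)[OF assms(2)] E_D[OF assms(2)] unfolding fam_def by simp
qed

lemma Pf_pair: assumes "Pf v P Y" "v \<sqsubseteq> t" "op t p a s"
  shows "M t p P \<longleftrightarrow> M t a A \<and> fam t a s Y"
proof
  assume "M t p P"
  then obtain a' s' where a': "M t a' A" "op t p a' s'" "fam t a' s' Y" using Pf_iff assms by blast
  have eq: "E t a' a" "E t s' s" using op_inj[OF a'(2) assms(3)] by blast+
  have "fam t a s Y" using fam_cong[OF fam_cong_fun[OF a'(3) eq(2)] eq(1)] .
  then show "M t a A \<and> fam t a s Y" using a'(1) E_iff(2)[OF eq(1) le_refl] by blast
qed (use Pf_iff assms in blast)

text \<open>Nested exactly as the quantifiers of \<open>is_Pf_map\<close>, so that forcing unfolds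
  to it; \<open>map_pair_iff\<close> gives the readable form.\<close>

definition map_pair where
  "map_pair v \<alpha> P q \<longleftrightarrow> (\<exists>u. D v u \<and> (\<exists>x. D v x \<and> op v q u x \<and> M v u P \<and> (\<exists>a. D v a \<and> (\<exists>s. D v s \<and>
     (\<exists>s'. D v s' \<and> op v u a s \<and> op v x a s' \<and> comp v s' \<alpha> s)))))"

lemma map_pair_iff: "map_pair v \<alpha> P q \<longleftrightarrow>
    (\<exists>u x a s s'. op v q u x \<and> M v u P \<and> op v u a s \<and> op v x a s' \<and> comp v s' \<alpha> s)"
proof
  assume "map_pair v \<alpha> P q"
  then show "\<exists>u x a s s'. op v q u x \<and> M v u P \<and> op v u a s \<and> op v x a s' \<and> comp v s' \<alpha> s"
    unfolding map_pair_def by (elim exE conjE) (intro exI conjI)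
next
  assume "\<exists>u x a s s'. op v q u x \<and> M v u P \<and> op v u a s \<and> op v x a s' \<and> comp v s' \<alpha> s"
  then obtain u x a s s' where
    1: "op v q u x" "M v u P" "op v u a s" "op v x a s'" "comp v s' \<alpha> s" by (elim exE conjE)
  show "map_pair v \<alpha> P q"
    unfolding map_pair_def
    by (rule exI[of _ u], rule conjI, rule op_D(1)[OF 1(3)], rule exI[of _ x], rule conjI,
        rule op_D(1)[OF 1(4)], intro conjI 1, rule exI[of _ a], rule conjI, rule op_D(2)[OF 1(3)],
        rule exI[of _ s], rule conjI, rule op_D(3)[OF 1(3)], rule exI[of _ s'], rule conjI,
        rule op_D(3)[OF 1(4)], intro conjI 1)
qed

definition Pf_map where
  "Pf_map v m \<alpha> Y \<longleftrightarrow> (\<exists>P. D v P \<and> Pf v P Y \<and>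
     (\<forall>t. v \<sqsubseteq> t \<longrightarrow> (\<forall>q. D t q \<longrightarrow> (M t q m \<longleftrightarrow> map_pair t \<alpha> P q))))"

lemma fs_is_Pf_map:
  assumes "take 3 e = [A, B, f]" "w0 \<sqsubseteq> v" "m < length e" "\<alpha> < length e" "Y < length e"
  shows "fs pr (is_Pf_map 2 1 0 m \<alpha> Y) v e \<longleftrightarrow> Pf_map v (e ! m) (e ! \<alpha>) (e ! Y)"
proof -
  have "length e \<ge> 3" using arg_cong[OF assms(1), of length] by simp
  then have "fs pr (is_Pf 2 1 0 (length e) Y) v (e @ [P]) \<longleftrightarrow> Pf v P (e ! Y)" for P
    using fs_is_Pf[of "e @ [P]" v "length e" Y pr] assms by (simp add: nth_append)
  then show ?thesis using assms(3-5)
    by (simp add: is_Pf_map_def Pf_map_def map_pair_def fs_is_pair fs_is_composite nth_append cong: conj_cong)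
qed

definition algebra where
  "algebra v Y t \<longleftrightarrow> (\<exists>P. D v P \<and> Pf v P Y \<and> fn v t P Y)"

lemma fs_is_algebra:
  assumes "take 3 e = [A, B, f]" "w0 \<sqsubseteq> v" "Y < length e" "t < length e"
  shows "fs pr (is_algebra 2 1 0 Y t) v e \<longleftrightarrow> algebra v (e ! Y) (e ! t)"
proof -
  have "length e \<ge> 3" using arg_cong[OF assms(1), of length] by simp
  then have "fs pr (is_Pf 2 1 0 (length e) Y) v (e @ [P]) \<longleftrightarrow> Pf v P (e ! Y)" for P
    using fs_is_Pf[of "e @ [P]" v "length e" Y pr] assms by (simp add: nth_append)
  then show ?thesis using assms(3,4)
    by (simp add: is_algebra_def algebra_def fs_is_function nth_append)
qed

definition morphism where
  "morphism v \<alpha> Y s Z t \<longleftrightarrow> fn v \<alpha> Y Z \<and> (\<exists>m. D v m \<and> (\<exists>h. D v h \<and>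
     Pf_map v m \<alpha> Y \<and> comp v h \<alpha> s \<and> comp v h t m))"

lemma fs_is_morphism:
  assumes "take 3 e = [A, B, f]" "w0 \<sqsubseteq> v" "\<alpha> < length e" "Y < length e" "s < length e"
    "Z < length e" "t < length e"
  shows "fs pr (is_morphism 2 1 0 \<alpha> Y s Z t) v e \<longleftrightarrow>
    morphism v (e ! \<alpha>) (e ! Y) (e ! s) (e ! Z) (e ! t)"
proof -
  have "length e \<ge> 3" using arg_cong[OF assms(1), of length] by simp
  then have "fs pr (is_Pf_map 2 1 0 (length e) \<alpha> Y) v (e @ [m, h]) \<longleftrightarrow> Pf_map v m (e ! \<alpha>) (e ! Y)" for m h
    using fs_is_Pf_map[of "e @ [m, h]" v "length e" \<alpha> Y pr] assms by (simp add: nth_append)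
  then show ?thesis using assms(3-7)
    by (simp add: is_morphism_def morphism_def fs_is_function fs_is_composite nth_append)
qed

text \<open>Unlike the formula in \<open>sup_exists\<close> this one is unbounded: it is used inside
  Collection, where the bounds are dispensable.\<close>

definition sup_form :: "nat \<Rightarrow> nat \<Rightarrow> nat \<Rightarrow> nat \<Rightarrow> form" where
  "sup_form z y a s = (\<^bold>\<forall>p. p \<^bold>\<in> y \<^bold>\<longleftrightarrow> b_pair p a z \<^bold>\<or>
     (\<^bold>\<exists>b. \<^bold>\<exists>c. bex c (\<lambda>q. b_pm b c s \<^bold>\<and> b_pair p b q)))"

lemma fs_sup_form:
  assumes "z < length e" "y < length e" "a < length e" "s < length e" "e ! z = z0" "D v (e ! y)"
  shows "fs pr (sup_form z y a s) v e \<longleftrightarrow> sup v (e ! y) (e ! a) (e ! s)"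
proof -
  have "fs pr (sup_form z y a s) v e \<longleftrightarrow> (\<forall>t. v \<sqsubseteq> t \<longrightarrow> (\<forall>p. D t p \<longrightarrow> (M t p (e ! y) \<longleftrightarrow>
      op t p (e ! a) z0 \<or> (\<exists>b. D t b \<and> (\<exists>c. D t c \<and> (\<exists>q. M t q c \<and> pm t b c (e ! s) \<and> op t p b q))))))"
    using assms by (simp add: sup_form_def nth_append)
  also have "\<dots> \<longleftrightarrow> sup v (e ! y) (e ! a) (e ! s)"
    using assms(6) M_Ds(1) op_D(1) pm_D(1,2) unfolding sup_def by (smt (verit))
  finally show ?thesis .
qed

text \<open>Since every element of \<open>W\<close> is \<open>sup a s\<close> for a unique \<open>(a, s)\<close>, Collection over \<open>W\<close> yields both
  the set \<open>P\<^sub>f(W)\<close>, without exponentiation, and the structure map.\<close>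

lemma algebra_exists:
  "\<exists>P st. D w0 P \<and> D w0 st \<and> Pf w0 P W \<and> fn w0 st P W \<and>
    (\<forall>v p a s y. w0 \<sqsubseteq> v \<longrightarrow> op v p a s \<longrightarrow>
      (pm v p y st \<longleftrightarrow> M v a A \<and> fam v a s W \<and> sup v y a s))"
proof -
  let ?ps = "[A, B, f, z0, W]"
  have ps: "\<forall>p\<in>set ?ps. D w0 p" using params[OF le_refl] W(1) by simp
  \<comment> \<open>\<open>p\<close> is the pair (a, s) from which the tree \<open>y\<close> is
    built. Read from \<open>y\<close> to \<open>p\<close> this is functional by \<open>W_inv\<close>
    and \<open>sup_inj\<close>, so its image is the value of the functor at
    \<open>W\<close>.\<close>
  let ?K = "\<lambda>v y p. \<exists>a. M v a A \<and> (\<exists>s. D v s \<and> op v p a s \<and> fam v a s W \<and> sup v y a s)"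
  let ?F = "\<lambda>y p. bex 0 (\<lambda>a. \<^bold>\<exists>s. b_pair p a s \<^bold>\<and> fam_form a s 4 \<^bold>\<and> sup_form 3 y a s)"
  have F: "fs pr (?F 6 5) v (?ps @ [p, y]) \<longleftrightarrow> ?K v y p"
    if v: "w0 \<sqsubseteq> v" and y: "D v y" for pr v p y
  proof -
    have 1: "fs pr (fam_form 7 8 4) v (?ps @ [p, y, a, s]) \<longleftrightarrow> fam v a s W" if "M v a A" "D v s" for a s
      using fs_fam_form[of "?ps @ [p, y, a, s]" v 7 8 4 pr] v that M_Ds(1) by simp
    have 2: "fs pr (sup_form 3 6 7 8) v (?ps @ [p, y, a, s]) \<longleftrightarrow> sup v y a s" for a s
      using fs_sup_form[of 3 "?ps @ [p, y, a, s]" 6 7 8 v pr] y by simp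
    show ?thesis using 1 2 by (simp add: numeral_eq_Suc cong: conj_cong)
  qed
  have exK: "\<exists>p. D v p \<and> ?K v y p" if v: "w0 \<sqsubseteq> v" and y: "M v y W" for v y
  proof -
    obtain a s where a: "M v a A" "fam v a s W" "sup v y a s" by (rule W_inv[OF v y])
    then have "D v s" unfolding fam_def by blast
    moreover obtain p where "op v p a s" using op_exists M_Ds(1)[OF a(1)] \<open>D v s\<close> by blast
    ultimately show ?thesis using a op_D(1) by blast
  qed
  have uniqueK: "E v p p'" if v: "w0 \<sqsubseteq> v" and p: "?K v y p" "?K v y p'" for v y p p'
  proof -
    obtain a s a' s' where 1: "M v a A" "op v p a s" "fam v a s W" "sup v y a s"
      and 2: "M v a' A" "op v p' a' s'" "fam v a' s' W" "sup v y a' s'" using p by blast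
    have "E v a a'" "E v s s'" using sup_inj[OF v 1(1,3,4) 2(1,3,4)] .
    then have "op v p a' s'" using op_cong[OF 1(2)] op_self[OF 1(2)] by blast
    then show ?thesis using op_unique 2(2) by blast
  qed
  obtain P where P: "D w0 P" "\<And>v p. w0 \<sqsubseteq> v \<Longrightarrow> D v p \<Longrightarrow> M v p P \<longleftrightarrow> (\<exists>y. M v y W \<and> ?K v y p)"
    by (rule image[where ps = ?ps and w = w0 and a = W and K = ?K and F = "?F 6 5", OF W(1) ps])
      ((rule F exK uniqueK; assumption)+, blast)
  let ?L = "\<lambda>v y q. \<exists>p. D v p \<and> op v q p y \<and> ?K v y p"
  obtain st where st: "D w0 st" "\<And>v q. w0 \<sqsubseteq> v \<Longrightarrow> D v q \<Longrightarrow> M v q st \<longleftrightarrow> (\<exists>y. M v y W \<and> ?L v y q)"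
  proof (rule image[where ps = ?ps and w = w0 and a = W and K = ?L and
        F = "\<^bold>\<exists>p. b_pair 5 p 6 \<^bold>\<and> ?F 6 p", OF W(1) ps])
    fix pr v y q assume v: "w0 \<sqsubseteq> v" and y: "D v y"
    have "fs pr (?F 6 7) v (?ps @ [q, y, p]) \<longleftrightarrow> ?K v y p" for p
    proof -
      have 1: "fs pr (fam_form 8 9 4) v (?ps @ [q, y, p, a, s]) \<longleftrightarrow> fam v a s W" if "M v a A" "D v s" for a s
        using fs_fam_form[of "?ps @ [q, y, p, a, s]" v 8 9 4 pr] v that M_Ds(1) by simp
      have 2: "fs pr (sup_form 3 6 8 9) v (?ps @ [q, y, p, a, s]) \<longleftrightarrow> sup v y a s" for a s
        using fs_sup_form[of 3 "?ps @ [q, y, p, a, s]" 6 8 9 v pr] y by simp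
      show ?thesis using 1 2 by (simp add: numeral_eq_Suc cong: conj_cong)
    qed
    then show "fs pr (\<^bold>\<exists>p. b_pair 5 p 6 \<^bold>\<and> ?F 6 p) v (?ps @ [q, y]) \<longleftrightarrow> ?L v y q"
      by (simp add: numeral_eq_Suc)
  next
    fix v y assume v: "w0 \<sqsubseteq> v" and y: "M v y W"
    obtain p where p: "D v p" "?K v y p" using exK[OF v y] by blast
    obtain q where "op v q p y" using op_exists p(1) M_Ds(1)[OF y] by blast
    then show "\<exists>q. D v q \<and> ?L v y q" using p op_D(1) by blast
  next
    fix v y q q' assume v: "w0 \<sqsubseteq> v" and q: "?L v y q" "?L v y q'"
    then obtain p p' where p: "op v q p y" "?K v y p" "op v q' p' y" "?K v y p'" by blast
    have "op v q p' y" using op_cong[OF p(1)] op_self[OF p(1)] uniqueK[OF v p(2,4)] by blast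
    then show "E v q q'" using op_unique p(3) by blast
  qed blast
  have main: "pm v p y st \<longleftrightarrow> M v a A \<and> fam v a s W \<and> sup v y a s"
    if v: "w0 \<sqsubseteq> v" and p: "op v p a s" for v p a s y
  proof
    assume "pm v p y st"
    then obtain q where q: "M v q st" "op v q p y" unfolding pm_def by blast
    then obtain y' p' where y': "op v q p' y'" "?K v y' p'"
      using st(2)[OF v M_Ds(1)[OF q(1)]] by blast
    then obtain a' s' where a': "M v a' A" "op v p' a' s'" "fam v a' s' W" "sup v y' a' s'" by blast
    have eq: "E v p' p" "E v y' y" using op_inj[OF y'(1) q(2)] by blast+
    have "op v p a' s'" using op_cong[OF a'(2) eq(1)] op_self[OF a'(2)] by blast
    then have eq': "E v a' a" "E v s' s" using op_inj[OF _ p] by blast+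
    have "sup v y a s" using sup_congs[OF sup_cong[OF a'(4) eq(2)] eq'] .
    moreover have "M v a A" using a'(1) E_iff(2)[OF eq'(1) le_refl] by blast
    moreover have "fam v a s W" using fam_cong[OF fam_cong_fun[OF a'(3) eq'(2)] eq'(1)] .
    ultimately show "M v a A \<and> fam v a s W \<and> sup v y a s" by blast
  next
    assume a: "M v a A \<and> fam v a s W \<and> sup v y a s"
    then have y: "M v y W" using W_sup[OF v] by blast
    obtain q where q: "op v q p y" using op_exists op_D(1)[OF p] M_Ds(1)[OF y] by blast
    have "?K v y p" using a p op_D(3)[OF p] by blast
    then have "M v q st" using st(2)[OF v op_D(1)[OF q]] y q op_D(1)[OF p] by blast
    then show "pm v p y st" using q pmI by blast
  qed
  have PfP: "Pf w0 P W" unfolding Pf_def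
  proof (intro allI impI)
    fix v p assume v: "w0 \<sqsubseteq> v" and p: "D v p"
    have "\<exists>y. M v y W \<and> sup v y a s" if "M v a A" "fam v a s W" for a s
      using sup_exists[OF v that(1) fam_T[OF v that(2)]] W_sup[OF v that] by blast
    then show "M v p P \<longleftrightarrow> (\<exists>a. M v a A \<and> (\<exists>s. D v s \<and> op v p a s \<and> fam v a s W))"
      using P(2)[OF v p] by blast
  qed
  have "fn w0 st P W"
  proof (rule fnI)
    show "\<exists>p y. M v p P \<and> M v y W \<and> op v q p y" if v: "w0 \<sqsubseteq> v" and q: "M v q st" for v q
      using st(2)[OF v M_Ds(1)[OF q]] P(2)[OF v] q by blast
    show "\<exists>y. pm v p y st" if v: "w0 \<sqsubseteq> v" and p: "M v p P" for v p
    proof -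
      obtain a s where a: "M v a A" "op v p a s" "fam v a s W" using Pf_iff[OF PfP v] p by blast
      obtain y where "sup v y a s" using sup_exists[OF v a(1) fam_T[OF v a(3)]] by blast
      then show ?thesis using main[OF v a(2)] a by blast
    qed
    show "E v y y'" if v: "w0 \<sqsubseteq> v" and y: "pm v p y st" "pm v p y' st" for v p y y'
    proof -
      obtain q where q: "M v q st" "op v q p y" using y(1) unfolding pm_def by blast
      then obtain y0 p' where y0: "op v q p' y0" "?K v y0 p'" using st(2)[OF v M_Ds(1)[OF q(1)]] by blast
      then obtain a s where a: "op v p' a s" by blast
      have "E v p' p" using op_inj(1)[OF y0(1) q(2)] .
      then have p: "op v p a s" using op_cong[OF a] op_self[OF a] by blast
      then have "sup v y a s" "sup v y' a s" using main[OF v p] y by blast+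
      then show ?thesis by (rule sup_unique)
    qed
  qed
  then show ?thesis using P(1) st(1) PfP main by blast
qed

end

section \<open>Recursion on trees\<close>

text \<open>The target algebra (Y, th) lives at a world \<open>v0\<close> above \<open>w0\<close>,
  because initiality quantifies over all algebras at later worlds.\<close>

locale recursion = family +
  fixes P st v0 Y PY th
  assumes P: "D w0 P" "Pf w0 P W" and st: "D w0 st" "fn w0 st P W"
    and st_iff: "w0 \<sqsubseteq> v \<Longrightarrow> op v p a s \<Longrightarrow> pm v p y st \<longleftrightarrow> M v a A \<and> fam v a s W \<and> sup v y a s"
    and v0: "w0 \<sqsubseteq> v0" and Y: "D v0 Y" and PY: "D v0 PY" "Pf v0 PY Y"
    and th: "D v0 th" "fn v0 th PY Y"
begin

section \<open>Rules generating the graph of a recursive function\<close>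

lemma w0_le: "v0 \<sqsubseteq> v \<Longrightarrow> w0 \<sqsubseteq> v"
  using le_trans v0 by blast

definition tval where
  "tval v a g z \<longleftrightarrow> (\<exists>p. op v p a g \<and> pm v p z th)"

lemma tval_mono: "tval u a g z \<Longrightarrow> u \<sqsubseteq> v \<Longrightarrow> tval v a g z"
  unfolding tval_def using op_mono pm_mono by meson

lemma tval_in:
  assumes v: "v0 \<sqsubseteq> v" and z: "tval v a g z"
  shows "M v a A" "fam v a g Y" "M v z Y"
proof -
  obtain p where p: "op v p a g" "pm v p z th" using z unfolding tval_def by blast
  have "M v p PY" "M v z Y" using fn_in[OF fn_mono[OF th(2) v] p(2)] .
  then show "M v a A" "fam v a g Y" "M v z Y" using Pf_pair[OF PY(2) v p(1)] by blast+
qed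

lemma tval_ex:
  assumes v: "v0 \<sqsubseteq> v" and a: "M v a A" "fam v a g Y"
  obtains z where "tval v a g z"
proof -
  have "D v g" using a(2) unfolding fam_def by blast
  then obtain p where p: "op v p a g" using op_exists M_Ds(1)[OF a(1)] by blast
  then have "M v p PY" using Pf_pair[OF PY(2) v p] a by blast
  then show thesis using fn_ex[OF fn_mono[OF th(2) v]] p that unfolding tval_def by blast
qed

lemma tval_unique:
  assumes v: "v0 \<sqsubseteq> v" and z: "tval v a g z" "tval v a' g' z'" and e: "E v a a'" "E v g g'"
  shows "E v z z'"
proof -
  obtain p p' where p: "op v p a g" "pm v p z th" "op v p' a' g'" "pm v p' z' th"
    using z unfolding tval_def by blast
  have "op v p a' g'" using op_cong[OF p(1) _ e] op_self[OF p(1)] by blast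
  then have "E v p' p" using op_unique p(3) by blast
  then have "pm v p z' th" using pm_cong[OF p(4)] E_refl pm_D[OF p(4)] by blast
  then show ?thesis using fn_unique[OF fn_mono[OF th(2) v] p(2)] by blast
qed

text \<open>The set of all pairs (s b, g b): what has to be in the graph before the value at the
  tree of (a, s) may be recorded.\<close>

definition prem where
  "prem v u s g \<longleftrightarrow> (\<forall>t. v \<sqsubseteq> t \<longrightarrow> (\<forall>x. D t x \<longrightarrow> (M t x u \<longleftrightarrow>
     (\<exists>b. D t b \<and> (\<exists>y. D t y \<and> (\<exists>z. D t z \<and> op t x y z \<and> pm t b y s \<and> pm t b z g))))))"

lemma prem_iff:
  assumes "prem v u s g" "v \<sqsubseteq> t"
  shows "M t x u \<longleftrightarrow> (\<exists>b y z. op t x y z \<and> pm t b y s \<and> pm t b z g)"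
proof (cases "D t x")
  case True
  then have "M t x u \<longleftrightarrow>
     (\<exists>b. D t b \<and> (\<exists>y. D t y \<and> (\<exists>z. D t z \<and> op t x y z \<and> pm t b y s \<and> pm t b z g)))"
    using assms unfolding prem_def by blast
  then show ?thesis using op_D(2,3) pm_D(1) by meson
next
  case False
  then show ?thesis using M_Ds(1) op_D(1) by meson
qed

text \<open>For \<open>r\<close> = ((a, g), z) in \<open>th\<close> and \<open>y\<close> the tree of
  (a, s), the rule \<open>q\<close> leads from all pairs (s b, g b) to the pair (y, z). Indexing by
  \<open>r\<close> and \<open>y\<close> takes \<open>g\<close> from the domain of \<open>th\<close>,
  so that no set of functions has to be formed.\<close>

definition rl where
  "rl v r y q \<longleftrightarrow> (\<exists>p. D v p \<and> (\<exists>z. D v z \<and> (\<exists>a. D v a \<and> (\<exists>g. D v g \<and> (\<exists>p0. D v p0 \<and> (\<exists>s. D v s \<and>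
     (\<exists>u. D v u \<and> (\<exists>c. D v c \<and> (\<exists>x. D v x \<and> op v r p z \<and> op v p a g \<and> op v p0 a s \<and> pm v p0 y st \<and>
       op v q u c \<and> op v x y z \<and> upair v c x x \<and> prem v u s g)))))))))"

definition rl_form :: "nat \<Rightarrow> nat \<Rightarrow> nat \<Rightarrow> form" where
  "rl_form r y q = (\<^bold>\<exists>p. \<^bold>\<exists>z. \<^bold>\<exists>a. \<^bold>\<exists>g. \<^bold>\<exists>p0. \<^bold>\<exists>s. \<^bold>\<exists>u. \<^bold>\<exists>c. \<^bold>\<exists>x.
     b_pair r p z \<^bold>\<and> b_pair p a g \<^bold>\<and> b_pair p0 a s \<^bold>\<and> b_pm p0 y 1 \<^bold>\<and>
     b_pair q u c \<^bold>\<and> b_pair x y z \<^bold>\<and> b_upair c x x \<^bold>\<and>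
     (\<^bold>\<forall>x. x \<^bold>\<in> u \<^bold>\<longleftrightarrow> (\<^bold>\<exists>b. \<^bold>\<exists>y. \<^bold>\<exists>z. b_pair x y z \<^bold>\<and> b_pm b y s \<^bold>\<and> b_pm b z g)))"

lemma fs_rl_form:
  assumes "1 < length e" "e ! 1 = st" "r < length e" "y < length e" "q < length e"
  shows "fs pr (rl_form r y q) v e \<longleftrightarrow> rl v (e ! r) (e ! y) (e ! q)"
  using assms by (simp add: rl_form_def rl_def prem_def fs_b_upair nth_append cong: conj_cong)

lemma rlE:
  assumes "rl v r y q"
  obtains p z a g p0 s u c x where "op v r p z" "op v p a g" "op v p0 a s" "pm v p0 y st"
    "op v q u c" "op v x y z" "upair v c x x" "prem v u s g"
  using assms unfolding rl_def by (elim exE conjE) (rule that; assumption)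

lemma rlI:
  assumes "op v r p z" "op v p a g" "op v p0 a s" "pm v p0 y st"
    "op v q u c" "op v x y z" "upair v c x x" "prem v u s g"
  shows "rl v r y q"
  unfolding rl_def
  by (rule exI[of _ p], rule conjI, rule op_D(1)[OF assms(2)],
     rule exI[of _ z], rule conjI, rule op_D(3)[OF assms(1)],
     rule exI[of _ a], rule conjI, rule op_D(2)[OF assms(2)],
     rule exI[of _ g], rule conjI, rule op_D(3)[OF assms(2)],
     rule exI[of _ p0], rule conjI, rule op_D(1)[OF assms(3)],
     rule exI[of _ s], rule conjI, rule op_D(3)[OF assms(3)],
     rule exI[of _ u], rule conjI, rule op_D(2)[OF assms(5)],
     rule exI[of _ c], rule conjI, rule op_D(3)[OF assms(5)],
     rule exI[of _ x], rule conjI, rule op_D(1)[OF assms(6)],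
     intro conjI assms)

lemma prem_exists:
  assumes v: "v0 \<sqsubseteq> v" and s: "fam v a s W" and g: "fam v a g Y"
  obtains u where "D v u" "prem v u s g"
proof -
  have Ds': "D v s" "D v g" "D v W" "D v Y" "D v B"
    using s g D_mono[OF W(1) w0_le[OF v]] D_mono[OF Y v] Ds[OF w0_le[OF v]] unfolding fam_def by blast+
  obtain Z where Z: "D v Z" "\<And>t p. v \<sqsubseteq> t \<Longrightarrow> M t p Z \<longleftrightarrow> (\<exists>x y. M t x W \<and> M t y Y \<and> op t p x y)"
    using product_exists[OF Ds'(3,4)] by blast
  obtain u where u: "D v u" "\<And>t x. v \<sqsubseteq> t \<Longrightarrow> M t x u \<longleftrightarrow> M t x Z \<and> (\<exists>b. M t b B \<and> (\<exists>y. M t y W \<and>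
      (\<exists>z. M t z Y \<and> op t x y z \<and> pm t b y s \<and> pm t b z g)))"
    by (rule separation[where ps = "[B, W, Y, s, g]" and w = v and a = Z and
        F = "bex 0 (\<lambda>b. bex 1 (\<lambda>y. bex 2 (\<lambda>z. b_pair 5 y z \<^bold>\<and> b_pm b y 3 \<^bold>\<and> b_pm b z 4)))"])
      (use Ds' Z(1) in auto)
  have "prem v u s g" unfolding prem_def
  proof (intro allI impI)
    fix t x assume t: "v \<sqsubseteq> t" and x: "D t x"
    note st = fam_mono[OF s t] and gt = fam_mono[OF g t]
    have wt: "w0 \<sqsubseteq> t" using le_trans[OF w0_le[OF v] t] .
    show "M t x u \<longleftrightarrow> (\<exists>b. D t b \<and> (\<exists>y. D t y \<and> (\<exists>z. D t z \<and> op t x y z \<and> pm t b y s \<and> pm t b z g)))"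
    proof
      assume "M t x u"
      then obtain b y z where b: "op t x y z" "pm t b y s" "pm t b z g" using u(2)[OF t] by blast
      then show "\<exists>b. D t b \<and> (\<exists>y. D t y \<and> (\<exists>z. D t z \<and> op t x y z \<and> pm t b y s \<and> pm t b z g))"
        using op_D(2,3)[OF b(1)] pm_D(1)[OF b(2)] by blast
    next
      assume "\<exists>b. D t b \<and> (\<exists>y. D t y \<and> (\<exists>z. D t z \<and> op t x y z \<and> pm t b y s \<and> pm t b z g))"
      then obtain b y z where b: "op t x y z" "pm t b y s" "pm t b z g" by blast
      have "M t y W" "M t z Y" "M t b B"
        using fam_in[OF st b(2)] fam_in[OF gt b(3)] f_in[OF wt] by blast+
      then show "M t x u" using b u(2)[OF t] Z(2)[OF t] by blast
    qed
  qed
  then show thesis using that u(1) by blast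
qed

lemma rl_exists:
  assumes v: "v0 \<sqsubseteq> v" and r: "op v r p z" "op v p a g" "pm v p z th"
    and s: "fam v a s W" "sup v y a s"
  obtains q where "rl v r y q"
proof -
  have a: "M v a A" "fam v a g Y" using tval_in[OF v] r(2,3) unfolding tval_def by blast+
  have "D v s" using s(1) unfolding fam_def by blast
  then obtain p0 where p0: "op v p0 a s" using op_exists M_Ds(1)[OF a(1)] by blast
  then have y: "pm v p0 y st" using st_iff[OF w0_le[OF v]] a(1) s by blast
  obtain u where u: "D v u" "prem v u s g" using prem_exists[OF v s(1) a(2)] by blast
  obtain x where x: "op v x y z" using op_exists pm_D(2)[OF y] op_D(3)[OF r(1)] by blast
  obtain c where c: "D v c" "upair v c x x" using upair_exists op_D(1)[OF x] by blast
  obtain q where "op v q u c" using op_exists u(1) c(1) by blast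
  then show thesis using rlI[OF r(1,2) p0 y _ x c(2) u(2)] that by blast
qed

lemma prem_unique:
  assumes "prem v u s g" "prem v u' s' g'" "E v s s'" "E v g g'" "D v u" "D v u'"
  shows "E v u u'"
proof (rule extensionality)
  show "M t x u \<longleftrightarrow> M t x u'" if t: "v \<sqsubseteq> t" for t x
  proof -
    have e: "E t s s'" "E t s' s" "E t g g'" "E t g' g" using assms(3,4) E_mono[OF _ t] E_sym by blast+
    have "pm t b y s \<longleftrightarrow> pm t b y s'" for b y
      using pm_cong[of t b y s b y s'] pm_cong[of t b y s' b y s] e E_refl pm_D by blast
    moreover have "pm t b y g \<longleftrightarrow> pm t b y g'" for b y
      using pm_cong[of t b y g b y g'] pm_cong[of t b y g' b y g] e E_refl pm_D by blast
    ultimately show ?thesis unfolding prem_iff[OF assms(1) t] prem_iff[OF assms(2) t] by simp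
  qed
qed (use assms in blast)+

text \<open>\<open>r\<close> determines \<open>a\<close>, \<open>g\<close> and \<open>z\<close>; the
  family \<open>s\<close> is recovered from the tree \<open>y\<close> by injectivity of
  \<open>sup\<close>.\<close>

lemma rl_unique:
  assumes v: "v0 \<sqsubseteq> v" and q: "rl v r y q" "rl v r y q'"
  shows "E v q q'"
proof -
  from q(1) obtain p z a g p0 s u c x where 1: "op v r p z" "op v p a g" "op v p0 a s" "pm v p0 y st"
    "op v q u c" "op v x y z" "upair v c x x" "prem v u s g" by (rule rlE)
  from q(2) obtain p' z' a' g' p0' s' u' c' x' where 2: "op v r p' z'" "op v p' a' g'" "op v p0' a' s'"
    "pm v p0' y st" "op v q' u' c'" "op v x' y z'" "upair v c' x' x'" "prem v u' s' g'" by (rule rlE)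
  have wv: "w0 \<sqsubseteq> v" using w0_le[OF v] .
  have pz: "E v p p'" "E v z z'" using op_inj[OF 1(1) 2(1)] .
  have "op v p' a g" using op_cong[OF 1(2) pz(1)] op_self[OF 1(2)] by blast
  then have ag: "E v a a'" "E v g g'" using op_inj 2(2) by blast+
  have "E v s s'" using sup_inj(2)[OF wv] st_iff[OF wv 1(3)] st_iff[OF wv 2(3)] 1(4) 2(4) by blast
  then have u: "E v u u'" using prem_unique[OF 1(8) 2(8) _ ag(2)] op_D(2)[OF 1(5)] op_D(2)[OF 2(5)] by blast
  have "op v x y z'" using op_cong[OF 1(6) _ _ pz(2)] op_self[OF 1(6)] by blast
  then have "E v x x'" using op_unique 2(6) by blast
  then have "upair v c x' x'" using upair_cong[OF _ _ _ 1(7)] E_refl op_D(3)[OF 1(5)] by blast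
  then have "E v c c'" using upair_unique 2(7) op_D(3)[OF 1(5)] op_D(3)[OF 2(5)] by blast
  then have "op v q u' c'" using op_cong[OF 1(5) _ u] op_self[OF 1(5)] by blast
  then show ?thesis using op_unique 2(5) by blast
qed

lemma rules_exist:
  obtains Q where "D v0 Q"
    "\<And>v q. v0 \<sqsubseteq> v \<Longrightarrow> D v q \<Longrightarrow> M v q Q \<longleftrightarrow> (\<exists>r. M v r th \<and> (\<exists>y. M v y W \<and> rl v r y q))"
proof -
  have DW: "D v W" "D v st" "D v z0" if "v0 \<sqsubseteq> v" for v
    using D_mono[OF W(1)] D_mono[OF st(1)] Ds(4) w0_le[OF that] by blast+
  let ?K = "\<lambda>v r q. \<exists>y. M v y W \<and> rl v r y q"
  show thesis
  proof (rule union_image[where ps = "[W, st]" and w = v0 and a = th and K = ?K and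
        F = "bex 0 (\<lambda>y. rl_form 3 y 4)"])
    fix pr v s r q
    have "fs pr (rl_form 3 5 4) v [W, st, s, r, q, y] \<longleftrightarrow> rl v r y q" for y
      using fs_rl_form[of "[W, st, s, r, q, y]" 3 5 4 pr v] by simp
    then show "fs pr (bex 0 (\<lambda>y. rl_form 3 y 4)) v ([W, st] @ [s, r, q]) \<longleftrightarrow> ?K v r q"
      by (simp add: numeral_eq_Suc)
  next
    fix v r assume v: "v0 \<sqsubseteq> v" and r: "M v r th"
    have wv: "w0 \<sqsubseteq> v" using w0_le[OF v] .
    obtain p z where pz: "M v p PY" "op v r p z" using fn_elem[OF fn_mono[OF th(2) v] r] by blast
    obtain a g where ag: "M v a A" "op v p a g" "fam v a g Y" using Pf_iff[OF PY(2) v] pz(1) by blast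
    \<comment> \<open>Only trees with the root label \<open>a\<close> given by \<open>r\<close>
      admit a rule. Restricting \<open>W\<close> to them first makes the assignment of rules total,
      as Replacement demands.\<close>
    obtain Wa where Wa: "D v Wa" "\<And>t y. v \<sqsubseteq> t \<Longrightarrow> M t y Wa \<longleftrightarrow> M t y W \<and> pm t a z0 y"
      by (rule separation[where ps = "[a, z0]" and w = v and a = W and F = "b_pm 0 1 2"])
        (use M_Ds(1)[OF ag(1)] DW[OF v] in auto)
    obtain s where s: "D v s" "\<And>t q. v \<sqsubseteq> t \<Longrightarrow> D t q \<Longrightarrow> M t q s \<longleftrightarrow> (\<exists>y. M t y Wa \<and> rl t r y q)"
    proof (rule image[where ps = "[W, st, r]" and w = v and a = Wa and K = "\<lambda>t y q. rl t r y q" and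
          F = "rl_form 2 4 3"])
      show "fs pr (rl_form 2 4 3) t ([W, st, r] @ [q, y]) \<longleftrightarrow> rl t r y q" for pr t y q
        using fs_rl_form[of "[W, st, r] @ [q, y]" 2 4 3 pr t] by simp
      show "\<exists>q. D t q \<and> rl t r y q" if t: "v \<sqsubseteq> t" and y: "M t y Wa" for t y
      proof -
        have vt: "v0 \<sqsubseteq> t" and wt: "w0 \<sqsubseteq> t" using le_trans v wv t by blast+
        have yW: "M t y W" "pm t a z0 y" using Wa(2)[OF t] y by blast+
        obtain a' s where s: "M t a' A" "fam t a' s W" "sup t y a' s" by (rule W_inv[OF wt yW(1)])
        have e: "E t a' a" using sup_root[OF wt s(2) trees_W[OF wt] s(3) yW(2)] E_sym by blast
        have s': "fam t a s W" "sup t y a s"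
          using fam_cong[OF s(2) e] sup_congs[OF s(3) e] s(2) E_refl unfolding fam_def by blast+
        obtain q where q: "rl t r y q"
          by (rule rl_exists[OF vt op_mono[OF pz(2) t] op_mono[OF ag(2) t]
                pm_mono[OF pmI[OF r pz(2)] t] s'])
        then have "D t q" by (rule rlE) (erule op_D(1))
        then show ?thesis using q by blast
      qed
      show "E t q q'" if "v \<sqsubseteq> t" "rl t r y q" "rl t r y q'" for t y q q'
        using rl_unique[OF le_trans[OF v that(1)] that(2,3)] .
    qed (use Wa(1) DW[OF v] M_Ds(1)[OF r] in auto)
    have "M t y Wa" if t: "v \<sqsubseteq> t" and y: "M t y W" "rl t r y q" for t y q
    proof -
      have wt: "w0 \<sqsubseteq> t" using le_trans wv t by blast
      from y(2) obtain p' z' a' g' p0 s where 1: "op t r p' z'" "op t p' a' g'" "op t p0 a' s"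
        "pm t p0 y st" by (rule rlE)
      have "E t p' p" using op_inj(1)[OF 1(1) op_mono[OF pz(2) t]] .
      then have "op t p a' g'" using op_cong[OF 1(2)] op_self[OF 1(2)] by blast
      then have e: "E t a' a" using op_inj(1)[OF _ op_mono[OF ag(2) t]] by blast
      have "pm t a' z0 y" using sup_rootI[OF wt] st_iff[OF wt 1(3)] 1(4) by blast
      then have "pm t a z0 y" using pm_cong[OF _ e] E_refl pm_D by blast
      then show ?thesis using Wa(2)[OF t] y(1) by blast
    qed
    then have "M t q s \<longleftrightarrow> ?K t r q" if "v \<sqsubseteq> t" "D t q" for t q
      using s(2)[OF that] Wa(2)[OF that(1)] that(1) by blast
    then show "\<exists>s. D v s \<and> (\<forall>u q. v \<sqsubseteq> u \<longrightarrow> D u q \<longrightarrow> (M u q s \<longleftrightarrow> ?K u r q))" using s(1) by blast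
  qed (use that th(1) DW[OF le_refl] in auto)
qed

text \<open>Closure under the rules \<open>rl\<close> with their coding removed: values of
  \<open>th\<close> are propagated from subtrees to trees.\<close>

definition recursive where
  "recursive v Z \<longleftrightarrow> (\<forall>t a s g y z. v \<sqsubseteq> t \<longrightarrow> fam t a s W \<longrightarrow> sup t y a s \<longrightarrow> tval t a g z \<longrightarrow>
     (\<forall>u b y' z'. t \<sqsubseteq> u \<longrightarrow> pm u b y' s \<longrightarrow> pm u b z' g \<longrightarrow> pm u y' z' Z) \<longrightarrow> pm t y z Z)"

text \<open>The conclusions are singletons, so \<open>least_closed\<close> yields the least
  recursive subset of the product of \<open>W\<close> and \<open>Y\<close>. Leastness is kept in the
  form used later: a recursive subset of \<rho> is all of \<rho>.\<close>

lemma graph_exists: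
  obtains \<rho> where "D v0 \<rho>"
    "\<And>v p. v0 \<sqsubseteq> v \<Longrightarrow> M v p \<rho> \<Longrightarrow> \<exists>y z. M v y W \<and> M v z Y \<and> op v p y z"
    "recursive v0 \<rho>"
    "\<And>v Z. v0 \<sqsubseteq> v \<Longrightarrow> D v Z \<Longrightarrow> sub v Z \<rho> \<Longrightarrow> recursive v Z \<Longrightarrow> sub v \<rho> Z"
proof -
  obtain Q where Q: "D v0 Q"
    "\<And>v q. v0 \<sqsubseteq> v \<Longrightarrow> D v q \<Longrightarrow> M v q Q \<longleftrightarrow> (\<exists>r. M v r th \<and> (\<exists>y. M v y W \<and> rl v r y q))"
    using rules_exist by blast
  obtain X2 where X2: "D v0 X2" "\<And>v p. v0 \<sqsubseteq> v \<Longrightarrow> M v p X2 \<longleftrightarrow> (\<exists>y z. M v y W \<and> M v z Y \<and> op v p y z)"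
    using product_exists[OF D_mono[OF W(1) v0] Y] by blast
  have ruleD: "\<exists>a g s y z x. fam v a s W \<and> sup v y a s \<and> tval v a g z \<and> op v x y z \<and> upair v c x x \<and>
      (\<forall>t x. v \<sqsubseteq> t \<longrightarrow> (M t x u \<longleftrightarrow> (\<exists>b y z. op t x y z \<and> pm t b y s \<and> pm t b z g)))"
    if v: "v0 \<sqsubseteq> v" and q: "M v q Q" "op v q u c" for v q u c
  proof -
    obtain r y where r: "M v r th" "M v y W" "rl v r y q" using Q(2)[OF v M_Ds(1)[OF q(1)]] q(1) by blast
    from r(3) obtain p z a g p0 s u' c' x where 1: "op v r p z" "op v p a g" "op v p0 a s" "pm v p0 y st"
      "op v q u' c'" "op v x y z" "upair v c' x x" "prem v u' s g" by (rule rlE)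
    have eq: "E v u' u" "E v c' c" using op_inj[OF 1(5) q(2)] .
    have "tval v a g z" using pmI[OF r(1) 1(1)] 1(2) unfolding tval_def by blast
    moreover have "fam v a s W" "sup v y a s" using st_iff[OF w0_le[OF v] 1(3)] 1(4) by blast+
    moreover have "upair v c x x" using upair_cong[OF eq(2) _ _ 1(7)] op_self[OF 1(6)] by blast
    moreover have "M t x u \<longleftrightarrow> (\<exists>b y z. op t x y z \<and> pm t b y s \<and> pm t b z g)" if "v \<sqsubseteq> t" for t x
      using prem_iff[OF 1(8) that] E_iff(1)[OF eq(1) that] by blast
    ultimately show ?thesis using 1(6) by blast
  qed
  have closed: "closed v Q Z \<longleftrightarrow> recursive v Z" if v: "v0 \<sqsubseteq> v" for v Z
  proof
    assume Z: "closed v Q Z"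
    show "recursive v Z" unfolding recursive_def
    proof (intro allI impI)
      fix t a s g y z assume t: "v \<sqsubseteq> t" and s: "fam t a s W" "sup t y a s" and z: "tval t a g z"
        and H: "\<forall>u b y' z'. t \<sqsubseteq> u \<longrightarrow> pm u b y' s \<longrightarrow> pm u b z' g \<longrightarrow> pm u y' z' Z"
      have vt: "v0 \<sqsubseteq> t" using le_trans[OF v t] .
      obtain p where p: "op t p a g" "pm t p z th" using z unfolding tval_def by blast
      obtain r where r: "M t r th" "op t r p z" using p(2) unfolding pm_def by blast
      obtain q where q: "rl t r y q" using rl_exists[OF vt r(2) p s] by blast
      have yW: "M t y W" using W_sup[OF w0_le[OF vt] tval_in(1)[OF vt z] s] .
      from q obtain p' z' a' g' p0 s' u c x where 1: "op t r p' z'" "op t p' a' g'" "op t p0 a' s'"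
        "pm t p0 y st" "op t q u c" "op t x y z'" "upair t c x x" "prem t u s' g'" by (rule rlE)
      have pz: "E t p' p" "E t z' z" using op_inj[OF 1(1) r(2)] .
      have "op t p a' g'" using op_cong[OF 1(2) pz(1)] op_self[OF 1(2)] by blast
      then have ag: "E t a' a" "E t g' g" using op_inj[OF _ p(1)] by blast+
      have ss: "E t s' s"
        using sup_inj(2)[OF w0_le[OF vt]] st_iff[OF w0_le[OF vt] 1(3)] 1(4) s tval_in(1)[OF vt z] by blast
      have "M t q Q" using Q(2)[OF vt op_D(1)[OF 1(5)]] r(1) yW q by blast
      then have "pm t u c Q" using 1(5) pmI by blast
      moreover have "sub t u Z" unfolding sub_def
      proof (intro allI impI)
        fix t' x' assume t': "t \<sqsubseteq> t'" and "M t' x' u"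
        then obtain b y1 z1 where x': "op t' x' y1 z1" "pm t' b y1 s'" "pm t' b z1 g'"
          using prem_iff[OF 1(8) t'] by blast
        have "pm t' b y1 s" using pm_cong[OF x'(2) _ _ E_mono[OF ss t']] E_refl pm_D[OF x'(2)] by blast
        moreover have "pm t' b z1 g"
          using pm_cong[OF x'(3) _ _ E_mono[OF ag(2) t']] E_refl pm_D[OF x'(3)] by blast
        ultimately have "pm t' y1 z1 Z" using H t' by blast
        then show "M t' x' Z" using pm_op[OF x'(1)] by blast
      qed
      ultimately obtain x' where x': "M t x' c" "M t x' Z" using closedD[OF closed_mono[OF Z t]] by blast
      have "E t x' x" using upairD[OF 1(7)] x'(1) by blast
      then have "M t x Z" using x'(2) E_iff(2)[OF _ le_refl] by blast
      then have "pm t y z' Z" using 1(6) pmI by blast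
      then show "pm t y z Z" using pm_cong[OF _ _ pz(2)] E_refl pm_D by blast
    qed
  next
    assume Z: "recursive v Z"
    show "closed v Q Z" unfolding closed_def
    proof (intro allI impI)
      fix t u c assume t: "v \<sqsubseteq> t" and uc: "pm t u c Q" and uZ: "sub t u Z"
      have vt: "v0 \<sqsubseteq> t" using le_trans[OF v t] .
      obtain q where q: "M t q Q" "op t q u c" using uc unfolding pm_def by blast
      obtain a g s y z x where 1: "fam t a s W" "sup t y a s" "tval t a g z" "op t x y z" "upair t c x x"
        "\<And>t' x. t \<sqsubseteq> t' \<Longrightarrow> M t' x u \<longleftrightarrow> (\<exists>b y z. op t' x y z \<and> pm t' b y s \<and> pm t' b z g)"
        using ruleD[OF vt q] by blast
      have "pm u' y' z' Z" if u': "t \<sqsubseteq> u'" and b: "pm u' b y' s" "pm u' b z' g" for u' b y' z'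
      proof -
        obtain x' where x': "op u' x' y' z'" using op_exists pm_D(2)[OF b(1)] pm_D(2)[OF b(2)] by blast
        then have "M u' x' u" using 1(6)[OF u'] b by blast
        then have "M u' x' Z" using uZ u' unfolding sub_def by blast
        then show ?thesis using x' pmI by blast
      qed
      then have "pm t y z Z" using Z t 1(1-3) unfolding recursive_def by blast
      then have "M t x Z" using pm_op[OF 1(4)] by blast
      moreover have "M t x c" using upairD[OF 1(5)] E_refl op_D(1)[OF 1(4)] by blast
      ultimately show "\<exists>z. M t z c \<and> M t z Z" by blast
    qed
  qed
  have rules: "rule_set v0 Q X2" unfolding rule_set_def
  proof (intro allI impI)
    fix v q assume v: "v0 \<sqsubseteq> v" and q: "M v q Q"
    have wv: "w0 \<sqsubseteq> v" using w0_le[OF v] .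
    obtain r y where "rl v r y q" using Q(2)[OF v M_Ds(1)[OF q]] q by blast
    then obtain u c where uc: "op v q u c" by (rule rlE)
    obtain a g s y z x where 1: "fam v a s W" "sup v y a s" "tval v a g z" "op v x y z" "upair v c x x"
      "\<And>t' x. v \<sqsubseteq> t' \<Longrightarrow> M t' x u \<longleftrightarrow> (\<exists>b y z. op t' x y z \<and> pm t' b y s \<and> pm t' b z g)"
      using ruleD[OF v q uc] by blast
    have "sub v u X2" unfolding sub_def
    proof (intro allI impI)
      fix t x assume t: "v \<sqsubseteq> t" and "M t x u"
      then obtain b y z where x: "op t x y z" "pm t b y s" "pm t b z g" using 1(6) by blast
      have "M t y W" "M t z Y"
        using fam_in(2)[OF fam_mono[OF 1(1) t] x(2)] fam_in(2)[OF fam_mono[OF tval_in(2)[OF v 1(3)] t] x(3)] .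
      then show "M t x X2" using X2(2)[OF le_trans[OF v t]] x(1) by blast
    qed
    moreover have "sub v c X2" unfolding sub_def
    proof (intro allI impI)
      fix t x' assume t: "v \<sqsubseteq> t" and "M t x' c"
      then have e: "E t x' x" using upairD[OF upair_mono[OF 1(5) t]] by blast
      have "M v y W" "M v z Y" using W_sup[OF wv tval_in(1)[OF v 1(3)] 1(1,2)] tval_in(3)[OF v 1(3)] .
      then have "M v x X2" using X2(2)[OF v] 1(4) by blast
      then show "M t x' X2" using M_mono t E_iff(2)[OF e le_refl] by blast
    qed
    ultimately show "\<exists>a b. op v q a b \<and> sub v a X2 \<and> sub v b X2" using uc by blast
  qed
  have single: "\<exists>x. D v x \<and> upair v c x x" if v: "v0 \<sqsubseteq> v" and uc: "pm v u c Q" for v u c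
  proof -
    obtain q where "M v q Q" "op v q u c" using uc unfolding pm_def by blast
    then show ?thesis using ruleD[OF v] op_D(1) by meson
  qed
  obtain \<rho> where \<rho>: "D v0 \<rho>" "sub v0 \<rho> X2" "closed v0 Q \<rho>"
    "\<And>v Z. v0 \<sqsubseteq> v \<Longrightarrow> D v Z \<Longrightarrow> sub v Z X2 \<Longrightarrow> closed v Q Z \<Longrightarrow> sub v \<rho> Z"
    by (rule least_closed[OF X2(1) Q(1) rules], erule (1) single, blast)
  show thesis
  proof (rule that[OF \<rho>(1)])
    show "\<exists>y z. M v y W \<and> M v z Y \<and> op v p y z" if "v0 \<sqsubseteq> v" "M v p \<rho>" for v p
      using \<rho>(2) X2(2)[OF that(1)] that unfolding sub_def by blast
    show "recursive v0 \<rho>" using closed[OF le_refl] \<rho>(3) by blast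
    show "sub v \<rho> Z" if "v0 \<sqsubseteq> v" "D v Z" "sub v Z \<rho>" "recursive v Z" for v Z
      using \<rho>(4)[OF that(1,2)] closed[OF that(1)] that(4) sub_trans[OF that(3) sub_mono[OF \<rho>(2) that(1)]]
      by blast
  qed
qed

section \<open>The generated graph is a function\<close>

definition rec_graph where
  "rec_graph \<rho> \<longleftrightarrow> D v0 \<rho> \<and> fn v0 \<rho> W Y \<and> recursive v0 \<rho>"

text \<open>\<rho> is assumed total and functional over \<open>Z\<close> only. This lets the
  composite be formed inside an induction, before \<rho> is known to be a function on all of
  \<open>W\<close>.\<close>

lemma comp_fam:
  assumes v: "v0 \<sqsubseteq> v" and \<rho>: "D v \<rho>" "\<And>t y. v \<sqsubseteq> t \<Longrightarrow> M t y Z \<Longrightarrow> \<exists>z. pm t y z \<rho>"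
    "\<And>t y z z'. v \<sqsubseteq> t \<Longrightarrow> M t y Z \<Longrightarrow> pm t y z \<rho> \<Longrightarrow> pm t y z' \<rho> \<Longrightarrow> E t z z'"
    "\<And>t y z. v \<sqsubseteq> t \<Longrightarrow> pm t y z \<rho> \<Longrightarrow> M t z Y"
    and s: "fam v a s Z"
  obtains g where "comp v g \<rho> s" "fam v a g Y"
proof -
  have Ds': "D v s" using s unfolding fam_def by blast
  obtain g where g: "D v g" "comp v g \<rho> s"
  proof (rule comp_exists[OF \<rho>(1) Ds'])
    show "\<exists>x y z. op t p x y \<and> pm t y z \<rho>" if t: "v \<sqsubseteq> t" and p: "M t p s" for t p
    proof -
      obtain b y where b: "M t y Z" "op t p b y" using s t p unfolding fam_def by blast
      then show ?thesis using \<rho>(2)[OF t b(1)] by blast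
    qed
    show "E t z z'" if t: "v \<sqsubseteq> t" and x: "pm t x y s" "pm t y z \<rho>" "pm t y z' \<rho>" for t x y z z'
      using \<rho>(3)[OF t fam_in(2)[OF fam_mono[OF s t] x(1)] x(2,3)] .
  qed blast
  have "fam v a g Y" unfolding fam_def
  proof (intro conjI allI impI)
    show "D v g" by (rule g(1))
    fix t assume t: "v \<sqsubseteq> t"
    note st = fam_mono[OF s t] and gt = comp_mono[OF g(2) t]
    show "\<exists>b y. pm t b a f \<and> M t y Y \<and> op t p b y" if p: "M t p g" for p
    proof -
      obtain b y z where b: "op t p b z" "pm t b y s" "pm t y z \<rho>"
        using comp_iff[OF gt M_Ds(1)[OF p]] p by blast
      then show ?thesis using fam_in(1)[OF st b(2)] \<rho>(4)[OF t b(3)] by blast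
    qed
    show "\<exists>z. pm t b z g" if b: "pm t b a f" for b
      using fam_ex[OF st b] fam_in(2)[OF st] \<rho>(2)[OF t] unfolding comp_pm[OF gt] by blast
    show "E t z z'" if z: "pm t b z g" "pm t b z' g" for b z z'
    proof -
      obtain y y' where y: "pm t b y s" "pm t y z \<rho>" "pm t b y' s" "pm t y' z' \<rho>"
        using z unfolding comp_pm[OF gt] by blast
      have "E t y' y" using fam_unique[OF st y(3,1)] .
      then have "pm t y z' \<rho>" using pm_cong[OF y(4)] E_refl pm_D[OF y(4)] by blast
      then show ?thesis using \<rho>(3)[OF t fam_in(2)[OF st y(1)] y(2)] by blast
    qed
  qed
  then show thesis using that g(2) by blast
qed

text \<open>Induction over the trees with exactly one value. At a tree built from (a, s) the
  composite g of \<rho> with s gives the value z of \<open>th\<close> at (a, g). For uniqueness,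
  \<rho> is shrunk to the pairs that agree with this value; the result is still recursive and hence
  equals \<rho>.\<close>

lemma rec_graph_exists:
  obtains \<rho> where "D v0 \<rho>" "fn v0 \<rho> W Y" "recursive v0 \<rho>"
proof -
  obtain \<rho> where \<rho>: "D v0 \<rho>"
    "\<And>v p. v0 \<sqsubseteq> v \<Longrightarrow> M v p \<rho> \<Longrightarrow> \<exists>y z. M v y W \<and> M v z Y \<and> op v p y z"
    "recursive v0 \<rho>"
    "\<And>v Z. v0 \<sqsubseteq> v \<Longrightarrow> D v Z \<Longrightarrow> sub v Z \<rho> \<Longrightarrow> recursive v Z \<Longrightarrow> sub v \<rho> Z"
    using graph_exists by blast
  have \<rho>in: "M v y W" "M v z Y" if v: "v0 \<sqsubseteq> v" and yz: "pm v y z \<rho>" for v y z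
  proof -
    obtain p where p: "M v p \<rho>" "op v p y z" using yz unfolding pm_def by blast
    obtain y' z' where y': "M v y' W" "M v z' Y" "op v p y' z'" using \<rho>(2)[OF v p(1)] by blast
    have "E v y' y" "E v z' z" using op_inj[OF y'(3) p(2)] .
    then show "M v y W" "M v z Y" using y' E_iff(2)[OF _ le_refl] by blast+
  qed
  let ?K = "\<lambda>v y. \<exists>z. M v z Y \<and> pm v y z \<rho> \<and>
    (\<forall>t. v \<sqsubseteq> t \<longrightarrow> (\<forall>z'. M t z' Y \<longrightarrow> (\<forall>u. t \<sqsubseteq> u \<longrightarrow> pm u y z' \<rho> \<longrightarrow> E u z' z)))"
  \<comment> \<open>Existence and uniqueness of a value are bounded conditions because values lie in
    \<open>Y\<close>.\<close>
  obtain Z where Z: "D v0 Z" "\<And>v y. v0 \<sqsubseteq> v \<Longrightarrow> M v y Z \<longleftrightarrow> M v y W \<and> ?K v y"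
    by (rule separation[where ps = "[Y, \<rho>]" and w = v0 and a = W and K = ?K and
        F = "bex 0 (\<lambda>z. b_pm 2 z 1 \<^bold>\<and> ball 0 (\<lambda>z'. b_pm 2 z' 1 \<^bold>\<longrightarrow> z' \<^bold>= z))"])
      (use Y \<rho>(1) D_mono[OF W(1) v0] in auto)
  have ZW: "sub v0 Z W" unfolding sub_def using Z(2) by blast
  have Zex: "\<exists>z. pm v y z \<rho>" if "v0 \<sqsubseteq> v" "M v y Z" for v y
    using Z(2)[OF that(1)] that(2) by blast
  have Zuniq: "E v z z'" if v: "v0 \<sqsubseteq> v" and y: "M v y Z" "pm v y z \<rho>" "pm v y z' \<rho>" for v y z z'
  proof -
    obtain c where "\<forall>t. v \<sqsubseteq> t \<longrightarrow> (\<forall>z'. M t z' Y \<longrightarrow> (\<forall>u. t \<sqsubseteq> u \<longrightarrow> pm u y z' \<rho> \<longrightarrow> E u z' c))"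
      using Z(2)[OF v] y(1) by blast
    then have "E v z c" "E v z' c" using le_refl[of v] \<rho>in(2)[OF v] y(2,3) by blast+
    then show ?thesis using E_sym E_trans by blast
  qed
  have "sub v0 W Z"
  proof (rule W_induct[OF v0 Z(1) ZW])
    fix v y a s assume v: "v0 \<sqsubseteq> v" and a: "M v a A" "fam v a s Z" "sup v y a s"
    have wv: "w0 \<sqsubseteq> v" using w0_le[OF v] .
    have sW: "fam v a s W" using fam_sub[OF a(2) sub_mono[OF ZW v]] .
    have yW: "M v y W" using W_sup[OF wv a(1) sW a(3)] .
    obtain g where g: "comp v g \<rho> s" "fam v a g Y"
    proof (rule comp_fam[OF v D_mono[OF \<rho>(1) v] _ _ _ a(2)])
      show "\<exists>z. pm t y z \<rho>" if "v \<sqsubseteq> t" "M t y Z" for t y using Zex le_trans[OF v] that by blast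
      show "E t z z'" if "v \<sqsubseteq> t" "M t y Z" "pm t y z \<rho>" "pm t y z' \<rho>" for t y z z'
        using Zuniq[OF le_trans[OF v that(1)] that(2-4)] .
      show "M t z Y" if "v \<sqsubseteq> t" "pm t y z \<rho>" for t y z using \<rho>in(2)[OF le_trans[OF v that(1)] that(2)] .
    qed blast
    obtain z where z: "tval v a g z" using tval_ex[OF v a(1) g(2)] by blast
    have "pm u y' z' \<rho>" if u: "v \<sqsubseteq> u" and b: "pm u b y' s" "pm u b z' g" for u b y' z'
    proof -
      obtain y1 where y1: "pm u b y1 s" "pm u y1 z' \<rho>" using b(2) unfolding comp_pm[OF comp_mono[OF g(1) u]] by blast
      have "E u y1 y'" using fam_unique[OF fam_mono[OF a(2) u] y1(1) b(1)] .
      then show ?thesis using pm_cong[OF y1(2)] E_refl pm_D[OF y1(2)] by blast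
    qed
    then have yz: "pm v y z \<rho>" using \<rho>(3) v sW a(3) z unfolding recursive_def by blast
    have uniq: "E t z' z" if t: "v \<sqsubseteq> t" and z': "pm t y z' \<rho>" for t z'
    proof -
      have vt: "v0 \<sqsubseteq> t" and wt: "w0 \<sqsubseteq> t" using le_trans[OF v t] le_trans[OF wv t] .
      have zt: "tval t a g z" using tval_mono[OF z t] .
      let ?L = "\<lambda>u p. \<forall>u1. u \<sqsubseteq> u1 \<longrightarrow> (\<forall>c. M u1 c Y \<longrightarrow> (\<forall>u2. u1 \<sqsubseteq> u2 \<longrightarrow> op u2 p y c \<longrightarrow> E u2 c z))"
      have Dt: "D t \<rho>" "D t y" "D t z" "D t Y"
        using D_mono[OF \<rho>(1) vt] pm_D(1)[OF z'] M_Ds[OF tval_in(3)[OF vt zt]] by blast+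
      \<comment> \<open>Kept are those elements of \<rho> for which being a pair (y, c) implies that
        c is z. The implication replaces a decision whether the first component is
        \<open>y\<close>.\<close>
      obtain \<rho>' where \<rho>': "D t \<rho>'" "\<And>u p. t \<sqsubseteq> u \<Longrightarrow> M u p \<rho>' \<longleftrightarrow> M u p \<rho> \<and> ?L u p"
        by (rule separation[where ps = "[Y, y, z]" and w = t and a = \<rho> and K = ?L and
            F = "ball 0 (\<lambda>c. b_pair 3 1 c \<^bold>\<longrightarrow> c \<^bold>= 2)"]) (use Dt in auto)
      have \<rho>'\<rho>: "pm u i j \<rho>" if "t \<sqsubseteq> u" "pm u i j \<rho>'" for u i j
        using that \<rho>'(2) unfolding pm_def by blast
      have "recursive t \<rho>'" unfolding recursive_def
      proof (intro allI impI)
        fix t1 a' s' g' y' c assume t1: "t \<sqsubseteq> t1" and s': "fam t1 a' s' W" "sup t1 y' a' s'"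
          and c: "tval t1 a' g' c"
          and H: "\<forall>u b i j. t1 \<sqsubseteq> u \<longrightarrow> pm u b i s' \<longrightarrow> pm u b j g' \<longrightarrow> pm u i j \<rho>'"
        have vt1: "v \<sqsubseteq> t1" using le_trans[OF t t1] .
        have v0t1: "v0 \<sqsubseteq> t1" and wt1: "w0 \<sqsubseteq> t1" using le_trans[OF vt t1] le_trans[OF wt t1] .
        have Hr: "pm u i j \<rho>" if "t1 \<sqsubseteq> u" "pm u b i s'" "pm u b j g'" for u b i j
          using H \<rho>'\<rho>[OF le_trans[OF t1 that(1)]] that by blast
        then have yc: "pm t1 y' c \<rho>" using \<rho>(3) v0t1 s' c unfolding recursive_def by blast
        then obtain p where p: "M t1 p \<rho>" "op t1 p y' c" unfolding pm_def by blast
        have "E u c' z" if u: "t1 \<sqsubseteq> u" and c': "op u p y c'" for u c'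
        proof -
          have vu: "v \<sqsubseteq> u" and v0u: "v0 \<sqsubseteq> u" and wu: "w0 \<sqsubseteq> u"
            using le_trans[OF vt1 u] le_trans[OF v0t1 u] le_trans[OF wt1 u] .
          have eq: "E u y' y" "E u c c'" using op_inj[OF op_mono[OF p(2) u] c'] .
          note s'u = fam_mono[OF s'(1) u] and cu = tval_mono[OF c u] and zu = tval_mono[OF z vu]
          \<comment> \<open>A rule instance that concludes something about \<open>y\<close> must
            come from the same label and the same subtrees.\<close>
          have inj: "E u a' a" "E u s' s"
            using sup_inj[OF wu tval_in(1)[OF v0u cu] s'u sup_cong[OF sup_mono[OF s'(2) u] eq(1)]
                tval_in(1)[OF v0u zu] fam_mono[OF sW vu] sup_mono[OF a(3) vu]] .
          have g'u: "fam u a' g' Y" using tval_in(2)[OF v0u cu] .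
          \<comment> \<open>The premises put (s' b, g' b) into \<rho>; since s' and s agree, each
            pair of g' belongs to the composite g.\<close>
          have sub1: "M u1 q g" if u1: "u \<sqsubseteq> u1" and q: "M u1 q g'" for u1 q
          proof -
            have vu1: "v \<sqsubseteq> u1" and v0u1: "v0 \<sqsubseteq> u1" and t1u1: "t1 \<sqsubseteq> u1"
              using le_trans[OF vu u1] le_trans[OF v0u u1] le_trans[OF u u1] .
            obtain b j where b: "pm u1 b a' f" "op u1 q b j" using g'u u1 q unfolding fam_def by blast
            have bj: "pm u1 b j g'" using q b(2) pmI by blast
            obtain i where i: "pm u1 b i s'" using fam_ex[OF fam_mono[OF s'u u1] b(1)] by blast
            have "pm u1 b i s" using pm_cong[OF i _ _ E_mono[OF inj(2) u1]] E_refl pm_D[OF i] by blast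
            moreover have "pm u1 i j \<rho>" using Hr[OF t1u1 i bj] .
            ultimately have "pm u1 b j g" using comp_pm[OF comp_mono[OF g(1) vu1]] by blast
            then show ?thesis using pm_op[OF b(2)] by blast
          qed
          \<comment> \<open>Conversely g' is total on the fibre and contained in g, which is
            functional.\<close>
          have sub2: "M u1 q g'" if u1: "u \<sqsubseteq> u1" and q: "M u1 q g" for u1 q
          proof -
            have vu1: "v \<sqsubseteq> u1" using le_trans[OF vu u1] .
            obtain b j where b: "pm u1 b a f" "op u1 q b j"
              using g(2) vu1 q unfolding fam_def by blast
            have "pm u1 b a' f" using pm_cong[OF b(1) _ E_sym[OF E_mono[OF inj(1) u1]]] E_refl pm_D[OF b(1)] by blast
            then obtain j' where j': "pm u1 b j' g'" using fam_ex[OF fam_mono[OF g'u u1]] by blast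
            then obtain q' where q': "M u1 q' g'" "op u1 q' b j'" unfolding pm_def by blast
            have "pm u1 b j' g" using pmI[OF sub1[OF u1 q'(1)] q'(2)] .
            then have "E u1 j j'" using fam_unique[OF fam_mono[OF g(2) vu1] pmI[OF q b(2)]] by blast
            then have "op u1 q b j'" using op_cong[OF b(2)] op_self[OF b(2)] by blast
            then show ?thesis using j' pm_op by blast
          qed
          have "E u g' g"
            by (rule extensionality) (use sub1 sub2 g'u fam_mono[OF g(2) vu] in \<open>unfold fam_def, blast+\<close>)
          then have "E u c z" using tval_unique[OF v0u cu zu inj(1)] by blast
          then show ?thesis using eq(2) E_sym E_trans by blast
        qed
        then have "?L t1 p" using le_trans by blast
        then have "M t1 p \<rho>'" using \<rho>'(2)[OF t1] p(1) by blast
        then show "pm t1 y' c \<rho>'" using p(2) pmI by blast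
      qed
      moreover have "sub t \<rho>' \<rho>" unfolding sub_def using \<rho>'(2) by blast
      ultimately have "sub t \<rho> \<rho>'" using \<rho>(4)[OF vt \<rho>'(1)] by blast
      moreover obtain p where p: "M t p \<rho>" "op t p y z'" using z' unfolding pm_def by blast
      ultimately have "M t p \<rho>'" using subD by blast
      then show ?thesis using \<rho>'(2)[OF le_refl] p(2) \<rho>in(2)[OF vt z'] le_refl[of t] by blast
    qed
    have "?K v y" using tval_in(3)[OF v z] yz uniq le_trans by blast
    then show "M v y Z" using Z(2)[OF v] yW by blast
  qed
  then have WZ: "M v y Z" if "v0 \<sqsubseteq> v" "M v y W" for v y using that unfolding sub_def by blast
  have "fn v0 \<rho> W Y"
  proof (rule fnI)
    show "\<exists>y z. M v y W \<and> M v z Y \<and> op v p y z" if "v0 \<sqsubseteq> v" "M v p \<rho>" for v p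
      using \<rho>(2)[OF that] .
    show "\<exists>z. pm v y z \<rho>" if "v0 \<sqsubseteq> v" "M v y W" for v y using Zex WZ that by blast
    show "E v z z'" if v: "v0 \<sqsubseteq> v" and z: "pm v y z \<rho>" "pm v y z' \<rho>" for v y z z'
      using Zuniq[OF v WZ[OF v \<rho>in(1)[OF v z(1)]] z] .
  qed
  then show thesis using that \<rho>(1,3) by blast
qed

lemma comp_fam_fn:
  assumes v: "v0 \<sqsubseteq> v" and \<rho>: "D v \<rho>" "fn v \<rho> W Y" and s: "fam v a s W"
  obtains g where "comp v g \<rho> s" "fam v a g Y"
proof (rule comp_fam[OF v \<rho>(1) _ _ _ s])
  show "\<exists>z. pm t y z \<rho>" if "v \<sqsubseteq> t" "M t y W" for t y using fn_ex[OF fn_mono[OF \<rho>(2) that(1)] that(2)] .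
  show "E t z z'" if "v \<sqsubseteq> t" "pm t y z \<rho>" "pm t y z' \<rho>" for t y z z'
    using fn_unique[OF fn_mono[OF \<rho>(2) that(1)] that(2,3)] .
  show "M t z Y" if "v \<sqsubseteq> t" "pm t y z \<rho>" for t y z using fn_in(2)[OF fn_mono[OF \<rho>(2) that(1)] that(2)] .
qed (rule that)

text \<open>The computation rule: the value at the tree of (a, s) is \<open>th\<close> applied to
  \<open>a\<close> and the composite of \<rho> with s.\<close>

lemma recursive_value:
  assumes v: "v0 \<sqsubseteq> v" and \<rho>: "recursive v \<rho>" "fn v \<rho> W Y" and s: "fam v a s W" "sup v y a s"
    and g: "comp v g \<rho> s" "tval v a g z"
  shows "pm v y z \<rho>"
proof -
  have "pm u y' z' \<rho>" if u: "v \<sqsubseteq> u" and b: "pm u b y' s" "pm u b z' g" for u b y' z'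
  proof -
    obtain y1 where y1: "pm u b y1 s" "pm u y1 z' \<rho>" using b(2) unfolding comp_pm[OF comp_mono[OF g(1) u]] by blast
    have "E u y1 y'" using fam_unique[OF fam_mono[OF s(1) u] y1(1) b(1)] .
    then show ?thesis using pm_cong[OF y1(2)] E_refl pm_D[OF y1(2)] by blast
  qed
  then show ?thesis using \<rho>(1) le_refl[of v] s g(2) unfolding recursive_def by blast
qed

end

section \<open>Initiality\<close>

context czf
begin

lemma comp_cong:
  assumes "comp v h g k" "E v k k'"
  shows "comp v h g k'"
proof -
  have "pm t x y k \<longleftrightarrow> pm t x y k'" if "v \<sqsubseteq> t" for t x y
    using pm_cong[of t x y k x y k'] pm_cong[of t x y k' x y k] E_mono[OF assms(2) that] E_sym E_refl pm_D
    by blast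
  then show ?thesis using assms(1) unfolding comp_def by simp
qed

lemma comp_unique:
  assumes "comp v h g k" "comp v h' g k" "D v h" "D v h'"
  shows "E v h h'"
proof (rule extensionality)
  show "M t p h \<longleftrightarrow> M t p h'" if "v \<sqsubseteq> t" for t p
    using comp_iff[OF comp_mono[OF assms(1) that], of p] comp_iff[OF comp_mono[OF assms(2) that], of p]
      M_Ds(1)[of t p h] M_Ds(1)[of t p h'] by blast
qed (use assms in blast)+

end

context family
begin

lemma Pf_map_pm:
  assumes v: "w0 \<sqsubseteq> v" and m: "Pf_map v m \<alpha> Y"
  shows "pm v u x m \<longleftrightarrow> (\<exists>a s s'. M v a A \<and> op v u a s \<and> fam v a s Y \<and> op v x a s' \<and> comp v s' \<alpha> s)"
proof -
  obtain P where P: "Pf v P Y" "\<And>q. D v q \<Longrightarrow> M v q m \<longleftrightarrow> map_pair v \<alpha> P q"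
    using m le_refl[of v] unfolding Pf_map_def by blast
  show ?thesis
  proof
    assume "pm v u x m"
    then obtain q where q: "M v q m" "op v q u x" unfolding pm_def by blast
    then obtain u' x' a s s' where 1: "op v q u' x'" "M v u' P" "op v u' a s" "op v x' a s'" "comp v s' \<alpha> s"
      using P(2)[OF M_Ds(1)[OF q(1)]] unfolding map_pair_iff by blast
    have eq: "E v u' u" "E v x' x" using op_inj[OF 1(1) q(2)] .
    have "op v u a s" "op v x a s'" using op_cong[OF 1(3) eq(1)] op_cong[OF 1(4) eq(2)] op_self 1(3,4) by blast+
    then show "\<exists>a s s'. M v a A \<and> op v u a s \<and> fam v a s Y \<and> op v x a s' \<and> comp v s' \<alpha> s"
      using Pf_pair[OF P(1) le_refl 1(3)] 1(2,5) by blast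
  next
    assume "\<exists>a s s'. M v a A \<and> op v u a s \<and> fam v a s Y \<and> op v x a s' \<and> comp v s' \<alpha> s"
    then obtain a s s' where 1: "M v a A" "op v u a s" "fam v a s Y" "op v x a s'" "comp v s' \<alpha> s" by blast
    have u: "M v u P" using Pf_pair[OF P(1) le_refl 1(2)] 1 by blast
    obtain q where q: "op v q u x" using op_exists op_D(1)[OF 1(2)] op_D(1)[OF 1(4)] by blast
    have "map_pair v \<alpha> P q" using q u 1(2,4,5) unfolding map_pair_iff by blast
    then have "M v q m" using P(2)[OF op_D(1)[OF q]] by blast
    then show "pm v u x m" using q pmI by blast
  qed
qed

lemma Pf_map_mono: assumes "Pf_map u m \<alpha> Y" "u \<sqsubseteq> v" shows "Pf_map v m \<alpha> Y"
  using assms(1) D_mono[OF _ assms(2)] Pf_mono[OF _ assms(2)] le_trans[OF assms(2)]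
  unfolding Pf_map_def by meson

end

context recursion
begin

text \<open>The functor's action on \<rho> is an image of \<open>P\<close>. Both composites send (a,
  s) to the same element: along \<open>st\<close> this is the value of \<rho> at the tree of (a, s),
  and \<open>recursive_value\<close> identifies it with \<open>th\<close> at (a, \<rho> after
  s).\<close>

lemma morphism_exists:
  assumes \<rho>: "D v0 \<rho>" "fn v0 \<rho> W Y" "recursive v0 \<rho>"
  shows "morphism v0 \<rho> W st Y th"
proof -
  \<comment> \<open>An element \<open>u\<close> = (a, s) is sent to the pair of \<open>u\<close>
    with (a, \<rho> after s), an element of the graph of the functor's action on \<rho>.\<close>
  define K where "K v u q \<longleftrightarrow> (\<exists>x. D v x \<and> (\<exists>a. D v a \<and> (\<exists>s. D v s \<and> (\<exists>s'. D v s' \<and>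
    op v q u x \<and> op v u a s \<and> op v x a s' \<and> comp v s' \<rho> s))))" for v u q
  have K_iff: "K v u q \<longleftrightarrow> (\<exists>x a s s'. op v q u x \<and> op v u a s \<and> op v x a s' \<and> comp v s' \<rho> s)" for v u q
    unfolding K_def using op_D by meson
  have Pel: "\<exists>a s. M v a A \<and> op v u a s \<and> fam v a s W" if v: "v0 \<sqsubseteq> v" and u: "M v u P" for v u
    using Pf_iff[OF P(2) w0_le[OF v]] u by blast
  have \<rho>v: "D v \<rho>" "fn v \<rho> W Y" "recursive v \<rho>" if v: "v0 \<sqsubseteq> v" for v
    using D_mono[OF \<rho>(1) v] fn_mono[OF \<rho>(2) v] \<rho>(3) le_trans[OF v] unfolding recursive_def by blast+
  obtain m where m: "D v0 m" "\<And>v q. v0 \<sqsubseteq> v \<Longrightarrow> D v q \<Longrightarrow> M v q m \<longleftrightarrow> (\<exists>u. M v u P \<and> K v u q)"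
  proof (rule image[where ps = "[\<rho>]" and w = v0 and a = P and K = K and
        F = "\<^bold>\<exists>x. \<^bold>\<exists>a. \<^bold>\<exists>s. \<^bold>\<exists>s'. b_pair 1 2 x \<^bold>\<and> b_pair 2 a s \<^bold>\<and> b_pair x a s' \<^bold>\<and> is_composite s' 0 s"])
    fix v u assume v: "v0 \<sqsubseteq> v" and u: "M v u P"
    obtain a s where a: "M v a A" "op v u a s" "fam v a s W" using Pel[OF v u] by blast
    obtain s' where s': "comp v s' \<rho> s" "fam v a s' Y" using comp_fam_fn[OF v \<rho>v(1,2)[OF v] a(3)] by blast
    have Ds': "D v s'" using s'(2) unfolding fam_def by blast
    obtain x where x: "op v x a s'" using op_exists M_Ds(1)[OF a(1)] Ds' by blast
    obtain q where q: "op v q u x" using op_exists M_Ds(1)[OF u] op_D(1)[OF x] by blast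
    have "K v u q" unfolding K_iff
      by (rule exI[of _ x], rule exI[of _ a], rule exI[of _ s], rule exI[of _ s']) (intro conjI q a(2) x s'(1))
    then show "\<exists>q. D v q \<and> K v u q" using op_D(1)[OF q] by (intro exI conjI)
  next
    fix v u q q' assume v: "v0 \<sqsubseteq> v" and q: "K v u q" "K v u q'"
    from q[unfolded K_iff] obtain x a s s' x2 a2 s2 s2' where
      1: "op v q u x" "op v u a s" "op v x a s'" "comp v s' \<rho> s" and
      2: "op v q' u x2" "op v u a2 s2" "op v x2 a2 s2'" "comp v s2' \<rho> s2" by blast
    have e: "E v a a2" "E v s s2" using op_inj[OF 1(2) 2(2)] .
    have "E v s' s2'" using comp_unique[OF comp_cong[OF 1(4) e(2)] 2(4)] op_D(3)[OF 1(3)] op_D(3)[OF 2(3)] by blast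
    then have "op v x a2 s2'" using op_cong[OF 1(3) _ e(1)] op_self[OF 1(3)] by blast
    then have "E v x x2" using op_unique 2(3) by blast
    then have "op v q u x2" using op_cong[OF 1(1)] op_self[OF 1(1)] by blast
    then show "E v q q'" using op_unique 2(1) by blast
  next
    show "\<forall>p\<in>set [\<rho>]. D v0 p" using \<rho>(1) by simp
    show "D v0 P" using D_mono[OF P(1) v0] .
  qed (simp_all add: fs_is_composite K_def)
  have mP: "Pf_map v0 m \<rho> W" unfolding Pf_map_def
  proof (rule exI[of _ P], intro conjI allI impI)
    show "D v0 P" using D_mono[OF P(1) v0] .
    show "Pf v0 P W" using Pf_mono[OF P(2) v0] .
    fix t q assume t: "v0 \<sqsubseteq> t" and q: "D t q"
    show "M t q m \<longleftrightarrow> map_pair t \<rho> P q"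
      unfolding m(2)[OF t q] K_iff map_pair_iff
      by (intro iffI; elim exE conjE; intro exI conjI; assumption)
  qed
  obtain h where h: "D v0 h" "comp v0 h \<rho> st"
  proof (rule comp_exists[OF \<rho>(1) D_mono[OF st(1) v0]])
    show "\<exists>x y z. op t p x y \<and> pm t y z \<rho>" if t: "v0 \<sqsubseteq> t" and p: "M t p st" for t p
    proof -
      obtain x y where xy: "M t y W" "op t p x y" using fn_elem[OF fn_mono[OF st(2) w0_le[OF t]] p] by blast
      then show ?thesis using fn_ex[OF \<rho>v(2)[OF t] xy(1)] by blast
    qed
    show "E t z z'" if "v0 \<sqsubseteq> t" "pm t y z \<rho>" "pm t y z' \<rho>" for t y z z'
      using fn_unique[OF \<rho>v(2)[OF that(1)] that(2,3)] .
  qed blast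
  have "comp v0 h th m" unfolding comp_def
  proof (intro allI impI)
    fix t q assume t: "v0 \<sqsubseteq> t" and q: "D t q"
    have wt: "w0 \<sqsubseteq> t" using w0_le[OF t] .
    note mt = Pf_map_pm[OF wt Pf_map_mono[OF mP t]]
    show "M t q h \<longleftrightarrow> (\<exists>x. D t x \<and> (\<exists>y. D t y \<and> (\<exists>z. D t z \<and> op t q x z \<and> pm t x y m \<and> pm t y z th)))"
    proof
      assume "M t q h"
      then obtain x y z where xyz: "op t q x z" "pm t x y st" "pm t y z \<rho>"
        using comp_iff[OF comp_mono[OF h(2) t] q] by blast
      have "M t x P" using fn_in(1)[OF fn_mono[OF st(2) wt] xyz(2)] .
      then obtain a s where a: "M t a A" "op t x a s" "fam t a s W" using Pel[OF t] by blast
      have y: "sup t y a s" using st_iff[OF wt a(2)] xyz(2) by blast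
      obtain s' where s': "comp t s' \<rho> s" "fam t a s' Y" using comp_fam_fn[OF t \<rho>v(1,2)[OF t] a(3)] by blast
      obtain z' where z': "tval t a s' z'" using tval_ex[OF t a(1) s'(2)] by blast
      have "pm t y z' \<rho>" using recursive_value[OF t \<rho>v(3,2)[OF t] a(3) y s'(1) z'] .
      then have e: "E t z' z" using fn_unique[OF \<rho>v(2)[OF t] _ xyz(3)] by blast
      obtain p where p: "op t p a s'" "pm t p z' th" using z' unfolding tval_def by blast
      have "pm t p z th" using pm_cong[OF p(2) _ e] E_refl pm_D[OF p(2)] by blast
      moreover have "pm t x p m" using mt a p(1) s'(1) by blast
      ultimately show "\<exists>x. D t x \<and> (\<exists>y. D t y \<and> (\<exists>z. D t z \<and> op t q x z \<and> pm t x y m \<and> pm t y z th))"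
        using xyz(1) op_D(2,3)[OF xyz(1)] op_D(1)[OF p(1)] by blast
    next
      assume "\<exists>x. D t x \<and> (\<exists>y. D t y \<and> (\<exists>z. D t z \<and> op t q x z \<and> pm t x y m \<and> pm t y z th))"
      then obtain x p z where x: "op t q x z" "pm t x p m" "pm t p z th" by blast
      obtain a s s' where a: "M t a A" "op t x a s" "fam t a s W" "op t p a s'" "comp t s' \<rho> s"
        using mt x(2) by blast
      obtain y where y: "sup t y a s" using sup_exists[OF wt a(1) fam_T[OF wt a(3)]] by blast
      have "pm t x y st" using st_iff[OF wt a(2)] a(1,3) y by blast
      moreover have "tval t a s' z" using a(4) x(3) unfolding tval_def by blast
      then have "pm t y z \<rho>" using recursive_value[OF t \<rho>v(3,2)[OF t] a(3) y a(5)] by blast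
      ultimately show "M t q h" using comp_iff[OF comp_mono[OF h(2) t] q] x(1) by blast
    qed
  qed
  then show ?thesis unfolding morphism_def using \<rho>(2) m(1) h mP by blast
qed

text \<open>Induction over the trees where both functions agree. At the tree of (a, s) each value is
  \<open>th\<close> at \<open>a\<close> and the composite with s, and the composites coincide
  because the functions agree on all subtrees.\<close>

lemma morphism_unique:
  assumes \<rho>: "D v0 \<rho>" "fn v0 \<rho> W Y" "recursive v0 \<rho>"
    and v: "v0 \<sqsubseteq> v" and \<beta>: "D v \<beta>" "morphism v \<beta> W st Y th"
  shows "E v \<beta> \<rho>"
proof -
  have wv: "w0 \<sqsubseteq> v" using w0_le[OF v] .
  have \<rho>v: "D t \<rho>" "fn t \<rho> W Y" "recursive t \<rho>" if t: "v0 \<sqsubseteq> t" for t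
    using D_mono[OF \<rho>(1) t] fn_mono[OF \<rho>(2) t] \<rho>(3) le_trans[OF t] unfolding recursive_def by blast+
  obtain m h where mh: "fn v \<beta> W Y" "Pf_map v m \<beta> W" "comp v h \<beta> st" "comp v h th m"
    using \<beta>(2) unfolding morphism_def by blast
  \<comment> \<open>One inclusion between the values is enough to separate by: \<rho> is total and
    \<beta> functional, which gives the converse.\<close>
  let ?K = "\<lambda>t y. \<forall>t1. t \<sqsubseteq> t1 \<longrightarrow> (\<forall>z. M t1 z Y \<longrightarrow> (\<forall>u. t1 \<sqsubseteq> u \<longrightarrow> pm u y z \<rho> \<longrightarrow> pm u y z \<beta>))"
  have Dv: "D v Y" "D v \<rho>" "D v W" using D_mono[OF Y v] \<rho>v(1)[OF v] D_mono[OF W(1) wv] by blast+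
  obtain Z where Z: "D v Z" "\<And>t y. v \<sqsubseteq> t \<Longrightarrow> M t y Z \<longleftrightarrow> M t y W \<and> ?K t y"
    by (rule separation[where ps = "[Y, \<rho>, \<beta>]" and w = v and a = W and K = ?K and
        F = "ball 0 (\<lambda>z. b_pm 3 z 1 \<^bold>\<longrightarrow> b_pm 3 z 2)"]) (use Dv \<beta>(1) in auto)
  have ZW: "sub v Z W" unfolding sub_def using Z(2) by blast
  have Z\<beta>: "pm t y z \<rho> \<longleftrightarrow> pm t y z \<beta>" if t: "v \<sqsubseteq> t" and y: "M t y Z" for t y z
  proof -
    have vt: "v0 \<sqsubseteq> t" using le_trans[OF v t] .
    have yW: "M t y W" using Z(2)[OF t] y by blast
    have imp: "pm t y c \<beta>" if "pm t y c \<rho>" for c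
      using Z(2)[OF t] y that fn_in(2)[OF \<rho>v(2)[OF vt] that] le_refl[of t] by blast
    show ?thesis
    proof
      assume z: "pm t y z \<beta>"
      obtain c where c: "pm t y c \<rho>" using fn_ex[OF \<rho>v(2)[OF vt] yW] by blast
      have "E t c z" using fn_unique[OF fn_mono[OF mh(1) t] imp[OF c] z] .
      then show "pm t y z \<rho>" using pm_cong[OF c] E_refl pm_D[OF c] by blast
    qed (rule imp)
  qed
  have "sub v W Z"
  proof (rule W_induct[OF wv Z(1) ZW])
    fix t y a s assume t: "v \<sqsubseteq> t" and a: "M t a A" "fam t a s Z" "sup t y a s"
    have wt: "w0 \<sqsubseteq> t" using le_trans[OF wv t] .
    have sW: "fam t a s W" using fam_sub[OF a(2) sub_mono[OF ZW t]] .
    have yW: "M t y W" using W_sup[OF wt a(1) sW a(3)] .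
    have "pm u y z \<beta>" if u: "t \<sqsubseteq> u" and z: "pm u y z \<rho>" for u z
    proof -
      have vu: "v \<sqsubseteq> u" and v0u: "v0 \<sqsubseteq> u" and wu: "w0 \<sqsubseteq> u"
        using le_trans[OF t u] le_trans[OF v le_trans[OF t u]] le_trans[OF wt u] .
      note \<rho>u = \<rho>v[OF v0u] and au = M_mono[OF a(1) u] and su = fam_mono[OF sW u] and yu = sup_mono[OF a(3) u]
      obtain s' where s': "comp u s' \<rho> s" "fam u a s' Y" using comp_fam_fn[OF v0u \<rho>u(1,2) su] by blast
      obtain c where c: "tval u a s' c" using tval_ex[OF v0u au s'(2)] by blast
      have "pm u y c \<rho>" using recursive_value[OF v0u \<rho>u(3,2) su yu s'(1) c] .
      then have cz: "E u c z" using fn_unique[OF \<rho>u(2) _ z] by blast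
      obtain z' where z': "pm u y z' \<beta>" using fn_ex[OF fn_mono[OF mh(1) vu] M_mono[OF yW u]] by blast
      have "D u s" using su unfolding fam_def by blast
      then obtain x where x: "op u x a s" using op_exists M_Ds(1)[OF au] by blast
      have "pm u x y st" using st_iff[OF wu x] au su yu by blast
      then have "pm u x z' h" using comp_pm[OF comp_mono[OF mh(3) vu]] z' by blast
      then obtain x2 where x2: "pm u x x2 m" "pm u x2 z' th"
        using comp_pm[OF comp_mono[OF mh(4) vu]] by blast
      obtain a2 s2 s2' where 2: "op u x a2 s2" "op u x2 a2 s2'" "comp u s2' \<beta> s2"
        using Pf_map_pm[OF wu Pf_map_mono[OF mh(2) vu]] x2(1) by blast
      have e: "E u a2 a" "E u s2 s" using op_inj[OF 2(1) x] .
      have comp2: "comp u s2' \<beta> s" using comp_cong[OF 2(3) e(2)] .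
      \<comment> \<open>The composites of \<beta> and \<rho> with s are compared pointwise; the
        values of s lie in \<open>Z\<close>, where the two functions agree.\<close>
      have "E u s2' s'"
      proof (rule extensionality)
        show "D u s2'" "D u s'" using op_D(3)[OF 2(2)] s'(2) unfolding fam_def by blast+
        fix u1 q assume u1: "u \<sqsubseteq> u1"
        have "pm u1 y1 c \<rho> \<longleftrightarrow> pm u1 y1 c \<beta>" if "pm u1 b y1 s" for b y1 c
          using Z\<beta>[OF le_trans[OF vu u1] fam_in(2)[OF fam_mono[OF a(2) le_trans[OF u u1]] that]] .
        then show "M u1 q s2' \<longleftrightarrow> M u1 q s'"
          using comp_iff[OF comp_mono[OF comp2 u1], of q] comp_iff[OF comp_mono[OF s'(1) u1], of q]
            M_Ds(1)[of u1 q] by blast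
      qed
      then have "op u x2 a s'" using op_cong[OF 2(2) _ e(1)] op_self[OF 2(2)] by blast
      then have "tval u a s' z'" using x2(2) unfolding tval_def by blast
      then have "E u c z'" using tval_unique[OF v0u c] op_self[OF x] E_refl s'(2) unfolding fam_def by blast
      then have "E u z' z" using cz E_sym E_trans by blast
      then show ?thesis using pm_cong[OF z'] E_refl pm_D[OF z'] by blast
    qed
    then have "?K t y" using le_trans by blast
    then show "M t y Z" using Z(2)[OF t] yW by blast
  qed
  then have eq: "pm t y z \<rho> \<longleftrightarrow> pm t y z \<beta>" if "v \<sqsubseteq> t" "M t y W" for t y z
    using Z\<beta> that unfolding sub_def by blast
  show ?thesis
  proof (rule extensionality[OF \<beta>(1) Dv(2)])
    fix t p assume t: "v \<sqsubseteq> t"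
    have vt: "v0 \<sqsubseteq> t" using le_trans[OF v t] .
    have "\<exists>y z. M t y W \<and> op t p y z" if "M t p \<beta> \<or> M t p \<rho>"
      using that fn_elem[OF fn_mono[OF mh(1) t]] fn_elem[OF \<rho>v(2)[OF vt]] by blast
    then show "M t p \<beta> \<longleftrightarrow> M t p \<rho>" using eq[OF t] pm_op by blast
  qed
qed

end

context czf
begin

text \<open>The tree construction is carried out once at the world \<open>w\<close>; its results
  persist, while the recursion is instantiated anew for each algebra at a later world.\<close>

lemma initial_algebra:
  assumes D: "D w A" "D w B" "D w f" and f: "fn w f B A"
  shows "fs pr (\<^bold>\<exists>W. \<^bold>\<exists>s. is_initial_algebra 2 1 0 W s) w [A, B, f]"
proof -
  interpret family le D M E w A B f
  proof
    show "M v b B \<and> M v a A" if "w \<sqsubseteq> v" "pm v b a f" for v b a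
      using fn_in[OF fn_mono[OF f that(1)] that(2)] by blast
    show "\<exists>a. pm v b a f" if "w \<sqsubseteq> v" "M v b B" for v b
      using fn_ex[OF fn_mono[OF f that(1)] that(2)] .
    show "E v a a'" if "w \<sqsubseteq> v" "pm v b a f" "pm v b a' f" for v b a a'
      using fn_unique[OF fn_mono[OF f that(1)] that(2,3)] .
  qed (rule D)+
  obtain P st where P: "D w P" "Pf w P W" and st: "D w st" "fn w st P W"
    and st_iff: "\<And>v p a s y. w \<sqsubseteq> v \<Longrightarrow> op v p a s \<Longrightarrow>
      pm v p y st \<longleftrightarrow> M v a A \<and> fam v a s W \<and> sup v y a s"
    using algebra_exists by blast
  have initial: "\<exists>\<alpha>. D v \<alpha> \<and> morphism v \<alpha> W st Y t \<and>
      (\<forall>u. v \<sqsubseteq> u \<longrightarrow> (\<forall>\<beta>. D u \<beta> \<longrightarrow> morphism u \<beta> W st Y t \<longrightarrow> E u \<beta> \<alpha>))"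
    if v: "w \<sqsubseteq> v" and Y: "D v Y" "D v t" "algebra v Y t" for v Y t
  proof -
    obtain PY where PY: "D v PY" "Pf v PY Y" "fn v t PY Y" using Y(3) unfolding algebra_def by blast
    \<comment> \<open>Here the base world of the recursion is the world \<open>v\<close> at which
      the algebra is given.\<close>
    interpret recursion le D M E w A B f P st v Y PY t
      by unfold_locales (use P st st_iff v Y PY in auto)
    obtain \<rho> where \<rho>: "D v \<rho>" "fn v \<rho> W Y" "recursive v \<rho>" by (rule rec_graph_exists)
    then show ?thesis using morphism_exists[OF \<rho>] morphism_unique[OF \<rho>] by blast
  qed
  have alg: "fs pr (is_algebra 2 1 0 3 4) w [A, B, f, W, st]"
    using fs_is_algebra[of "[A, B, f, W, st]" w 3 4 pr] le_refl[of w] P st unfolding algebra_def by auto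
  have "fs pr (\<^bold>\<forall>Y. \<^bold>\<forall>t. is_algebra 2 1 0 Y t \<^bold>\<longrightarrow> (\<^bold>\<exists>\<^bold>!\<alpha>. is_morphism 2 1 0 \<alpha> 3 4 Y t)) w [A, B, f, W, st]"
    unfolding fs_all fs_imp
  proof (intro allI impI)
    fix v1 Y v2 t v assume v1: "w \<sqsubseteq> v1" "D v1 Y" "v1 \<sqsubseteq> v2" "D v2 t" "v2 \<sqsubseteq> v"
    let ?e = "[A, B, f, W, st, Y, t]"
    have v: "w \<sqsubseteq> v" "D v Y" "D v t" using v1 le_trans D_mono by meson+
    assume "fs pr (is_algebra 2 1 0 (length [A, B, f, W, st]) (length ([A, B, f, W, st] @ [Y]))) v
      (([A, B, f, W, st] @ [Y]) @ [t])"
    then have "algebra v Y t"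
      using fs_is_algebra[of ?e v "length [A, B, f, W, st]" "length ([A, B, f, W, st] @ [Y])" pr] v(1) by simp
    from initial[OF v this] obtain \<alpha> where \<alpha>: "D v \<alpha>" "morphism v \<alpha> W st Y t"
      "\<forall>u. v \<sqsubseteq> u \<longrightarrow> (\<forall>\<beta>. D u \<beta> \<longrightarrow> morphism u \<beta> W st Y t \<longrightarrow> E u \<beta> \<alpha>)" by blast
    have 1: "fs pr (is_morphism 2 1 0 (length ?e) 3 4 (length [A, B, f, W, st]) (length ([A, B, f, W, st] @ [Y])))
        v (?e @ [\<alpha>])"
      using fs_is_morphism[of "?e @ [\<alpha>]" v "length ?e" 3 4 "length [A, B, f, W, st]"
          "length ([A, B, f, W, st] @ [Y])" pr] v(1) \<alpha>(2) by simp
    have 2: "fs pr (is_morphism 2 1 0 (length (?e @ [\<alpha>])) 3 4 (length [A, B, f, W, st])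
        (length ([A, B, f, W, st] @ [Y]))) u (?e @ [\<alpha>, \<beta>]) \<longleftrightarrow> morphism u \<beta> W st Y t"
      if "v \<sqsubseteq> u" for u \<beta>
      using fs_is_morphism[of "?e @ [\<alpha>, \<beta>]" u "length (?e @ [\<alpha>])" 3 4 "length [A, B, f, W, st]"
          "length ([A, B, f, W, st] @ [Y])" pr] le_trans[OF v(1) that] by simp
    show "fs pr (\<^bold>\<exists>\<^bold>!\<alpha>. is_morphism 2 1 0 \<alpha> 3 4 (length [A, B, f, W, st]) (length ([A, B, f, W, st] @ [Y])))
        v (([A, B, f, W, st] @ [Y]) @ [t])"
      using 1 2 \<alpha>(1,3) by (auto simp: ex1_def)
  qed
  with alg have "fs pr (is_initial_algebra 2 1 0 3 4) w [A, B, f, W, st]"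
    by (simp add: is_initial_algebra_def del: fs_all_NO_MATCH fs_all_imp)
  then show ?thesis using W(1) st(1) by (auto simp: numeral_eq_Suc)
qed

lemma W_types: "fs pr W_types_exist w []"
  unfolding W_types_exist_def fs_all fs_imp
proof (intro allI impI)
  fix v1 A v2 B v3 f v
  assume v: "w \<sqsubseteq> v1" "D v1 A" "v1 \<sqsubseteq> v2" "D v2 B" "v2 \<sqsubseteq> v3" "D v3 f" "v3 \<sqsubseteq> v"
    and f: "fs pr (is_function (length (([] @ [A]) @ [B])) (length ([] @ [A])) (length [])) v ((([] @ [A]) @ [B]) @ [f])"
  have D: "D v A" "D v B" "D v f" using v D_mono le_trans by meson+
  have "fn v f B A" using f fs_is_function[of 2 "[A, B, f]" 1 0 pr v] by (simp add: numeral_eq_Suc)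
  from initial_algebra[OF D this, of pr]
  show "fs pr (\<^bold>\<exists>W. \<^bold>\<exists>s. is_initial_algebra (length (([] @ [A]) @ [B])) (length ([] @ [A])) (length []) W s) v
      ((([] @ [A]) @ [B]) @ [f])"
    by (simp add: numeral_eq_Suc)
qed

end

theorem theorem3p7: "CZF \<union> {toplevel NID} \<turnstile> toplevel W_types_exist"
proof (rule ccontr)
  let ?T = "CZF \<union> {toplevel NID}"
  assume "\<not> ?T \<turnstile> toplevel W_types_exist"
  then show False
    unfolding proves_def
  proof (rule kripke_completeness)
    fix w r
    assume w: "\<not> canonical.sat ?T (toplevel W_types_exist) w r"
    assume ax: "\<And>q v s. q \<in> ?T \<Longrightarrow> cworld ?T v \<Longrightarrow> (\<And>i. cdom ?T v (s i)) \<Longrightarrow> canonical.sat ?T q v s"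
    interpret czf "cle ?T" "cdom ?T" "cmem ?T" "ceq ?T"
    proof
      fix p w r assume p: "p \<in> ?T" and r: "\<And>i::nat. cdom ?T w (r i)"
      \<comment> \<open>The locale asks for the axioms at every pair of sets. An assignment into the
        domain exists only at genuine worlds, so completeness covers all cases.\<close>
      have "cworld ?T w" using r[of 0] unfolding cdom_def by blast
      then show "canonical.sat ?T p w r" using p r by (intro ax)
    qed
    show False using W_types[of r w] w by (simp add: canonical.fs_def toplevel_def)
  qed
qed

end
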